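(* Let $\mathcal T\subset\mathbb R$ be a closed finite interval, $k,r\in\mathbb N$, $\mathbf H\in\mathbb R^{r\times k}$ a fixed matrix and $\mathbf c:\mathcal T\to\mathbb R^r$ a fixed measurable function. Consider $k$ independent samples of real-valued stochastic processes on $\mathcal T$, where for each $i\in\{1,\dots,k\}$ the $i$th sample is $x_{i1},\dots,x_{in_i}$, $n=\sum_{i=1}^k n_i$, and put $v_{ij}:=x_{ij}-\eta_i$. Assume that for every $i\in\{1,\dots,k\}$: (i) $x_{i1},\dots,x_{in_i}$ are i.i.d. with mean function $\eta_i$ and covariance function $\gamma_i$ and take values in $\mathcal L_2(\mathcal T)$; (ii) $\eta_i\in\mathcal L_2(\mathcal T)$; (iii) the function $\mathcal T\ni t\mapsto\gamma_i(t,t)\in\mathbb R$ is continuous and positive; (iv) there exists $\tau_i>0$ such that $n_i/n\to\tau_i$ as $n\to\infty$; (v) for each $j\in\{1,2\}$, $\mathrm E_{\mathrm{out}}\Big[\sup_{t,s\in\mathcal T,\,|t-s|<\delta}|v_{i1}(t)v_{ij}(t)-v_{i1}(s)v_{ij}(s)|\Big]\to0$ as $\delta\to0$. Assume moreover that the null hypothesis $\mathbf H\boldsymbol\eta(t)=\mathbf c(t)$ for all $t\in\mathcal T$ holds, where $\boldsymbol\eta=(\eta_1,\dots,\eta_k)^\top$. Let $\mathbf z\sim GP_r(\mathbf 0_r,\mathbf H\boldsymbol\Sigma\mathbf H^\top)$. Then, as $n\to\infty$, $$T_n(\mathbf H,\mathbf c)\xrightarrow{d}\int_{\mathcal T}\mathbf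 z^\top(t)\big(\mathbf H\boldsymbol\Sigma(t,t)\mathbf H^\top\big)^+\mathbf z(t)\,\mathrm dt .$$
   Context: $\mathcal L_2(\mathcal T)$ is the Hilbert space of square-integrable real functions on $\mathcal T$. $\mathrm E_{\mathrm{out}}$ is outer expectation. $\mathbf A^+$ is the Moore–Penrose inverse of $\mathbf A$. $GP_r(\mathbf 0_r,\boldsymbol\Gamma)$ denotes an $r$-dimensional centered Gaussian process on $\mathcal T$ (all finite-dimensional distributions Gaussian), viewed as a random element of $\mathcal L_2^r(\mathcal T)$, with covariance function $\boldsymbol\Gamma:\mathcal T^2\to\mathbb R^{r\times r}$. $\xrightarrow{d}$ is convergence in distribution in the sense of van der Vaart and Wellner (outer expectations of bounded continuous functions converge). Define $$\boldsymbol\Sigma(t,s):=\mathrm{diag}\Big(\tfrac1{\tau_1}\gamma_1(t,s),\dots,\tfrac1{\tau_k}\gamma_k(t,s)\Big).$$ Estimators: $\widehat\eta_i(t):=\frac1{n_i}\sum_{j=1}^{n_i}x_{ij}(t)$, $\widehat{\boldsymbol\eta}:=(\widehat\eta_1,\dots,\widehat\eta_k)^\top$, $$\widehat\gamma_i(t,s):=\frac1{n_i-1}\sum_{j=1}^{n_i}(x_{ij}(t)-\widehat\eta_i(t))(x_{ij}(s)-\widehat\eta_i(s)),\qquad \widehat{\boldsymbol\Sigma}(t,s):=\mathrm{diag}\Big(\tfrac n{n_1}\widehat\gamma_1(t,s),\dots,\tfrac n{n_k}\widehat\gamma_k(t,s)\Big).$$ The globalizing point-wise Hotelling's $T^2$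 (GPH) statistic is $$T_n(\mathbf H,\mathbf c):=\int_{\mathcal T}n\,(\mathbf H\widehat{\boldsymbol\eta}(t)-\mathbf c(t))^\top\big(\mathbf H\widehat{\boldsymbol\Sigma}(t,t)\mathbf H^\top\big)^+(\mathbf H\widehat{\boldsymbol\eta}(t)-\mathbf c(t))\,\mathrm dt .$$ *)

theory Defs
  imports "HOL-Probability.Probability"
begin

section \<open>Outer expectation and weak convergence of possibly non-measurable maps\<close>

text \<open>The expectation of an extended-real function, as the difference of the integrals of its
  positive and negative part; it exists unless both are infinite.\<close>

definition ereal_expectation :: "'w measure \<Rightarrow> ('w \<Rightarrow> ereal) \<Rightarrow> ereal" where
  "ereal_expectation M U =
     enn2ereal (\<integral>\<^sup>+ \<omega>. e2ennreal (U \<omega>) \<partial>M) - enn2ereal (\<integral>\<^sup>+ \<omega>. e2ennreal (- U \<omega>) \<partial>M)"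

definition ereal_expectation_exists :: "'w measure \<Rightarrow> ('w \<Rightarrow> ereal) \<Rightarrow> bool" where
  "ereal_expectation_exists M U \<longleftrightarrow>
     (\<integral>\<^sup>+ \<omega>. e2ennreal (U \<omega>) \<partial>M) < \<infinity> \<or> (\<integral>\<^sup>+ \<omega>. e2ennreal (- U \<omega>) \<partial>M) < \<infinity>"

definition outer_expectation :: "'w measure \<Rightarrow> ('w \<Rightarrow> ereal) \<Rightarrow> ereal" where
  "outer_expectation M f =
     Inf {ereal_expectation M U | U. U \<in> borel_measurable M \<and> ereal_expectation_exists M U
                                   \<and> (\<forall>\<omega>\<in>space M. f \<omega> \<le> U \<omega>)}"

text \<open>Convergence in distribution in the sense of van der Vaart and Wellner, for real-valued maps:
  the \<open>X n\<close> may be arbitrary maps, only the limit has to be a random variable.\<close>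

definition converges_in_distribution ::
  "'w measure \<Rightarrow> (nat \<Rightarrow> 'w \<Rightarrow> real) \<Rightarrow> 'v measure \<Rightarrow> ('v \<Rightarrow> real) \<Rightarrow> bool" where
  "converges_in_distribution M X N Y \<longleftrightarrow>
     Y \<in> borel_measurable N \<and>
     (\<forall>f :: real \<Rightarrow> real. continuous_on UNIV f \<longrightarrow> bounded (range f) \<longrightarrow>
        (\<lambda>n. outer_expectation M (\<lambda>\<omega>. ereal (f (X n \<omega>))))
          \<longlonglongrightarrow> ereal (\<integral>v. f (Y v) \<partial>N))"


section \<open>Stochastic processes with square-integrable paths\<close>

definition square_integrable :: "real set \<Rightarrow> (real \<Rightarrow> 'b::euclidean_space) \<Rightarrow> bool" where
  "square_integrable T f \<longleftrightarrow>
     f \<in> borel_measurable (lebesgue_on T) \<and> integrable (lebesgue_on T) (\<lambda>t. (norm (f t))\<^sup>2)"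

text \<open>A process (with pointwise defined values) viewed as a random element of the space of
  square-integrable functions on \<open>T\<close>. Joint measurability ties the pointwise random variables
  to the path as an element of that space: without it, the finite-dimensional distributions
  (and hence mean and covariance function) do not determine the distribution of the path.\<close>

definition L2_process :: "'w measure \<Rightarrow> real set \<Rightarrow> ('w \<Rightarrow> real \<Rightarrow> 'b::euclidean_space) \<Rightarrow> bool" where
  "L2_process M T X \<longleftrightarrow>
     (\<lambda>(\<omega>, t). X \<omega> t) \<in> borel_measurable (M \<Otimes>\<^sub>M lebesgue_on T) \<and>
     (\<forall>\<omega>\<in>space M. square_integrable T (X \<omega>))"

text \<open>The path restricted to \<open>T\<close>, as an element of the product space \<open>\<real>\<^sup>T\<close>.\<close>

definition path_on :: "real set \<Rightarrow> ('w \<Rightarrow> real \<Rightarrow> real) \<Rightarrow> 'w \<Rightarrow> real \<Rightarrow> real" where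
  "path_on T X \<omega> = restrict (X \<omega>) T"

abbreviation path_space :: "real set \<Rightarrow> (real \<Rightarrow> real) measure" where
  "path_space T \<equiv> PiM T (\<lambda>_. borel)"

definition has_mean_function ::
  "'w measure \<Rightarrow> real set \<Rightarrow> ('w \<Rightarrow> real \<Rightarrow> real) \<Rightarrow> (real \<Rightarrow> real) \<Rightarrow> bool" where
  "has_mean_function M T X m \<longleftrightarrow>
     (\<forall>t\<in>T. integrable M (\<lambda>\<omega>. X \<omega> t) \<and> (\<integral>\<omega>. X \<omega> t \<partial>M) = m t)"

definition covariance :: "'w measure \<Rightarrow> ('w \<Rightarrow> real) \<Rightarrow> ('w \<Rightarrow> real) \<Rightarrow> real" where
  "covariance M X Y =
     (\<integral>\<omega>. (X \<omega> - (\<integral>\<omega>'. X \<omega>' \<partial>M)) * (Y \<omega> - (\<integral>\<omega>'. Y \<omega>' \<partial>M)) \<partial>M)"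

definition has_covariance_function ::
  "'w measure \<Rightarrow> real set \<Rightarrow> ('w \<Rightarrow> real \<Rightarrow> real) \<Rightarrow> (real \<Rightarrow> real \<Rightarrow> real) \<Rightarrow> bool" where
  "has_covariance_function M T X g \<longleftrightarrow>
     (\<forall>t\<in>T. integrable M (\<lambda>\<omega>. (X \<omega> t)\<^sup>2)) \<and>
     (\<forall>t\<in>T. \<forall>s\<in>T. covariance M (\<lambda>\<omega>. X \<omega> t) (\<lambda>\<omega>. X \<omega> s) = g t s)"


section \<open>Gaussian processes\<close>

text \<open>Degenerate normal distributions are included, as a covariance matrix may be singular.\<close>

definition gaussian_variable :: "'v measure \<Rightarrow> ('v \<Rightarrow> real) \<Rightarrow> bool" where
  "gaussian_variable N X \<longleftrightarrow>
     X \<in> borel_measurable N \<and>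
     ((\<exists>\<mu> \<sigma>. \<sigma> > 0 \<and> distr N borel X = density lborel (\<lambda>y. ennreal (normal_density \<mu> \<sigma> y))) \<or>
      (\<exists>\<mu>. distr N borel X = return borel \<mu>))"

text \<open>A random vector is Gaussian iff all its linear combinations are; here the vector is
  \<open>(z t)\<^bsub>t \<in> F\<^esub>\<close> and the coefficients are \<open>a t \<in> \<real>\<^sup>r\<close>.\<close>

definition centered_gaussian_process ::
  "'v measure \<Rightarrow> real set \<Rightarrow> (real \<Rightarrow> real \<Rightarrow> real^'r^'r) \<Rightarrow> ('v \<Rightarrow> real \<Rightarrow> real^'r::finite) \<Rightarrow> bool" where
  "centered_gaussian_process N T \<Gamma> z \<longleftrightarrow>
     L2_process N T z \<and>
     (\<forall>F a. finite F \<longrightarrow> F \<subseteq> T \<longrightarrow> gaussian_variable N (\<lambda>v. \<Sum>t\<in>F. a t \<bullet> z v t)) \<and>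
     (\<forall>t\<in>T. \<forall>p. (\<integral>v. z v t $ p \<partial>N) = 0) \<and>
     (\<forall>t\<in>T. \<forall>s\<in>T. \<forall>p q. covariance N (\<lambda>v. z v t $ p) (\<lambda>v. z v s $ q) = \<Gamma> t s $ p $ q)"


section \<open>The test statistic\<close>

definition pinv :: "real^'n^'m \<Rightarrow> real^'m^'n" where
  "pinv A = (THE X. A ** X ** A = A \<and> X ** A ** X = X \<and>
                    transpose (A ** X) = A ** X \<and> transpose (X ** A) = X ** A)"

definition diag_matrix :: "('k \<Rightarrow> real) \<Rightarrow> real^'k^'k" where
  "diag_matrix d = (\<chi> i j. if i = j then d i else 0)"

text \<open>In the following, \<open>ns i\<close> is the size of the \<open>i\<close>-th sample and \<open>x i j\<close>, for
  \<open>j \<in> {1..ns i}\<close>, are its (observed) members.\<close>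

definition total_size :: "('k::finite \<Rightarrow> nat) \<Rightarrow> nat" where
  "total_size ns = (\<Sum>i\<in>UNIV. ns i)"

definition sample_mean ::
  "('k \<Rightarrow> nat) \<Rightarrow> ('k \<Rightarrow> nat \<Rightarrow> real \<Rightarrow> real) \<Rightarrow> 'k \<Rightarrow> real \<Rightarrow> real" where
  "sample_mean ns x i t = (\<Sum>j=1..ns i. x i j t) / real (ns i)"

definition sample_mean_vec ::
  "('k::finite \<Rightarrow> nat) \<Rightarrow> ('k \<Rightarrow> nat \<Rightarrow> real \<Rightarrow> real) \<Rightarrow> real \<Rightarrow> real^'k" where
  "sample_mean_vec ns x t = (\<chi> i. sample_mean ns x i t)"

definition sample_cov ::
  "('k \<Rightarrow> nat) \<Rightarrow> ('k \<Rightarrow> nat \<Rightarrow> real \<Rightarrow> real) \<Rightarrow> 'k \<Rightarrow> real \<Rightarrow> real \<Rightarrow> real" where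
  "sample_cov ns x i t s =
     (\<Sum>j=1..ns i. (x i j t - sample_mean ns x i t) * (x i j s - sample_mean ns x i s))
       / (real (ns i) - 1)"

definition Sigma_hat ::
  "('k::finite \<Rightarrow> nat) \<Rightarrow> ('k \<Rightarrow> nat \<Rightarrow> real \<Rightarrow> real) \<Rightarrow> real \<Rightarrow> real \<Rightarrow> real^'k^'k" where
  "Sigma_hat ns x t s =
     diag_matrix (\<lambda>i. real (total_size ns) / real (ns i) * sample_cov ns x i t s)"

definition Sigma_cov ::
  "('k::finite \<Rightarrow> real) \<Rightarrow> ('k \<Rightarrow> real \<Rightarrow> real \<Rightarrow> real) \<Rightarrow> real \<Rightarrow> real \<Rightarrow> real^'k^'k" where
  "Sigma_cov \<tau> \<gamma> t s = diag_matrix (\<lambda>i. 1 / \<tau> i * \<gamma> i t s)"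

text \<open>If the (nonnegative) integrand is not integrable, the value below is 0 by the library
  convention; under the assumptions of the theorem this is an event of asymptotically
  vanishing probability, so the choice does not affect the limit.\<close>

definition GPH_statistic ::
  "real set \<Rightarrow> real^'k^'r \<Rightarrow> (real \<Rightarrow> real^'r) \<Rightarrow> ('k::finite \<Rightarrow> nat)
     \<Rightarrow> ('k \<Rightarrow> nat \<Rightarrow> real \<Rightarrow> real) \<Rightarrow> real" where
  "GPH_statistic T H c ns x =
     (\<integral>t. real (total_size ns) *
           ((H *v sample_mean_vec ns x t - c t) \<bullet>
            (pinv (H ** Sigma_hat ns x t t ** transpose H) *v (H *v sample_mean_vec ns x t - c t)))
      \<partial>lebesgue_on T)"

end

theory Submission
  imports Defs "HOL-Real_Asymp.Real_Asymp"
begin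

text \<open>Under the null hypothesis the statistic is the integral of the quadratic form of
  \<open>(H \<Sigma>\<^sub>n(t,t) H\<^sup>T)\<^sup>+\<close> in the vector \<open>y\<^sub>n(t) = H u\<^sub>n(t)\<close>, where \<open>u\<^sub>n\<close> is the normalized deviation of the
  sample means and \<open>\<Sigma>\<^sub>n\<close> the estimator of \<open>\<Sigma>\<close>.

  First replace \<open>\<Sigma>\<^sub>n\<close> by \<open>\<Sigma>\<close>. On the range of \<open>H\<close>, the quadratic form of \<open>(H D H\<^sup>T)\<^sup>+\<close> at \<open>H u\<close> is the
  minimum of \<open>\<Sum>\<^sub>i w\<^sub>i\<^sup>2 / D\<^sub>i\<close> over \<open>H w = H u\<close>, so a uniformly small relative error in the variances
  causes a small relative error of the integral. The sample variance at \<open>t\<close> is a combination of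
  the products \<open>v\<^sub>j(t) v\<^sub>k(t)\<close>; condition (v) bounds their oscillation in mean, for \<open>j = k\<close> as well as for
  \<open>j \<noteq> k\<close>, which reduces uniform consistency to a finite grid of times and the weak law of large numbers.

  It remains to treat the integral of \<open>q\<^sub>n(t) = y\<^sub>n(t)\<^sup>T A(t) y\<^sub>n(t)\<close> with a deterministic \<open>A\<close>. The paths of the limit process
  need not be continuous, so the integral is not a limit of Riemann sums. Instead, truncate
  \<open>q\<^sub>n\<close> at \<open>K\<close>: the \<open>m\<close>-th moment of the truncated integral is an \<open>m\<close>-fold integral of expectations of products at fixed
  times, which converge by the central limit theorem. As the truncated integral is bounded, its
  moments determine the limit law. The truncation error is controlled by the
  convergence of \<open>E q\<^sub>n(t)\<close>.\<close>

text \<open>The processes have only second moments, so powers of the untruncated integral need not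
  be integrable; truncation supplies the moments and the compact range on which polynomials
  approximate a test function. What has to be compared are characteristic functions at finitely many
  times and second moments, pointwise in the times; uniform bounds do the rest.

  The Moore-Penrose inverse is discontinuous in general and the rank of \<open>H\<close> is
  arbitrary. Under the null hypothesis, however, the statistic evaluates its quadratic form only on
  the range of \<open>H\<close>, and there a change of the positive variances acts multiplicatively.
  Errors are therefore kept relative: they multiply an integral whose mean is bounded.

  Condition (v) concerns the sample members 1 and 2 and a supremum that need not be measurable.
  Pairs of members have only two joint laws, one for equal and one for distinct indices, but only
  measurable functionals can be carried from one pair to another. The bounds so obtained hold for
  each fixed time outside a null set that depends on the time; Fubini turns this into almost every
  time, almost surely, which is all that an integral over time sees.\<close>

section \<open>Laws of integral functionals from finite-dimensional distributions\<close>

text \<open>A bounded continuous function on the line may fail to be uniformly continuous. An error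
  that grows with \<open>x\<close> repairs this at the price of a first-moment bound, which is
  available wherever the lemma is applied: \<open>x\<close> will be an integral of bounded
  mean.\<close>

lemma bounded_continuous_modulus:
  fixes f :: "real \<Rightarrow> real"
  assumes cont: "continuous_on UNIV f" and bdd: "bounded (range f)" and e: "e > 0"
  obtains \<kappa> where "\<kappa> \<ge> 0" "\<And>x y. \<bar>f x - f y\<bar> \<le> e * (1 + \<bar>x\<bar>) + \<kappa> * \<bar>x - y\<bar>"
proof -
  obtain B where B: "B > 0" "\<And>x. \<bar>f x\<bar> \<le> B"
    using bdd unfolding bounded_pos by auto
  \<comment> \<open>Beyond \<open>L\<close> the term \<open>e * \<bar>x\<bar>\<close> alone exceeds
    \<open>2 * B\<close>, the largest possible difference. The interval below extends further by 1,
    and the distance is capped by \<open>min d 1\<close>, so that \<open>y\<close> stays inside it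
    as well.\<close>
  define L where "L = 2 * B / e"
  have "uniformly_continuous_on {-L-1..L+1} f"
    by (intro compact_uniformly_continuous continuous_on_subset[OF cont]) auto
  then obtain d where d: "d > 0"
    "\<And>x y. x \<in> {-L-1..L+1} \<Longrightarrow> y \<in> {-L-1..L+1} \<Longrightarrow> dist y x < d \<Longrightarrow> dist (f y) (f x) < e"
    unfolding uniformly_continuous_on_def using e by metis
  define \<kappa> where "\<kappa> = 2 * B / min d 1"
  have bound: "\<bar>f x - f y\<bar> \<le> e * (1 + \<bar>x\<bar>) + \<kappa> * \<bar>x - y\<bar>" for x y
  proof -
    have 2: "\<bar>f x - f y\<bar> \<le> 2 * B"
      using B(2)[of x] B(2)[of y] by linarith
    have pos: "0 \<le> \<kappa> * \<bar>x - y\<bar>" "0 \<le> e * (1 + \<bar>x\<bar>)"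
      using B d e by (auto simp: \<kappa>_def)
    consider "\<bar>x\<bar> > L" | "\<bar>x - y\<bar> \<ge> min d 1" | "\<bar>x\<bar> \<le> L" "\<bar>x - y\<bar> < min d 1" by linarith
    then show ?thesis
    proof cases
      case 1
      then have "2 * B \<le> e * \<bar>x\<bar>" using e unfolding L_def by (simp add: field_simps)
      then show ?thesis using 2 pos e by (simp add: algebra_simps)
    next
      case 2
      then have "2 * B \<le> \<kappa> * \<bar>x - y\<bar>"
        using B d unfolding \<kappa>_def by (simp add: pos_le_divide_eq)
      then show ?thesis using \<open>\<bar>f x - f y\<bar> \<le> 2 * B\<close> pos by linarith
    next
      case 3
      then have "dist (f y) (f x) < e"
        by (intro d(2)) (auto simp: dist_real_def)
      then have "\<bar>f x - f y\<bar> \<le> e" by (simp add: dist_real_def)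
      moreover have "e \<le> e * (1 + \<bar>x\<bar>)" using e by (simp add: algebra_simps)
      ultimately show ?thesis using pos by linarith
    qed
  qed
  show thesis
    by (rule that[of \<kappa>]) (use B d bound in \<open>auto simp: \<kappa>_def\<close>)
qed

lemma finite_measure_PiM_const:
  assumes L: "finite_measure L"
  shows "finite_measure (PiM {..<m::nat} (\<lambda>_. L))"
proof -
  interpret L: finite_measure L by fact
  interpret PL: product_sigma_finite "\<lambda>_::nat. L" by unfold_locales
  show ?thesis
  proof
    have "emeasure (PiM {..<m} (\<lambda>_. L)) (space (PiM {..<m} (\<lambda>_. L))) = (\<Prod>k<m. emeasure L (space L))"
      unfolding space_PiM by (subst PL.emeasure_PiM) auto
    then show "emeasure (PiM {..<m} (\<lambda>_. L)) (space (PiM {..<m} (\<lambda>_. L))) \<noteq> \<infinity>"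
      by (simp add: ennreal_prod_eq_top power_eq_top_ennreal)
  qed
qed

lemma integral_functional_moment:
  fixes g :: "'w \<Rightarrow> 't \<Rightarrow> real"
  assumes M: "prob_space M" and L: "finite_measure L"
    and g[measurable]: "(\<lambda>(\<omega>, t). g \<omega> t) \<in> borel_measurable (M \<Otimes>\<^sub>M L)"
    and bound: "\<And>\<omega> t. \<omega> \<in> space M \<Longrightarrow> t \<in> space L \<Longrightarrow> 0 \<le> g \<omega> t \<and> g \<omega> t \<le> K"
  shows "(\<integral>\<omega>. (\<integral>t. g \<omega> t \<partial>L) ^ m \<partial>M)
       = (\<integral>ts. (\<integral>\<omega>. (\<Prod>k<m. g \<omega> (ts k)) \<partial>M) \<partial>PiM {..<m} (\<lambda>_. L))"
proof -
  interpret M: prob_space M by fact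
  interpret L: finite_measure L by fact
  interpret PL: product_sigma_finite "\<lambda>_::nat. L" by unfold_locales
  interpret P: finite_measure "PiM {..<m} (\<lambda>_. L)"
    by (rule finite_measure_PiM_const[OF L])
  interpret MP: pair_sigma_finite M "PiM {..<m} (\<lambda>_. L)" ..
  have meas[measurable]: "(\<lambda>(\<omega>, ts). \<Prod>k<m. g \<omega> (ts k)) \<in> borel_measurable (M \<Otimes>\<^sub>M PiM {..<m} (\<lambda>_. L))"
    unfolding split_beta
  proof (rule borel_measurable_prod)
    fix k assume "k \<in> {..<m}"
    then have [measurable]: "(\<lambda>x. snd x k) \<in> M \<Otimes>\<^sub>M PiM {..<m} (\<lambda>_. L) \<rightarrow>\<^sub>M L" by measurable
    have "(\<lambda>x. (case (fst x, snd x k) of (\<omega>, t) \<Rightarrow> g \<omega> t)) \<in> borel_measurable (M \<Otimes>\<^sub>M PiM {..<m} (\<lambda>_. L))"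
      by measurable
    then show "(\<lambda>x. g (fst x) (snd x k)) \<in> borel_measurable (M \<Otimes>\<^sub>M PiM {..<m} (\<lambda>_. L))" by simp
  qed
  have "(\<integral>ts. (\<integral>\<omega>. (\<Prod>k<m. g \<omega> (ts k)) \<partial>M) \<partial>PiM {..<m} (\<lambda>_. L))
      = (\<integral>\<omega>. (\<integral>ts. (\<Prod>k<m. g \<omega> (ts k)) \<partial>PiM {..<m} (\<lambda>_. L)) \<partial>M)"
  proof (rule MP.Fubini_integral)
    have fin: "finite_measure (M \<Otimes>\<^sub>M PiM {..<m} (\<lambda>_. L))"
      by (intro finite_measure_pair_measure M.finite_measure_axioms P.finite_measure_axioms)
    show "integrable (M \<Otimes>\<^sub>M PiM {..<m} (\<lambda>_. L)) (\<lambda>(\<omega>, ts). \<Prod>k<m. g \<omega> (ts k))"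
    proof (rule finite_measure.integrable_const_bound[OF fin, where B="K^m"], rule AE_I2, safe)
      fix \<omega> ts assume "(\<omega>, ts) \<in> space (M \<Otimes>\<^sub>M PiM {..<m} (\<lambda>_. L))"
      then have *: "\<omega> \<in> space M" "\<And>k. k < m \<Longrightarrow> ts k \<in> space L"
        by (auto simp: space_pair_measure space_PiM)
      have "(\<Prod>k<m. g \<omega> (ts k)) \<le> (\<Prod>k<m. K)"
        using bound[OF *(1) *(2)] by (intro prod_mono) auto
      moreover have "0 \<le> (\<Prod>k<m. g \<omega> (ts k))"
        using bound[OF *(1) *(2)] by (intro prod_nonneg) auto
      ultimately show "norm (\<Prod>k<m. g \<omega> (ts k)) \<le> K^m" by simp
    qed measurable
  qed
  also have "\<dots> = (\<integral>\<omega>. (\<integral>t. g \<omega> t \<partial>L) ^ m \<partial>M)"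
  proof (rule Bochner_Integration.integral_cong[OF refl])
    fix \<omega> assume w: "\<omega> \<in> space M"
    have int: "integrable L (g \<omega>)"
    proof (rule L.integrable_const_bound[where B=K])
      show "g \<omega> \<in> borel_measurable L" using w by measurable
    qed (use bound[OF w] in \<open>auto intro!: AE_I2\<close>)
    have "(\<integral>ts. (\<Prod>k<m. g \<omega> (ts k)) \<partial>PiM {..<m} (\<lambda>_. L)) = (\<Prod>k<m. \<integral>t. g \<omega> t \<partial>L)"
      by (rule PL.product_integral_prod) (auto intro: int)
    then show "(\<integral>ts. (\<Prod>k<m. g \<omega> (ts k)) \<partial>PiM {..<m} (\<lambda>_. L)) = (\<integral>t. g \<omega> t \<partial>L) ^ m" by simp
  qed
  finally show ?thesis ..
qed

text \<open>The inner expectations converge for each tuple of times and are bounded by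
  \<open>K ^ m\<close>, so dominated convergence on the finite product measure suffices; neither
  uniformity nor continuity in the times enters.\<close>

lemma integral_functional_moments_converge:
  fixes g :: "nat \<Rightarrow> 'w \<Rightarrow> 't \<Rightarrow> real" and h :: "'v \<Rightarrow> 't \<Rightarrow> real"
  assumes M: "prob_space M" and N: "prob_space N" and L: "finite_measure L"
    and g: "\<And>l. (\<lambda>(\<omega>, t). g l \<omega> t) \<in> borel_measurable (M \<Otimes>\<^sub>M L)"
    and h: "(\<lambda>(\<omega>, t). h \<omega> t) \<in> borel_measurable (N \<Otimes>\<^sub>M L)"
    and bg: "\<And>l \<omega> t. \<omega> \<in> space M \<Longrightarrow> t \<in> space L \<Longrightarrow> 0 \<le> g l \<omega> t \<and> g l \<omega> t \<le> K"
    and bh: "\<And>\<omega> t. \<omega> \<in> space N \<Longrightarrow> t \<in> space L \<Longrightarrow> 0 \<le> h \<omega> t \<and> h \<omega> t \<le> K"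
    and fdd: "\<And>(m::nat) ts. (\<And>k. k < m \<Longrightarrow> ts k \<in> space L) \<Longrightarrow>
       (\<lambda>l. \<integral>\<omega>. (\<Prod>k<m. g l \<omega> (ts k)) \<partial>M) \<longlonglongrightarrow> (\<integral>\<omega>. (\<Prod>k<m. h \<omega> (ts k)) \<partial>N)"
  shows "(\<lambda>l. \<integral>\<omega>. (\<integral>t. g l \<omega> t \<partial>L) ^ m \<partial>M) \<longlonglongrightarrow> (\<integral>\<omega>. (\<integral>t. h \<omega> t \<partial>L) ^ m \<partial>N)"
proof -
  interpret M: prob_space M by fact
  interpret N: prob_space N by fact
  interpret L: finite_measure L by fact
  interpret PL: product_sigma_finite "\<lambda>_::nat. L" by unfold_locales
  have fin: "finite_measure (PiM {..<m} (\<lambda>_. L))"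
    by (rule finite_measure_PiM_const[OF L])
  have meas: "(\<lambda>ts. \<integral>\<omega>. (\<Prod>k<m. f \<omega> (ts k)) \<partial>R) \<in> borel_measurable (PiM {..<m} (\<lambda>_. L))"
    if R: "prob_space R" and f[measurable]: "(\<lambda>(\<omega>, t). f \<omega> t) \<in> borel_measurable (R \<Otimes>\<^sub>M L)"
    for R :: "'x measure" and f :: "'x \<Rightarrow> 't \<Rightarrow> real"
  proof -
    interpret R: prob_space R by fact
    have [measurable]: "(\<lambda>(ts, \<omega>). \<Prod>k<m. f \<omega> (ts k)) \<in> borel_measurable (PiM {..<m} (\<lambda>_. L) \<Otimes>\<^sub>M R)"
      unfolding split_beta
    proof (rule borel_measurable_prod)
      fix k assume "k \<in> {..<m}"
      then have [measurable]: "(\<lambda>x. fst x k) \<in> PiM {..<m} (\<lambda>_. L) \<Otimes>\<^sub>M R \<rightarrow>\<^sub>M L" by measurable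
      have "(\<lambda>x. (case (snd x, fst x k) of (\<omega>, t) \<Rightarrow> f \<omega> t)) \<in> borel_measurable (PiM {..<m} (\<lambda>_. L) \<Otimes>\<^sub>M R)"
        by measurable
      then show "(\<lambda>x. f (snd x) (fst x k)) \<in> borel_measurable (PiM {..<m} (\<lambda>_. L) \<Otimes>\<^sub>M R)" by simp
    qed
    show ?thesis by measurable
  qed
  have bound: "norm (\<integral>\<omega>. (\<Prod>k<m. f \<omega> (ts k)) \<partial>R) \<le> K ^ m"
    if R: "prob_space R" and ts: "ts \<in> space (PiM {..<m} (\<lambda>_. L))"
      and f: "\<And>\<omega> t. \<omega> \<in> space R \<Longrightarrow> t \<in> space L \<Longrightarrow> 0 \<le> f \<omega> t \<and> f \<omega> t \<le> K"
    for R :: "'x measure" and f :: "'x \<Rightarrow> 't \<Rightarrow> real" and ts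
  proof -
    interpret R: prob_space R by fact
    have ts': "\<And>k. k < m \<Longrightarrow> ts k \<in> space L" using ts by (auto simp: space_PiM)
    have b: "0 \<le> (\<Prod>k<m. f \<omega> (ts k)) \<and> (\<Prod>k<m. f \<omega> (ts k)) \<le> K ^ m" if "\<omega> \<in> space R" for \<omega>
    proof
      show "0 \<le> (\<Prod>k<m. f \<omega> (ts k))"
        using f[OF that ts'] by (intro prod_nonneg) auto
      have "(\<Prod>k<m. f \<omega> (ts k)) \<le> (\<Prod>k<m. K)"
        using f[OF that ts'] by (intro prod_mono) auto
      then show "(\<Prod>k<m. f \<omega> (ts k)) \<le> K ^ m" by simp
    qed
    have "0 \<le> (\<integral>\<omega>. (\<Prod>k<m. f \<omega> (ts k)) \<partial>R)"
      by (rule integral_nonneg_AE) (use b in auto)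
    moreover have "(\<integral>\<omega>. (\<Prod>k<m. f \<omega> (ts k)) \<partial>R) \<le> K ^ m"
    proof (cases "integrable R (\<lambda>\<omega>. \<Prod>k<m. f \<omega> (ts k))")
      case True
      then show ?thesis by (intro R.integral_le_const) (use b in auto)
    next
      \<comment> \<open>Here the integral is 0 by convention, and any point of the space yields
        \<open>0 \<le> K ^ m\<close>.\<close>
      case False
      obtain \<omega> where "\<omega> \<in> space R" using R.not_empty by auto
      then show ?thesis using b[of \<omega>] False by (simp add: not_integrable_integral_eq)
    qed
    ultimately show ?thesis by simp
  qed
  have eq1: "(\<integral>\<omega>. (\<integral>t. g l \<omega> t \<partial>L) ^ m \<partial>M)
       = (\<integral>ts. (\<integral>\<omega>. (\<Prod>k<m. g l \<omega> (ts k)) \<partial>M) \<partial>PiM {..<m} (\<lambda>_. L))" for l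
    by (rule integral_functional_moment[OF M L g]) (rule bg)
  have eq2: "(\<integral>\<omega>. (\<integral>t. h \<omega> t \<partial>L) ^ m \<partial>N)
       = (\<integral>ts. (\<integral>\<omega>. (\<Prod>k<m. h \<omega> (ts k)) \<partial>N) \<partial>PiM {..<m} (\<lambda>_. L))"
    by (rule integral_functional_moment[OF N L h]) (rule bh)
  show ?thesis
    unfolding eq1 eq2
  proof (rule integral_dominated_convergence[where w="\<lambda>_. K ^ m"])
    show "integrable (PiM {..<m} (\<lambda>_. L)) (\<lambda>_. K ^ m)"
      using fin by (simp add: finite_measure.integrable_const)
    show "(\<lambda>ts. \<integral>\<omega>. (\<Prod>k<m. h \<omega> (ts k)) \<partial>N) \<in> borel_measurable (PiM {..<m} (\<lambda>_. L))"
      by (rule meas[OF N h])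
    show "(\<lambda>ts. \<integral>\<omega>. (\<Prod>k<m. g l \<omega> (ts k)) \<partial>M) \<in> borel_measurable (PiM {..<m} (\<lambda>_. L))" for l
      by (rule meas[OF M g])
    show "AE ts in PiM {..<m} (\<lambda>_. L). (\<lambda>l. \<integral>\<omega>. (\<Prod>k<m. g l \<omega> (ts k)) \<partial>M)
            \<longlonglongrightarrow> (\<integral>\<omega>. (\<Prod>k<m. h \<omega> (ts k)) \<partial>N)"
    proof (rule AE_I2)
      fix ts assume "ts \<in> space (PiM {..<m} (\<lambda>_. L))"
      then have "\<And>k. k < m \<Longrightarrow> ts k \<in> space L" by (auto simp: space_PiM)
      then show "(\<lambda>l. \<integral>\<omega>. (\<Prod>k<m. g l \<omega> (ts k)) \<partial>M)
            \<longlonglongrightarrow> (\<integral>\<omega>. (\<Prod>k<m. h \<omega> (ts k)) \<partial>N)" by (rule fdd)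
    qed
    show "AE ts in PiM {..<m} (\<lambda>_. L). norm (\<integral>\<omega>. (\<Prod>k<m. g l \<omega> (ts k)) \<partial>M) \<le> K ^ m" for l
    proof (rule AE_I2)
      fix ts assume ts: "ts \<in> space (PiM {..<m} (\<lambda>_. L))"
      show "norm (\<integral>\<omega>. (\<Prod>k<m. g l \<omega> (ts k)) \<partial>M) \<le> K ^ m"
        by (rule bound[OF M ts]) (rule bg)
    qed
  qed
qed

text \<open>Moments give convergence for polynomials, and Weierstrass approximates \<open>f\<close>
  uniformly on the common compact range \<open>{0..R}\<close>.\<close>

lemma bounded_functional_converges:
  fixes X :: "nat \<Rightarrow> 'w \<Rightarrow> real" and Y :: "'v \<Rightarrow> real" and f :: "real \<Rightarrow> real"
  assumes M: "prob_space M" and N: "prob_space N"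
    and X[measurable]: "\<And>l. X l \<in> borel_measurable M" and Y[measurable]: "Y \<in> borel_measurable N"
    and bX: "\<And>l \<omega>. \<omega> \<in> space M \<Longrightarrow> X l \<omega> \<in> {0..R}"
    and bY: "\<And>\<omega>. \<omega> \<in> space N \<Longrightarrow> Y \<omega> \<in> {0..R}"
    and moments: "\<And>m. (\<lambda>l. \<integral>\<omega>. X l \<omega> ^ m \<partial>M) \<longlonglongrightarrow> (\<integral>\<omega>. Y \<omega> ^ m \<partial>N)"
    and f: "continuous_on UNIV f"
  shows "(\<lambda>l. \<integral>\<omega>. f (X l \<omega>) \<partial>M) \<longlonglongrightarrow> (\<integral>\<omega>. f (Y \<omega>) \<partial>N)"
proof -
  interpret M: prob_space M by fact
  interpret N: prob_space N by fact
  have f_meas[measurable]: "f \<in> borel_measurable borel"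
    by (rule borel_measurable_continuous_onI[OF f])
  have fR: "continuous_on {0..R} f" by (rule continuous_on_subset[OF f]) auto
  have intgen: "integrable Q (\<lambda>\<omega>. g (Z \<omega>))"
    if Q: "prob_space Q" and g: "continuous_on {0..R} g" "g \<in> borel_measurable borel"
      and Z: "Z \<in> borel_measurable Q" "\<And>\<omega>. \<omega> \<in> space Q \<Longrightarrow> Z \<omega> \<in> {0..R}"
    for Q :: "'x measure" and Z and g :: "real \<Rightarrow> real"
  proof -
    interpret Q: prob_space Q by fact
    have "bounded (g ` {0..R})"
      by (intro compact_imp_bounded compact_continuous_image g) auto
    then obtain B where B: "\<And>x. x \<in> {0..R} \<Longrightarrow> norm (g x) \<le> B" unfolding bounded_iff by blast
    show ?thesis
      using Z g by (intro Q.integrable_const_bound[where B=B]) (auto intro!: AE_I2 B[unfolded real_norm_def])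
  qed
  have pow: "integrable Q (\<lambda>\<omega>. Z \<omega> ^ i)"
    if Q: "prob_space Q" and Z: "Z \<in> borel_measurable Q" "\<And>\<omega>. \<omega> \<in> space Q \<Longrightarrow> Z \<omega> \<in> {0..R}"
    for Q :: "'x measure" and Z i
    by (rule intgen[OF Q _ _ Z]) (auto intro!: continuous_intros)
  have poly: "(\<lambda>l. \<integral>\<omega>. p (X l \<omega>) \<partial>M) \<longlonglongrightarrow> (\<integral>\<omega>. p (Y \<omega>) \<partial>N)"
    if "real_polynomial_function p" for p :: "real \<Rightarrow> real"
  proof -
    from that[unfolded real_polynomial_function_iff_sum]
    obtain a n where p: "p = (\<lambda>x. \<Sum>i\<le>n. a i * x^i)" by (elim exE)
    have 1: "(\<integral>\<omega>. p (X l \<omega>) \<partial>M) = (\<Sum>i\<le>n. a i * (\<integral>\<omega>. X l \<omega> ^ i \<partial>M))" for l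
      unfolding p by (subst Bochner_Integration.integral_sum) (simp_all add: pow[OF M X bX])
    have 2: "(\<integral>\<omega>. p (Y \<omega>) \<partial>N) = (\<Sum>i\<le>n. a i * (\<integral>\<omega>. Y \<omega> ^ i \<partial>N))"
      unfolding p by (subst Bochner_Integration.integral_sum) (simp_all add: pow[OF N Y bY])
    show ?thesis unfolding 1 2 by (intro tendsto_intros moments)
  qed
  show ?thesis
  proof (rule LIMSEQ_I)
    fix e :: real assume e: "e > 0"
    obtain p where p: "real_polynomial_function p" "\<And>x. x \<in> {0..R} \<Longrightarrow> \<bar>f x - p x\<bar> < e / 4"
      using Stone_Weierstrass_real_polynomial_function[of "{0..R}" f "e/4"] fR e by auto
    have pc: "continuous_on UNIV p"
      using p(1) continuous_on_polymonial_function real_polynomial_function_eq by blast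
    have [measurable]: "p \<in> borel_measurable borel"
      by (rule borel_measurable_continuous_onI[OF pc])
    have close: "\<bar>(\<integral>\<omega>. f (Z \<omega>) \<partial>Q) - (\<integral>\<omega>. p (Z \<omega>) \<partial>Q)\<bar> \<le> e / 4"
      if Q: "prob_space Q" and Z: "Z \<in> borel_measurable Q" "\<And>\<omega>. \<omega> \<in> space Q \<Longrightarrow> Z \<omega> \<in> {0..R}"
      for Q :: "'x measure" and Z
    proof -
      interpret Q: prob_space Q by fact
      note [measurable] = Z(1)
      have i: "integrable Q (\<lambda>\<omega>. f (Z \<omega>))" "integrable Q (\<lambda>\<omega>. p (Z \<omega>))"
        by (rule intgen[OF Q _ _ Z]; use fR continuous_on_subset[OF pc] in simp)+
      have "\<bar>(\<integral>\<omega>. f (Z \<omega>) \<partial>Q) - (\<integral>\<omega>. p (Z \<omega>) \<partial>Q)\<bar> = \<bar>\<integral>\<omega>. f (Z \<omega>) - p (Z \<omega>) \<partial>Q\<bar>"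
        using i by simp
      also have "\<dots> \<le> (\<integral>\<omega>. \<bar>f (Z \<omega>) - p (Z \<omega>)\<bar> \<partial>Q)" by (rule integral_abs_bound)
      also have "\<dots> \<le> e / 4"
        using i p(2)[OF Z(2)] by (intro Q.integral_le_const AE_I2) (auto intro: less_imp_le)
      finally show ?thesis .
    qed
    from LIMSEQ_D[OF poly[OF p(1)], of "e/4"] e obtain l0 where l0:
      "\<And>l. l \<ge> l0 \<Longrightarrow> norm ((\<integral>\<omega>. p (X l \<omega>) \<partial>M) - (\<integral>\<omega>. p (Y \<omega>) \<partial>N)) < e / 4" by auto
    have "norm ((\<integral>\<omega>. f (X l \<omega>) \<partial>M) - (\<integral>\<omega>. f (Y \<omega>) \<partial>N)) < e" if "l \<ge> l0" for l
      using l0[OF that] close[OF M X bX, of l] close[OF N Y bY] e unfolding real_norm_def by linarith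
    then show "\<exists>no. \<forall>l\<ge>no. norm ((\<integral>\<omega>. f (X l \<omega>) \<partial>M) - (\<integral>\<omega>. f (Y \<omega>) \<partial>N)) < e" by blast
  qed
qed

text \<open>Tonelli bounds the joint integral by \<open>C\<close> times the total mass of
  \<open>L\<close>. All claims are then Fubini for one jointly integrable function.\<close>

lemma nonneg_process_integral:
  fixes q :: "'w \<Rightarrow> 't \<Rightarrow> real"
  assumes M: "prob_space M" and L: "finite_measure L"
    and q[measurable]: "(\<lambda>(\<omega>, t). q \<omega> t) \<in> borel_measurable (M \<Otimes>\<^sub>M L)"
    and nonneg: "\<And>\<omega> t. \<omega> \<in> space M \<Longrightarrow> t \<in> space L \<Longrightarrow> 0 \<le> q \<omega> t"
    and int: "\<And>t. t \<in> space L \<Longrightarrow> integrable M (\<lambda>\<omega>. q \<omega> t)"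
    and bound: "\<And>t. t \<in> space L \<Longrightarrow> (\<integral>\<omega>. q \<omega> t \<partial>M) \<le> C" and C: "C \<ge> 0"
  shows "AE \<omega> in M. integrable L (q \<omega>)"
    and "integrable L (\<lambda>t. \<integral>\<omega>. q \<omega> t \<partial>M)"
    and "integrable M (\<lambda>\<omega>. \<integral>t. q \<omega> t \<partial>L)"
    and "(\<integral>\<omega>. (\<integral>t. q \<omega> t \<partial>L) \<partial>M) = (\<integral>t. (\<integral>\<omega>. q \<omega> t \<partial>M) \<partial>L)"
    and "(\<integral>\<omega>. (\<integral>t. q \<omega> t \<partial>L) \<partial>M) \<le> C * measure L (space L)"
proof -
  interpret M: prob_space M by fact
  interpret L: finite_measure L by fact
  interpret PR: pair_sigma_finite M L ..
  have "(\<integral>\<^sup>+x. ennreal (norm (case x of (\<omega>, t) \<Rightarrow> q \<omega> t)) \<partial>(M \<Otimes>\<^sub>M L))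
      = (\<integral>\<^sup>+t. (\<integral>\<^sup>+\<omega>. ennreal (norm (q \<omega> t)) \<partial>M) \<partial>L)"
    by (subst PR.nn_integral_snd[symmetric]) (auto simp: split_beta)
  also have "\<dots> \<le> (\<integral>\<^sup>+t. ennreal C \<partial>L)"
  proof (rule nn_integral_mono)
    fix t assume t: "t \<in> space L"
    have "(\<integral>\<^sup>+\<omega>. ennreal (norm (q \<omega> t)) \<partial>M) = (\<integral>\<^sup>+\<omega>. ennreal (q \<omega> t) \<partial>M)"
      by (rule nn_integral_cong) (use nonneg t in auto)
    also have "\<dots> = ennreal (\<integral>\<omega>. q \<omega> t \<partial>M)"
      by (rule nn_integral_eq_integral[OF int[OF t]]) (use nonneg t in auto)
    also have "\<dots> \<le> ennreal C" by (rule ennreal_leI[OF bound[OF t]])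
    finally show "(\<integral>\<^sup>+\<omega>. ennreal (norm (q \<omega> t)) \<partial>M) \<le> ennreal C" .
  qed
  also have "\<dots> < \<infinity>"
    by (metis L.emeasure_finite ennreal_mult_less_top ennreal_less_top infinity_ennreal_def less_top nn_integral_const)
  finally have PR_int: "integrable (M \<Otimes>\<^sub>M L) (\<lambda>(\<omega>, t). q \<omega> t)"
    by (intro integrableI_bounded) auto
  show "AE \<omega> in M. integrable L (q \<omega>)" by (rule PR.AE_integrable_fst[OF PR_int])
  show i2: "integrable L (\<lambda>t. \<integral>\<omega>. q \<omega> t \<partial>M)" by (rule PR.integrable_snd[OF PR_int])
  show "integrable M (\<lambda>\<omega>. \<integral>t. q \<omega> t \<partial>L)" by (rule PR.integrable_fst[OF PR_int])
  show eq: "(\<integral>\<omega>. (\<integral>t. q \<omega> t \<partial>L) \<partial>M) = (\<integral>t. (\<integral>\<omega>. q \<omega> t \<partial>M) \<partial>L)"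
    by (rule PR.Fubini_integral[OF PR_int, symmetric])
  have "(\<integral>t. (\<integral>\<omega>. q \<omega> t \<partial>M) \<partial>L) \<le> (\<integral>t. C \<partial>L)"
    by (rule integral_mono[OF i2]) (auto intro: bound)
  then show "(\<integral>\<omega>. (\<integral>t. q \<omega> t \<partial>L) \<partial>M) \<le> C * measure L (space L)"
    unfolding eq by (simp add: mult.commute)
qed

text \<open>The modulus is applied with \<open>x\<close> the untruncated integral. As truncation
  only decreases the integrand, the distance of the two integrals is their difference, whose mean
  Fubini computes exactly.\<close>

lemma truncated_functional_close:
  fixes q :: "'w \<Rightarrow> 't \<Rightarrow> real" and f :: "real \<Rightarrow> real"
  assumes M: "prob_space M" and L: "finite_measure L"
    and q[measurable]: "(\<lambda>(\<omega>, t). q \<omega> t) \<in> borel_measurable (M \<Otimes>\<^sub>M L)"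
    and nonneg: "\<And>\<omega> t. \<omega> \<in> space M \<Longrightarrow> t \<in> space L \<Longrightarrow> 0 \<le> q \<omega> t"
    and int: "\<And>t. t \<in> space L \<Longrightarrow> integrable M (\<lambda>\<omega>. q \<omega> t)"
    and bound: "\<And>t. t \<in> space L \<Longrightarrow> (\<integral>\<omega>. q \<omega> t \<partial>M) \<le> C" and C: "C \<ge> 0"
    and K: "K > 0"
    and f: "continuous_on UNIV f" "bounded (range f)"
    and \<kappa>: "\<kappa> \<ge> 0" "e \<ge> 0" "\<And>x y. \<bar>f x - f y\<bar> \<le> e * (1 + \<bar>x\<bar>) + \<kappa> * \<bar>x - y\<bar>"
  shows "\<bar>(\<integral>\<omega>. f (\<integral>t. q \<omega> t \<partial>L) \<partial>M) - (\<integral>\<omega>. f (\<integral>t. min (q \<omega> t) K \<partial>L) \<partial>M)\<bar>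
     \<le> e * (1 + C * measure L (space L)) + \<kappa> * (\<integral>t. (\<integral>\<omega>. q \<omega> t \<partial>M) - (\<integral>\<omega>. min (q \<omega> t) K \<partial>M) \<partial>L)"
proof -
  interpret M: prob_space M by fact
  interpret L: finite_measure L by fact
  have f_meas[measurable]: "f \<in> borel_measurable borel"
    by (rule borel_measurable_continuous_onI[OF f(1)])
  obtain B where B: "\<And>x. norm (f x) \<le> B" using f(2) unfolding bounded_iff by auto
  have m2[measurable]: "(\<lambda>(\<omega>, t). min (q \<omega> t) K) \<in> borel_measurable (M \<Otimes>\<^sub>M L)" by measurable
  have im: "integrable M (\<lambda>\<omega>. min (q \<omega> t) K)" if "t \<in> space L" for t
    by (rule Bochner_Integration.integrable_bound[OF int[OF that]])
       (use nonneg that K in \<open>auto intro!: AE_I2\<close>)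
  have bm: "(\<integral>\<omega>. min (q \<omega> t) K \<partial>M) \<le> C" if t: "t \<in> space L" for t
    using bound[OF t] integral_mono[OF im[OF t] int[OF t]] by (meson min.cobounded1 order_trans)
  have A: "AE \<omega> in M. integrable L (q \<omega>)" "integrable L (\<lambda>t. \<integral>\<omega>. q \<omega> t \<partial>M)"
    "integrable M (\<lambda>\<omega>. \<integral>t. q \<omega> t \<partial>L)"
    "(\<integral>\<omega>. (\<integral>t. q \<omega> t \<partial>L) \<partial>M) = (\<integral>t. (\<integral>\<omega>. q \<omega> t \<partial>M) \<partial>L)"
    "(\<integral>\<omega>. (\<integral>t. q \<omega> t \<partial>L) \<partial>M) \<le> C * measure L (space L)"
    by (rule nonneg_process_integral[OF M L q nonneg int bound C]; assumption)+
  have nonneg': "\<And>\<omega> t. \<omega> \<in> space M \<Longrightarrow> t \<in> space L \<Longrightarrow> 0 \<le> min (q \<omega> t) K"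
    using nonneg K by auto
  have A': "AE \<omega> in M. integrable L (\<lambda>t. min (q \<omega> t) K)" "integrable L (\<lambda>t. \<integral>\<omega>. min (q \<omega> t) K \<partial>M)"
    "integrable M (\<lambda>\<omega>. \<integral>t. min (q \<omega> t) K \<partial>L)"
    "(\<integral>\<omega>. (\<integral>t. min (q \<omega> t) K \<partial>L) \<partial>M) = (\<integral>t. (\<integral>\<omega>. min (q \<omega> t) K \<partial>M) \<partial>L)"
    by (rule nonneg_process_integral[OF M L m2 nonneg' im bm C]; assumption)+
  have fi: "integrable M (\<lambda>\<omega>. f (\<integral>t. q \<omega> t \<partial>L))" "integrable M (\<lambda>\<omega>. f (\<integral>t. min (q \<omega> t) K \<partial>L))"
    by (rule M.integrable_const_bound[where B=B]; use B in \<open>auto intro!: AE_I2\<close>)+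
  have "\<bar>(\<integral>\<omega>. f (\<integral>t. q \<omega> t \<partial>L) \<partial>M) - (\<integral>\<omega>. f (\<integral>t. min (q \<omega> t) K \<partial>L) \<partial>M)\<bar>
      = \<bar>\<integral>\<omega>. f (\<integral>t. q \<omega> t \<partial>L) - f (\<integral>t. min (q \<omega> t) K \<partial>L) \<partial>M\<bar>"
    using fi by simp
  also have "\<dots> \<le> (\<integral>\<omega>. \<bar>f (\<integral>t. q \<omega> t \<partial>L) - f (\<integral>t. min (q \<omega> t) K \<partial>L)\<bar> \<partial>M)"
    by (rule integral_abs_bound)
  also have "\<dots> \<le> (\<integral>\<omega>. e * (1 + (\<integral>t. q \<omega> t \<partial>L)) +
                   \<kappa> * ((\<integral>t. q \<omega> t \<partial>L) - (\<integral>t. min (q \<omega> t) K \<partial>L)) \<partial>M)"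
  proof (rule integral_mono_AE)
    show "integrable M (\<lambda>\<omega>. e * (1 + (\<integral>t. q \<omega> t \<partial>L)) +
                   \<kappa> * ((\<integral>t. q \<omega> t \<partial>L) - (\<integral>t. min (q \<omega> t) K \<partial>L)))"
      using A(3) A'(3) by simp
    show "AE \<omega> in M. \<bar>f (\<integral>t. q \<omega> t \<partial>L) - f (\<integral>t. min (q \<omega> t) K \<partial>L)\<bar>
        \<le> e * (1 + (\<integral>t. q \<omega> t \<partial>L)) + \<kappa> * ((\<integral>t. q \<omega> t \<partial>L) - (\<integral>t. min (q \<omega> t) K \<partial>L))"
      using A(1) A'(1) AE_space
    proof eventually_elim
      case (elim \<omega>)
      have "0 \<le> (\<integral>t. q \<omega> t \<partial>L)"
        by (rule integral_nonneg_AE) (use elim nonneg in auto)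
      moreover have "(\<integral>t. min (q \<omega> t) K \<partial>L) \<le> (\<integral>t. q \<omega> t \<partial>L)"
        by (rule integral_mono) (use elim in auto)
      ultimately show ?case
        using \<kappa>(3)[of "\<integral>t. q \<omega> t \<partial>L" "\<integral>t. min (q \<omega> t) K \<partial>L"] by simp
    qed
  qed (use fi in simp)
  also have "\<dots> = e * (1 + (\<integral>\<omega>. (\<integral>t. q \<omega> t \<partial>L) \<partial>M)) +
      \<kappa> * ((\<integral>\<omega>. (\<integral>t. q \<omega> t \<partial>L) \<partial>M) - (\<integral>\<omega>. (\<integral>t. min (q \<omega> t) K \<partial>L) \<partial>M))"
    using A(3) A'(3) by (simp add: M.prob_space)
  also have "\<dots> = e * (1 + (\<integral>\<omega>. (\<integral>t. q \<omega> t \<partial>L) \<partial>M)) +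
      \<kappa> * (\<integral>t. (\<integral>\<omega>. q \<omega> t \<partial>M) - (\<integral>\<omega>. min (q \<omega> t) K \<partial>M) \<partial>L)"
    using A(2) A'(2) unfolding A(4) A'(4) by simp
  also have "\<dots> \<le> e * (1 + C * measure L (space L)) +
      \<kappa> * (\<integral>t. (\<integral>\<omega>. q \<omega> t \<partial>M) - (\<integral>\<omega>. min (q \<omega> t) K \<partial>M) \<partial>L)"
    using A(5) \<kappa> by (intro add_right_mono mult_left_mono) auto
  finally show ?thesis .
qed

text \<open>\<open>D K l\<close> is the mean mass that truncation at \<open>K\<close> removes, and
  \<open>D' K\<close> its analogue for the limit. For fixed \<open>K\<close> the former tends to the
  latter, since means and truncated means (the case \<open>m = 1\<close> of \<open>fdd\<close>)
  converge at each time; and \<open>D' K\<close> vanishes as \<open>K\<close> grows. So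
  \<open>K\<close> can be chosen from \<open>f\<close> and the limit process alone, after which
  \<open>l\<close> is taken large. This is uniform integrability in disguise.\<close>

lemma integral_functional_converges:
  fixes q :: "nat \<Rightarrow> 'w \<Rightarrow> 't \<Rightarrow> real" and p :: "'v \<Rightarrow> 't \<Rightarrow> real" and f :: "real \<Rightarrow> real"
  assumes M: "prob_space M" and N: "prob_space N" and L: "finite_measure L"
    and q[measurable]: "\<And>l. (\<lambda>(\<omega>, t). q l \<omega> t) \<in> borel_measurable (M \<Otimes>\<^sub>M L)"
    and p[measurable]: "(\<lambda>(\<omega>, t). p \<omega> t) \<in> borel_measurable (N \<Otimes>\<^sub>M L)"
    and q_nonneg: "\<And>l \<omega> t. \<omega> \<in> space M \<Longrightarrow> t \<in> space L \<Longrightarrow> 0 \<le> q l \<omega> t"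
    and p_nonneg: "\<And>\<omega> t. \<omega> \<in> space N \<Longrightarrow> t \<in> space L \<Longrightarrow> 0 \<le> p \<omega> t"
    and q_int: "\<And>l t. t \<in> space L \<Longrightarrow> integrable M (\<lambda>\<omega>. q l \<omega> t)"
    and p_int: "\<And>t. t \<in> space L \<Longrightarrow> integrable N (\<lambda>\<omega>. p \<omega> t)"
    and q_bound: "\<And>l t. t \<in> space L \<Longrightarrow> (\<integral>\<omega>. q l \<omega> t \<partial>M) \<le> C" and C: "C \<ge> 0"
    and p_bound: "\<And>t. t \<in> space L \<Longrightarrow> (\<integral>\<omega>. p \<omega> t \<partial>N) \<le> C"
    and mean: "\<And>t. t \<in> space L \<Longrightarrow> (\<lambda>l. \<integral>\<omega>. q l \<omega> t \<partial>M) \<longlonglongrightarrow> (\<integral>\<omega>. p \<omega> t \<partial>N)"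
    and fdd: "\<And>(m::nat) ts K. K > 0 \<Longrightarrow> (\<And>k. k < m \<Longrightarrow> ts k \<in> space L) \<Longrightarrow>
       (\<lambda>l. \<integral>\<omega>. (\<Prod>k<m. min (q l \<omega> (ts k)) K) \<partial>M) \<longlonglongrightarrow> (\<integral>\<omega>. (\<Prod>k<m. min (p \<omega> (ts k)) K) \<partial>N)"
    and f: "continuous_on UNIV f" "bounded (range f)"
  shows "(\<lambda>l. \<integral>\<omega>. f (\<integral>t. q l \<omega> t \<partial>L) \<partial>M) \<longlonglongrightarrow> (\<integral>\<omega>. f (\<integral>t. p \<omega> t \<partial>L) \<partial>N)"
proof -
  interpret M: prob_space M by fact
  interpret N: prob_space N by fact
  interpret L: finite_measure L by fact
  define D where "D K l = (\<integral>t. (\<integral>\<omega>. q l \<omega> t \<partial>M) - (\<integral>\<omega>. min (q l \<omega> t) K \<partial>M) \<partial>L)" for K l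
  define D' where "D' K = (\<integral>t. (\<integral>\<omega>. p \<omega> t \<partial>N) - (\<integral>\<omega>. min (p \<omega> t) K \<partial>N) \<partial>L)" for K
  have qm[measurable]: "(\<lambda>(\<omega>, t). min (q l \<omega> t) K) \<in> borel_measurable (M \<Otimes>\<^sub>M L)" for l K by measurable
  have pm[measurable]: "(\<lambda>(\<omega>, t). min (p \<omega> t) K) \<in> borel_measurable (N \<Otimes>\<^sub>M L)" for K by measurable
  have swap: "(\<lambda>(t, \<omega>). g \<omega> t) \<in> borel_measurable (L \<Otimes>\<^sub>M R)"
    if "(\<lambda>(\<omega>, t). g \<omega> t) \<in> borel_measurable (R \<Otimes>\<^sub>M L)" for g :: "'x \<Rightarrow> 't \<Rightarrow> real" and R
    using measurable_compose[OF measurable_pair_swap' that] by (simp add: split_beta')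
  have mq[measurable]: "(\<lambda>t. \<integral>\<omega>. q l \<omega> t \<partial>M) \<in> borel_measurable L"
      "(\<lambda>t. \<integral>\<omega>. min (q l \<omega> t) K \<partial>M) \<in> borel_measurable L" for l K
    by (rule M.borel_measurable_lebesgue_integral[OF swap], measurable)+
  have mp[measurable]: "(\<lambda>t. \<integral>\<omega>. p \<omega> t \<partial>N) \<in> borel_measurable L"
      "(\<lambda>t. \<integral>\<omega>. min (p \<omega> t) K \<partial>N) \<in> borel_measurable L" for K
    by (rule N.borel_measurable_lebesgue_integral[OF swap], measurable)+
  have trunc: "0 \<le> (\<integral>\<omega>. g \<omega> \<partial>R) - (\<integral>\<omega>. min (g \<omega>) K \<partial>R)" "(\<integral>\<omega>. g \<omega> \<partial>R) - (\<integral>\<omega>. min (g \<omega>) K \<partial>R) \<le> (\<integral>\<omega>. g \<omega> \<partial>R)"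
    if R: "prob_space R" and g: "integrable R g" "\<And>\<omega>. \<omega> \<in> space R \<Longrightarrow> 0 \<le> g \<omega>" and K: "K > 0"
    for R :: "'x measure" and g :: "'x \<Rightarrow> real" and K
  proof -
    interpret R: prob_space R by fact
    have "integrable R (\<lambda>\<omega>. min (g \<omega>) K)" using g by simp
    then have "(\<integral>\<omega>. min (g \<omega>) K \<partial>R) \<le> (\<integral>\<omega>. g \<omega> \<partial>R)" using g by (intro integral_mono) auto
    then show "0 \<le> (\<integral>\<omega>. g \<omega> \<partial>R) - (\<integral>\<omega>. min (g \<omega>) K \<partial>R)" by simp
    have "0 \<le> (\<integral>\<omega>. min (g \<omega>) K \<partial>R)" using g K by (intro integral_nonneg_AE AE_I2) auto
    then show "(\<integral>\<omega>. g \<omega> \<partial>R) - (\<integral>\<omega>. min (g \<omega>) K \<partial>R) \<le> (\<integral>\<omega>. g \<omega> \<partial>R)" by simp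
  qed
  have D_lim: "(\<lambda>l. D K l) \<longlonglongrightarrow> D' K" if K: "K > 0" for K
    unfolding D_def D'_def
  proof (rule integral_dominated_convergence[where w="\<lambda>_. C"])
    show "AE t in L. (\<lambda>l. (\<integral>\<omega>. q l \<omega> t \<partial>M) - (\<integral>\<omega>. min (q l \<omega> t) K \<partial>M))
        \<longlonglongrightarrow> (\<integral>\<omega>. p \<omega> t \<partial>N) - (\<integral>\<omega>. min (p \<omega> t) K \<partial>N)"
    proof (rule AE_I2)
      fix t assume t: "t \<in> space L"
      show "(\<lambda>l. (\<integral>\<omega>. q l \<omega> t \<partial>M) - (\<integral>\<omega>. min (q l \<omega> t) K \<partial>M))
        \<longlonglongrightarrow> (\<integral>\<omega>. p \<omega> t \<partial>N) - (\<integral>\<omega>. min (p \<omega> t) K \<partial>N)"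
        using fdd[OF K, of 1 "\<lambda>_. t"] t by (intro tendsto_diff mean) auto
    qed
    show "AE t in L. norm ((\<integral>\<omega>. q l \<omega> t \<partial>M) - (\<integral>\<omega>. min (q l \<omega> t) K \<partial>M)) \<le> C" for l
    proof (rule AE_I2)
      fix t assume t: "t \<in> space L"
      show "norm ((\<integral>\<omega>. q l \<omega> t \<partial>M) - (\<integral>\<omega>. min (q l \<omega> t) K \<partial>M)) \<le> C"
        using trunc(1)[OF M q_int[OF t, of l] _ K] trunc(2)[OF M q_int[OF t, of l] _ K]
          q_bound[OF t, of l] q_nonneg[OF _ t] by fastforce
    qed
  qed simp_all
  have D'_lim: "(\<lambda>n. D' (real (Suc n))) \<longlonglongrightarrow> (\<integral>t. 0 \<partial>L)"
    unfolding D'_def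
  proof (rule integral_dominated_convergence[where w="\<lambda>_. C"])
    show "AE t in L. (\<lambda>n. (\<integral>\<omega>. p \<omega> t \<partial>N) - (\<integral>\<omega>. min (p \<omega> t) (real (Suc n)) \<partial>N)) \<longlonglongrightarrow> 0"
    proof (rule AE_I2)
      fix t assume t: "t \<in> space L"
      have "(\<lambda>n. \<integral>\<omega>. min (p \<omega> t) (real (Suc n)) \<partial>N) \<longlonglongrightarrow> (\<integral>\<omega>. p \<omega> t \<partial>N)"
      proof (rule integral_dominated_convergence[where w="\<lambda>\<omega>. p \<omega> t"])
        show "AE \<omega> in N. (\<lambda>n. min (p \<omega> t) (real (Suc n))) \<longlonglongrightarrow> p \<omega> t"
        proof (rule AE_I2)
          fix \<omega>
          obtain n0 :: nat where n0: "p \<omega> t \<le> real n0" using real_arch_simple by blast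
          have "\<forall>\<^sub>F n in sequentially. min (p \<omega> t) (real (Suc n)) = p \<omega> t"
            using eventually_ge_at_top[of n0] by eventually_elim (use n0 in auto)
          then show "(\<lambda>n. min (p \<omega> t) (real (Suc n))) \<longlonglongrightarrow> p \<omega> t" by (rule tendsto_eventually)
        qed
      qed (use p_int[OF t] p_nonneg[OF _ t] in \<open>auto intro!: AE_I2\<close>)
      then show "(\<lambda>n. (\<integral>\<omega>. p \<omega> t \<partial>N) - (\<integral>\<omega>. min (p \<omega> t) (real (Suc n)) \<partial>N)) \<longlonglongrightarrow> 0"
        using tendsto_diff[OF tendsto_const[of "\<integral>\<omega>. p \<omega> t \<partial>N"]] by fastforce
    qed
    show "AE t in L. norm ((\<integral>\<omega>. p \<omega> t \<partial>N) - (\<integral>\<omega>. min (p \<omega> t) (real (Suc n)) \<partial>N)) \<le> C" for n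
    proof (rule AE_I2)
      fix t assume t: "t \<in> space L"
      show "norm ((\<integral>\<omega>. p \<omega> t \<partial>N) - (\<integral>\<omega>. min (p \<omega> t) (real (Suc n)) \<partial>N)) \<le> C"
        using trunc(1)[OF N p_int[OF t], of "real (Suc n)"] trunc(2)[OF N p_int[OF t], of "real (Suc n)"]
          p_bound[OF t] p_nonneg[OF _ t] by fastforce
    qed
  qed simp_all
  have trunc_lim: "(\<lambda>l. \<integral>\<omega>. f (\<integral>t. min (q l \<omega> t) K \<partial>L) \<partial>M) \<longlonglongrightarrow> (\<integral>\<omega>. f (\<integral>t. min (p \<omega> t) K \<partial>L) \<partial>N)"
    if K: "K > 0" for K
  proof (rule bounded_functional_converges[OF M N, where f=f and R="K * measure L (space L)"])
    have b: "(\<integral>t. min (g t) K \<partial>L) \<in> {0..K * measure L (space L)}"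
      if g: "\<And>t. t \<in> space L \<Longrightarrow> 0 \<le> g t" "g \<in> borel_measurable L" for g :: "'t \<Rightarrow> real"
    proof -
      have "integrable L (\<lambda>t. min (g t) K)"
        using g K by (intro L.integrable_const_bound[where B=K]) (auto intro!: AE_I2)
      then have "(\<integral>t. min (g t) K \<partial>L) \<le> (\<integral>t. K \<partial>L)" by (intro integral_mono) auto
      moreover have "0 \<le> (\<integral>t. min (g t) K \<partial>L)" using g K by (intro integral_nonneg_AE AE_I2) auto
      ultimately show ?thesis by (simp add: mult.commute)
    qed
    show "(\<integral>t. min (q l \<omega> t) K \<partial>L) \<in> {0..K * measure L (space L)}" if "\<omega> \<in> space M" for l \<omega>
      by (rule b[OF q_nonneg[OF that]]) (use that in measurable)
    show "(\<integral>t. min (p \<omega> t) K \<partial>L) \<in> {0..K * measure L (space L)}" if "\<omega> \<in> space N" for \<omega>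
      by (rule b[OF p_nonneg[OF that]]) (use that in measurable)
    show "(\<lambda>l. \<integral>\<omega>. (\<integral>t. min (q l \<omega> t) K \<partial>L) ^ m \<partial>M) \<longlonglongrightarrow> (\<integral>\<omega>. (\<integral>t. min (p \<omega> t) K \<partial>L) ^ m \<partial>N)" for m
      by (rule integral_functional_moments_converge[OF M N L qm pm, where K=K])
         (use q_nonneg p_nonneg K fdd[OF K] in auto)
  qed (use f in auto)
  show ?thesis
  proof (rule LIMSEQ_I)
    fix \<epsilon> :: real assume \<epsilon>: "\<epsilon> > 0"
    define W where "W = 1 + C * measure L (space L)"
    have W: "W \<ge> 1" using C by (simp add: W_def)
    obtain \<kappa> where \<kappa>: "\<kappa> \<ge> 0" "\<And>x y. \<bar>f x - f y\<bar> \<le> (\<epsilon> / (8 * W)) * (1 + \<bar>x\<bar>) + \<kappa> * \<bar>x - y\<bar>"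
      using bounded_continuous_modulus[OF f, of "\<epsilon> / (8 * W)"] \<epsilon> W by auto
    have "(\<lambda>n. \<kappa> * D' (real (Suc n))) \<longlonglongrightarrow> \<kappa> * 0"
      using D'_lim by (intro tendsto_mult_left) simp
    \<comment> \<open>The budget in eighths: 3 for truncating \<open>q l\<close>, 2 for the
      truncated limit process, 2 for the truncated laws. \<open>W\<close> makes the first term of
      the modulus contribute exactly one eighth each time.\<close>
    from LIMSEQ_D[OF this, of "\<epsilon>/8"] \<epsilon> obtain n where n: "\<bar>\<kappa> * D' (real (Suc n))\<bar> < \<epsilon> / 8" by auto
    define K where "K = real (Suc n)"
    have K: "K > 0" by (simp add: K_def)
    have "(\<lambda>l. \<kappa> * D K l) \<longlonglongrightarrow> \<kappa> * D' K" by (intro tendsto_mult_left D_lim K)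
    from LIMSEQ_D[OF this, of "\<epsilon>/8"] \<epsilon> obtain l0 where
      l0: "\<And>l. l \<ge> l0 \<Longrightarrow> \<bar>\<kappa> * D K l - \<kappa> * D' K\<bar> < \<epsilon> / 8" by auto
    from LIMSEQ_D[OF trunc_lim[OF K], of "\<epsilon>/4"] \<epsilon> obtain l1 where
      l1: "\<And>l. l \<ge> l1 \<Longrightarrow> \<bar>(\<integral>\<omega>. f (\<integral>t. min (q l \<omega> t) K \<partial>L) \<partial>M) - (\<integral>\<omega>. f (\<integral>t. min (p \<omega> t) K \<partial>L) \<partial>N)\<bar> < \<epsilon> / 4"
      by auto
    have eW: "\<epsilon> / (8 * W) * (1 + C * measure L (space L)) = \<epsilon> / 8"
      using W unfolding W_def[symmetric] by simp
    have e0: "0 \<le> \<epsilon> / (8 * W)" using \<epsilon> W by simp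
    have "norm ((\<integral>\<omega>. f (\<integral>t. q l \<omega> t \<partial>L) \<partial>M) - (\<integral>\<omega>. f (\<integral>t. p \<omega> t \<partial>L) \<partial>N)) < \<epsilon>"
      if l: "l \<ge> max l0 l1" for l
    proof -
      have "\<bar>(\<integral>\<omega>. f (\<integral>t. q l \<omega> t \<partial>L) \<partial>M) - (\<integral>\<omega>. f (\<integral>t. min (q l \<omega> t) K \<partial>L) \<partial>M)\<bar> \<le> \<epsilon> / 8 + \<kappa> * D K l"
        using truncated_functional_close[OF M L q q_nonneg q_int q_bound C K f \<kappa>(1) e0 \<kappa>(2), of l]
        unfolding eW D_def by blast
      moreover have "\<bar>(\<integral>\<omega>. f (\<integral>t. p \<omega> t \<partial>L) \<partial>N) - (\<integral>\<omega>. f (\<integral>t. min (p \<omega> t) K \<partial>L) \<partial>N)\<bar> \<le> \<epsilon> / 8 + \<kappa> * D' K"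
        using truncated_functional_close[OF N L p p_nonneg p_int p_bound C K f \<kappa>(1) e0 \<kappa>(2)]
        unfolding eW D'_def by blast
      ultimately show ?thesis
        using l0[of l] l1[of l] l n \<epsilon> unfolding K_def[symmetric] real_norm_def by linarith
    qed
    then show "\<exists>no. \<forall>l\<ge>no. norm ((\<integral>\<omega>. f (\<integral>t. q l \<omega> t \<partial>L) \<partial>M) - (\<integral>\<omega>. f (\<integral>t. p \<omega> t \<partial>L) \<partial>N)) < \<epsilon>"
      by blast
  qed
qed

section \<open>Finite-dimensional distributions\<close>

text \<open>Trigonometric polynomials in finitely many values of a path. Closure under addition is
  built in, so that convergence of expectations is a short induction from characteristic functions;
  closure under products is a lemma because frequencies add.\<close>

inductive trig_functional :: "'t set \<Rightarrow> (('t \<Rightarrow> 'a::euclidean_space) \<Rightarrow> complex) \<Rightarrow> bool" for T where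
  cis: "finite F \<Longrightarrow> F \<subseteq> T \<Longrightarrow> trig_functional T (\<lambda>y. c * cis (\<Sum>t\<in>F. a t \<bullet> y t))"
| add: "trig_functional T f \<Longrightarrow> trig_functional T g \<Longrightarrow> trig_functional T (\<lambda>y. f y + g y)"

lemma trig_functional_const: "trig_functional T (\<lambda>_. c)"
  using trig_functional.cis[of "{}" T c] by simp

lemma trig_functional_mult_cis:
  assumes "trig_functional T f" "finite F" "F \<subseteq> T"
  shows "trig_functional T (\<lambda>y. (c * cis (\<Sum>t\<in>F. a t \<bullet> y t)) * f y)"
  using assms(1)
proof induction
  case (cis G d b)
  \<comment> \<open>A time that occurs in only one of the two index sets gets frequency 0 from the
    other factor.\<close>
  define e where "e t = (if t \<in> F then a t else 0) + (if t \<in> G then b t else 0)" for t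
  have "(\<Sum>t\<in>F. a t \<bullet> y t) + (\<Sum>t\<in>G. b t \<bullet> y t) = (\<Sum>t\<in>F \<union> G. e t \<bullet> y t)" for y
  proof -
    have "(\<Sum>t\<in>F \<union> G. e t \<bullet> y t) = (\<Sum>t\<in>F \<union> G. (if t \<in> F then a t \<bullet> y t else 0)) + (\<Sum>t\<in>F \<union> G. (if t \<in> G then b t \<bullet> y t else 0))"
      unfolding sum.distrib[symmetric] e_def by (intro sum.cong) (auto simp: inner_add_left)
    also have "(\<Sum>t\<in>F \<union> G. (if t \<in> F then a t \<bullet> y t else 0)) = (\<Sum>t\<in>F. a t \<bullet> y t)"
      using assms cis by (intro sum.mono_neutral_cong_right) auto
    also have "(\<Sum>t\<in>F \<union> G. (if t \<in> G then b t \<bullet> y t else 0)) = (\<Sum>t\<in>G. b t \<bullet> y t)"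
      using assms cis by (intro sum.mono_neutral_cong_right) auto
    finally show ?thesis by simp
  qed
  then have "(\<lambda>y. (c * cis (\<Sum>t\<in>F. a t \<bullet> y t)) * (d * cis (\<Sum>t\<in>G. b t \<bullet> y t)))
      = (\<lambda>y. (c * d) * cis (\<Sum>t\<in>F \<union> G. e t \<bullet> y t))"
    by (simp add: fun_eq_iff mult_ac cis_mult)
  then show ?case using trig_functional.cis[of "F \<union> G" T "c * d" e] assms cis by simp
next
  case (add f g)
  then show ?case by (simp add: ring_distribs trig_functional.add)
qed

lemma trig_functional_mult:
  assumes "trig_functional T f" "trig_functional T g"
  shows "trig_functional T (\<lambda>y. f y * g y)"
  using assms(1)
proof induction
  case (cis F c a)
  then show ?case by (intro trig_functional_mult_cis assms(2))
next
  case (add f g)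
  then show ?case by (simp add: ring_distribs trig_functional.add)
qed

lemma trig_functional_prod:
  assumes "\<And>k. k \<in> I \<Longrightarrow> trig_functional T (f k)"
  shows "trig_functional T (\<lambda>y. \<Prod>k\<in>I. f k y)"
  using assms by (induction I rule: infinite_finite_induct)
    (auto intro: trig_functional_const trig_functional_mult)

lemma trig_functional_sum:
  assumes "\<And>k. k \<in> I \<Longrightarrow> trig_functional T (f k)"
  shows "trig_functional T (\<lambda>y. \<Sum>k\<in>I. f k y)"
  using assms by (induction I rule: infinite_finite_induct)
    (auto intro: trig_functional_const trig_functional.add)

lemma trig_functional_sin:
  assumes "t \<in> T"
  shows "trig_functional T (\<lambda>y. complex_of_real (sin (a \<bullet> y t)))"
proof -
  have eq: "(\<lambda>y. complex_of_real (sin (a \<bullet> y t))) =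
     (\<lambda>y. (- \<i> / 2) * cis (\<Sum>t\<in>{t}. a \<bullet> y t) + (\<i> / 2) * cis (\<Sum>t\<in>{t}. (- a) \<bullet> y t))"
    by (auto simp: fun_eq_iff complex_eq_iff)
  show ?thesis unfolding eq
    by (intro trig_functional.add trig_functional.cis[where a="\<lambda>_. a"] trig_functional.cis[where a="\<lambda>_. -a"])
       (use assms in auto)
qed

lemma trig_functional_converges:
  assumes "trig_functional T f"
    and M: "prob_space M" and N: "prob_space N"
    and X: "\<And>l t. t \<in> T \<Longrightarrow> (\<lambda>\<omega>. X l \<omega> t) \<in> borel_measurable M"
    and Y: "\<And>t. t \<in> T \<Longrightarrow> (\<lambda>\<omega>. Y \<omega> t) \<in> borel_measurable N"
    and char: "\<And>F a. finite F \<Longrightarrow> F \<subseteq> T \<Longrightarrow>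
      (\<lambda>l. \<integral>\<omega>. cis (\<Sum>t\<in>F. a t \<bullet> X l \<omega> t) \<partial>M) \<longlonglongrightarrow> (\<integral>\<omega>. cis (\<Sum>t\<in>F. a t \<bullet> Y \<omega> t) \<partial>N)"
  shows "(\<forall>l. integrable M (\<lambda>\<omega>. f (X l \<omega>))) \<and> integrable N (\<lambda>\<omega>. f (Y \<omega>)) \<and>
    (\<lambda>l. \<integral>\<omega>. f (X l \<omega>) \<partial>M) \<longlonglongrightarrow> (\<integral>\<omega>. f (Y \<omega>) \<partial>N)"
  using assms(1)
proof induction
  case (cis F c a)
  interpret M: prob_space M by fact
  interpret N: prob_space N by fact
  have cm: "cis \<in> borel_measurable borel"
    by (intro borel_measurable_continuous_onI continuous_intros)
  have 1: "integrable M (\<lambda>\<omega>. cis (\<Sum>t\<in>F. a t \<bullet> X l \<omega> t))" for l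
  proof (rule M.integrable_const_bound[where B=1])
    have "(\<lambda>\<omega>. \<Sum>t\<in>F. a t \<bullet> X l \<omega> t) \<in> borel_measurable M"
      using X cis by (intro borel_measurable_sum borel_measurable_inner) auto
    then show "(\<lambda>\<omega>. cis (\<Sum>t\<in>F. a t \<bullet> X l \<omega> t)) \<in> borel_measurable M"
      by (rule measurable_compose[OF _ cm])
  qed simp
  have 2: "integrable N (\<lambda>\<omega>. cis (\<Sum>t\<in>F. a t \<bullet> Y \<omega> t))"
  proof (rule N.integrable_const_bound[where B=1])
    have "(\<lambda>\<omega>. \<Sum>t\<in>F. a t \<bullet> Y \<omega> t) \<in> borel_measurable N"
      using Y cis by (intro borel_measurable_sum borel_measurable_inner) auto
    then show "(\<lambda>\<omega>. cis (\<Sum>t\<in>F. a t \<bullet> Y \<omega> t)) \<in> borel_measurable N"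
      by (rule measurable_compose[OF _ cm])
  qed simp
  from 1 2 char[OF cis] show ?case by (auto intro: tendsto_mult_left)
next
  case (add f g)
  then show ?case by (auto intro: tendsto_add)
qed

lemma sin_polynomial_trig_functional:
  assumes "real_polynomial_function (p :: 'a::euclidean_space \<Rightarrow> real)" and t: "t \<in> T"
  shows "trig_functional T (\<lambda>y. complex_of_real (p (\<Sum>b\<in>Basis. sin (\<alpha> * (y t \<bullet> b)) *\<^sub>R b)))"
  using assms(1)
proof induction
  case (linear f)
  then interpret bounded_linear f .
  have eq: "(\<lambda>y. complex_of_real (f (\<Sum>b\<in>Basis. sin (\<alpha> * (y t \<bullet> b)) *\<^sub>R b)))
     = (\<lambda>y. \<Sum>b\<in>Basis. complex_of_real (f b) * complex_of_real (sin ((\<alpha> *\<^sub>R b) \<bullet> y t)))"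
    by (simp add: fun_eq_iff sum scaleR inner_commute mult_ac)
  show ?case unfolding eq
    by (intro trig_functional_sum trig_functional_mult trig_functional_const trig_functional_sin t)
qed (auto intro: trig_functional_const trig_functional.add trig_functional_mult)

text \<open>The approximation is a polynomial in the numbers \<open>sin (\<alpha> * (y \<bullet> b))\<close>, which range over a compact
  cube; hence it stays bounded on the whole space and not only where it is close to \<open>h\<close>.\<close>

lemma trig_approximation:
  fixes h :: "'a::euclidean_space \<Rightarrow> real" and T :: "'t set"
  assumes h: "continuous_on UNIV h" and h1: "\<And>y. \<bar>h y\<bar> \<le> 1" and e: "e > 0"
  obtains p where "continuous_on UNIV p" "\<And>y. \<bar>p y\<bar> \<le> 1"
    "\<And>y. \<bar>h y - p y\<bar> \<le> e * (1 + (norm y)\<^sup>2)"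
    "\<And>t. t \<in> T \<Longrightarrow> trig_functional T (\<lambda>y. complex_of_real (p (y t)))"
proof -
  \<comment> \<open>Outside the ball of radius \<open>R\<close> the allowed error is at least 2, the
    largest possible difference of two functions bounded by 1.\<close>
  define R where "R = sqrt (2 / e)"
  have R: "R > 0" using e by (simp add: R_def)
  \<comment> \<open>Coordinates of size at most \<open>R\<close> are scaled into
    \<open>[-pi/2, pi/2]\<close>, where \<open>arcsin\<close> inverts \<open>sin\<close>.\<close>
  define \<alpha> where "\<alpha> = pi / (2 * R)"
  have \<alpha>: "\<alpha> > 0" using R by (simp add: \<alpha>_def)
  define S :: "'a \<Rightarrow> 'a" where "S y = (\<Sum>b\<in>Basis. sin (\<alpha> * (y \<bullet> b)) *\<^sub>R b)" for y
  \<comment> \<open>\<open>h\<close> read in the coordinates \<open>S y\<close>: on the ball of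
    radius \<open>R\<close> one has \<open>G (S y) = h y\<close>, and on the whole cube
    \<open>G\<close> is continuous.\<close>
  define G :: "'a \<Rightarrow> real" where "G s = h (\<Sum>b\<in>Basis. (arcsin (s \<bullet> b) / \<alpha>) *\<^sub>R b)" for s
  have S_inner: "S y \<bullet> b = sin (\<alpha> * (y \<bullet> b))" if "b \<in> Basis" for y b
    using that by (simp add: S_def inner_sum_left inner_Basis if_distrib cong: if_cong)
  have S_box: "S y \<in> cbox (- One) One" for y
    by (simp add: mem_box S_inner)
  have contG: "continuous_on (cbox (- One) One) G"
    unfolding G_def
    by (intro continuous_on_compose2[OF h] continuous_intros) (use \<alpha> in \<open>auto simp: mem_box\<close>)
  obtain p0 where p0: "real_polynomial_function p0"
      "\<And>s. s \<in> cbox (- One) One \<Longrightarrow> \<bar>G s - p0 s\<bar> < e / 2"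
    using Stone_Weierstrass_real_polynomial_function[of "cbox (- One) One" G "e/2"] contG e by auto
  have G1: "\<bar>G s\<bar> \<le> 1" for s by (simp add: G_def h1)
  \<comment> \<open>The approximating polynomial may exceed 1 by \<open>e / 2\<close>; the division
    restores the bound 1 and costs at most another \<open>e / 2\<close>.\<close>
  define p where "p y = p0 (S y) / (1 + e / 2)" for y
  have p0S: "\<bar>p0 (S y)\<bar> \<le> 1 + e / 2" for y
    using p0(2)[OF S_box[of y]] G1[of "S y"] by linarith
  show thesis
  proof (rule that[of p])
    have "continuous_on UNIV S" unfolding S_def by (intro continuous_intros)
    moreover have "continuous_on UNIV p0"
      using p0(1) continuous_on_polymonial_function real_polynomial_function_eq by blast
    ultimately show "continuous_on UNIV p" unfolding p_def
      by (intro continuous_on_divide continuous_on_const continuous_on_compose2[of UNIV p0 UNIV S]) (use e in auto)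
    show p1: "\<bar>p y\<bar> \<le> 1" for y using p0S[of y] e by (simp add: p_def)
    show "\<bar>h y - p y\<bar> \<le> e * (1 + (norm y)\<^sup>2)" for y
    proof (cases "norm y \<le> R")
      case True
      have "arcsin (S y \<bullet> b) / \<alpha> = y \<bullet> b" if b: "b \<in> Basis" for b
      proof -
        have "\<bar>y \<bullet> b\<bar> \<le> R" using Basis_le_norm[OF b, of y] True by linarith
        then have "\<bar>\<alpha> * (y \<bullet> b)\<bar> \<le> \<alpha> * R" using \<alpha> by (simp add: abs_mult)
        also have "\<alpha> * R = pi / 2" using R by (simp add: \<alpha>_def)
        finally have "arcsin (sin (\<alpha> * (y \<bullet> b))) = \<alpha> * (y \<bullet> b)" by (intro arcsin_sin) auto
        then show ?thesis using \<alpha> by (simp add: S_inner b)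
      qed
      then have "G (S y) = h y" by (simp add: G_def euclidean_representation)
      then have "\<bar>h y - p0 (S y)\<bar> \<le> e / 2" using p0(2)[OF S_box[of y]] by simp
      moreover have "\<bar>p0 (S y) - p y\<bar> \<le> e / 2"
      proof -
        have "p0 (S y) - p y = (e / 2) * p y" using e by (simp add: p_def field_simps)
        then have "\<bar>p0 (S y) - p y\<bar> = (e / 2) * \<bar>p y\<bar>" using e by (simp only: abs_mult)
        also have "\<dots> \<le> (e / 2) * 1" using p1[of y] e by (intro mult_left_mono) auto
        finally show ?thesis by simp
      qed
      ultimately have "\<bar>h y - p y\<bar> \<le> e" by linarith
      also have "\<dots> \<le> e * (1 + (norm y)\<^sup>2)" using e by simp
      finally show ?thesis .
    next
      case False
      then have "R\<^sup>2 \<le> (norm y)\<^sup>2" using R by (intro power_mono) auto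
      then have "2 \<le> e * (norm y)\<^sup>2" using e by (simp add: R_def field_simps)
      moreover have "\<bar>h y - p y\<bar> \<le> 2" using h1[of y] p1[of y] by linarith
      ultimately show ?thesis using e by (simp add: algebra_simps)
    qed
    show "trig_functional T (\<lambda>y. complex_of_real (p (y t)))" if "t \<in> T" for t
      using trig_functional_mult[OF trig_functional_const[of T "complex_of_real (1 / (1 + e/2))"]
          sin_polynomial_trig_functional[OF p0(1) that, of \<alpha>]]
      unfolding p_def S_def of_real_mult[symmetric] by simp
  qed
qed

text \<open>Characteristic functions settle the case of trigonometric polynomials. The approximation
  error of \<open>trig_approximation\<close> grows quadratically and is absorbed by the uniform
  bound on second moments; this plays the part of tightness. A product of factors bounded by 1
  changes by at most the sum of the changes of its factors.\<close>

lemma fdd_product_converges: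
  fixes X :: "nat \<Rightarrow> 'w \<Rightarrow> 't \<Rightarrow> 'a::euclidean_space" and Y :: "'v \<Rightarrow> 't \<Rightarrow> 'a"
  assumes M: "prob_space M" and N: "prob_space N"
    and X: "\<And>l t. t \<in> T \<Longrightarrow> (\<lambda>\<omega>. X l \<omega> t) \<in> borel_measurable M"
    and Y: "\<And>t. t \<in> T \<Longrightarrow> (\<lambda>\<omega>. Y \<omega> t) \<in> borel_measurable N"
    and char: "\<And>F a. finite F \<Longrightarrow> F \<subseteq> T \<Longrightarrow>
      (\<lambda>l. \<integral>\<omega>. cis (\<Sum>t\<in>F. a t \<bullet> X l \<omega> t) \<partial>M) \<longlonglongrightarrow> (\<integral>\<omega>. cis (\<Sum>t\<in>F. a t \<bullet> Y \<omega> t) \<partial>N)"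
    and X2: "\<And>l t. t \<in> T \<Longrightarrow> integrable M (\<lambda>\<omega>. (norm (X l \<omega> t))\<^sup>2)"
    and Y2: "\<And>t. t \<in> T \<Longrightarrow> integrable N (\<lambda>\<omega>. (norm (Y \<omega> t))\<^sup>2)"
    and XC: "\<And>l t. t \<in> T \<Longrightarrow> (\<integral>\<omega>. (norm (X l \<omega> t))\<^sup>2 \<partial>M) \<le> C"
    and YC: "\<And>t. t \<in> T \<Longrightarrow> (\<integral>\<omega>. (norm (Y \<omega> t))\<^sup>2 \<partial>N) \<le> C"
    and ts: "\<And>k. k < m \<Longrightarrow> ts k \<in> T"
    and h: "\<And>k. k < m \<Longrightarrow> continuous_on UNIV (h k :: 'a \<Rightarrow> real)" "\<And>k y. k < m \<Longrightarrow> \<bar>h k y\<bar> \<le> 1"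
  shows "(\<lambda>l. \<integral>\<omega>. (\<Prod>k<m::nat. h k (X l \<omega> (ts k))) \<partial>M) \<longlonglongrightarrow> (\<integral>\<omega>. (\<Prod>k<m. h k (Y \<omega> (ts k))) \<partial>N)"
proof (rule LIMSEQ_I)
  fix \<epsilon> :: real assume \<epsilon>: "\<epsilon> > 0"
  interpret M: prob_space M by fact
  interpret N: prob_space N by fact
  \<comment> \<open>Each of the \<open>m\<close> factors costs at most
    \<open>e * (1 + \<bar>C\<bar>)\<close> in mean. The \<open>+ 1\<close> keeps \<open>e\<close>
    positive for \<open>m = 0\<close>.\<close>
  define e where "e = \<epsilon> / (4 * (real m + 1) * (1 + \<bar>C\<bar>))"
  have e: "e > 0" using \<epsilon> by (auto simp: e_def intro!: divide_pos_pos mult_pos_pos)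
  have "\<forall>k\<in>{..<m}. \<exists>p. continuous_on UNIV p \<and> (\<forall>y. \<bar>p y\<bar> \<le> 1) \<and> (\<forall>y. \<bar>h k y - p y\<bar> \<le> e * (1 + (norm y)\<^sup>2)) \<and>
    (\<forall>t. t \<in> T \<longrightarrow> trig_functional T (\<lambda>y. complex_of_real (p (y t))))"
  proof
    fix k assume "k \<in> {..<m}"
    then have k: "k < m" by simp
    show "\<exists>p. continuous_on UNIV p \<and> (\<forall>y. \<bar>p y\<bar> \<le> 1) \<and> (\<forall>y. \<bar>h k y - p y\<bar> \<le> e * (1 + (norm y)\<^sup>2)) \<and>
      (\<forall>t. t \<in> T \<longrightarrow> trig_functional T (\<lambda>y. complex_of_real (p (y t))))"
    proof (rule trig_approximation[OF h(1)[OF k] h(2)[OF k] e, where T=T])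
      fix p assume p: "continuous_on UNIV p" "\<And>y. \<bar>p y\<bar> \<le> 1" "\<And>y. \<bar>h k y - p y\<bar> \<le> e * (1 + (norm y)\<^sup>2)"
        "\<And>t. t \<in> T \<Longrightarrow> trig_functional T (\<lambda>y. complex_of_real (p (y t)))"
      show ?thesis
        by (rule exI[of _ p]) (intro conjI allI impI p)
    qed
  qed
  from bchoice[OF this] obtain p where p: "\<forall>k\<in>{..<m}. continuous_on UNIV (p k) \<and> (\<forall>y. \<bar>p k y\<bar> \<le> 1) \<and>
      (\<forall>y. \<bar>h k y - p k y\<bar> \<le> e * (1 + (norm y)\<^sup>2)) \<and>
      (\<forall>t. t \<in> T \<longrightarrow> trig_functional T (\<lambda>y. complex_of_real (p k (y t))))" ..
  have pc: "continuous_on UNIV (p k)" and p1: "\<bar>p k y\<bar> \<le> 1"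
    and pe: "\<bar>h k y - p k y\<bar> \<le> e * (1 + (norm y)\<^sup>2)"
    and pt: "t \<in> T \<Longrightarrow> trig_functional T (\<lambda>y. complex_of_real (p k (y t)))" if "k < m" for k y t
    using p that by auto
  have "trig_functional T (\<lambda>y. \<Prod>k<m. complex_of_real (p k (y (ts k))))"
    by (intro trig_functional_prod pt) (auto intro: ts)
  then have "trig_functional T (\<lambda>y. complex_of_real (\<Prod>k<m. p k (y (ts k))))" by simp
  from trig_functional_converges[OF this M N X Y char]
  have "(\<lambda>l. \<integral>\<omega>. complex_of_real (\<Prod>k<m. p k (X l \<omega> (ts k))) \<partial>M)
      \<longlonglongrightarrow> (\<integral>\<omega>. complex_of_real (\<Prod>k<m. p k (Y \<omega> (ts k))) \<partial>N)" by simp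
  then have conv: "(\<lambda>l. \<integral>\<omega>. (\<Prod>k<m. p k (X l \<omega> (ts k))) \<partial>M)
      \<longlonglongrightarrow> (\<integral>\<omega>. (\<Prod>k<m. p k (Y \<omega> (ts k))) \<partial>N)"
    unfolding integral_complex_of_real by (simp only: tendsto_of_real_iff)
  have close: "\<bar>(\<integral>\<omega>. (\<Prod>k<m. h k (Z \<omega> (ts k))) \<partial>Q) - (\<integral>\<omega>. (\<Prod>k<m. p k (Z \<omega> (ts k))) \<partial>Q)\<bar> \<le> \<epsilon> / 4"
    if Q: "prob_space Q" and Z: "\<And>t. t \<in> T \<Longrightarrow> (\<lambda>\<omega>. Z \<omega> t) \<in> borel_measurable Q"
      and Z2: "\<And>t. t \<in> T \<Longrightarrow> integrable Q (\<lambda>\<omega>. (norm (Z \<omega> t))\<^sup>2)"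
      and ZC: "\<And>t. t \<in> T \<Longrightarrow> (\<integral>\<omega>. (norm (Z \<omega> t))\<^sup>2 \<partial>Q) \<le> C"
    for Q :: "'x measure" and Z :: "'x \<Rightarrow> 't \<Rightarrow> 'a"
  proof -
    interpret Q: prob_space Q by fact
    have i: "integrable Q (\<lambda>\<omega>. (\<Prod>k<m. g k (Z \<omega> (ts k))))"
      if g: "\<And>k. k < m \<Longrightarrow> continuous_on UNIV (g k)" "\<And>k y. k < m \<Longrightarrow> \<bar>g k y\<bar> \<le> 1" for g :: "nat \<Rightarrow> 'a \<Rightarrow> real"
    proof (rule Q.integrable_const_bound[where B=1])
      show "(\<lambda>\<omega>. (\<Prod>k<m. g k (Z \<omega> (ts k)))) \<in> borel_measurable Q"
      proof (rule borel_measurable_prod)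
        fix k assume k: "k \<in> {..<m}"
        then have "g k \<in> borel_measurable borel" by (intro borel_measurable_continuous_onI g) auto
        then show "(\<lambda>\<omega>. g k (Z \<omega> (ts k))) \<in> borel_measurable Q"
          using Z[OF ts[of k]] k by (intro measurable_compose[of _ Q borel "g k"]) auto
      qed
      have "norm (\<Prod>k<m. g k (Z \<omega> (ts k))) \<le> 1" for \<omega>
        unfolding real_norm_def abs_prod by (intro prod_le_1) (auto intro: g)
      then show "AE \<omega> in Q. norm (\<Prod>k<m. g k (Z \<omega> (ts k))) \<le> 1" by simp
    qed
    have i': "integrable Q (\<lambda>\<omega>. \<Sum>k<m. e * (1 + (norm (Z \<omega> (ts k)))\<^sup>2))"
      using Z2 ts by (intro Bochner_Integration.integrable_sum) auto
    have "\<bar>(\<integral>\<omega>. (\<Prod>k<m. h k (Z \<omega> (ts k))) \<partial>Q) - (\<integral>\<omega>. (\<Prod>k<m. p k (Z \<omega> (ts k))) \<partial>Q)\<bar>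
        = \<bar>\<integral>\<omega>. (\<Prod>k<m. h k (Z \<omega> (ts k))) - (\<Prod>k<m. p k (Z \<omega> (ts k))) \<partial>Q\<bar>"
      using i[OF h] i[OF pc p1] by simp
    also have "\<dots> \<le> (\<integral>\<omega>. \<bar>(\<Prod>k<m. h k (Z \<omega> (ts k))) - (\<Prod>k<m. p k (Z \<omega> (ts k)))\<bar> \<partial>Q)"
      by (rule integral_abs_bound)
    also have "\<dots> \<le> (\<integral>\<omega>. (\<Sum>k<m. e * (1 + (norm (Z \<omega> (ts k)))\<^sup>2)) \<partial>Q)"
    proof (rule integral_mono)
      fix \<omega>
      have "\<bar>(\<Prod>k<m. h k (Z \<omega> (ts k))) - (\<Prod>k<m. p k (Z \<omega> (ts k)))\<bar>
         \<le> (\<Sum>k<m. \<bar>h k (Z \<omega> (ts k)) - p k (Z \<omega> (ts k))\<bar>)"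
        using norm_prod_diff[of "{..<m}" "\<lambda>k. h k (Z \<omega> (ts k))" "\<lambda>k. p k (Z \<omega> (ts k))"] h(2) p1 by simp
      also have "\<dots> \<le> (\<Sum>k<m. e * (1 + (norm (Z \<omega> (ts k)))\<^sup>2))" by (intro sum_mono pe) auto
      finally show "\<bar>(\<Prod>k<m. h k (Z \<omega> (ts k))) - (\<Prod>k<m. p k (Z \<omega> (ts k)))\<bar> \<le> (\<Sum>k<m. e * (1 + (norm (Z \<omega> (ts k)))\<^sup>2))" .
    qed (use i[OF h] i[OF pc p1] i' in auto)
    also have "\<dots> = (\<Sum>k<m. e * (1 + (\<integral>\<omega>. (norm (Z \<omega> (ts k)))\<^sup>2 \<partial>Q)))"
      using Z2 ts by (subst Bochner_Integration.integral_sum) (auto simp: Q.prob_space)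
    also have "\<dots> \<le> (\<Sum>k<m. e * (1 + \<bar>C\<bar>))"
    proof (intro sum_mono mult_left_mono add_left_mono)
      fix k assume "k \<in> {..<m}"
      then have "(\<integral>\<omega>. (norm (Z \<omega> (ts k)))\<^sup>2 \<partial>Q) \<le> C" by (intro ZC ts) auto
      then show "(\<integral>\<omega>. (norm (Z \<omega> (ts k)))\<^sup>2 \<partial>Q) \<le> \<bar>C\<bar>" by linarith
    qed (use e in auto)
    also have "\<dots> = real m * (e * (1 + \<bar>C\<bar>))" by simp
    also have "\<dots> \<le> (real m + 1) * (e * (1 + \<bar>C\<bar>))" using e by (intro mult_right_mono) auto
    also have "\<dots> = \<epsilon> / 4"
    proof -
      have "real m + 1 \<noteq> 0" "1 + \<bar>C\<bar> \<noteq> 0" by linarith+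
      then show ?thesis unfolding e_def by (simp add: divide_simps)
    qed
    finally show ?thesis .
  qed
  from LIMSEQ_D[OF conv, of "\<epsilon>/4"] \<epsilon> obtain l0 where l0: "\<And>l. l \<ge> l0 \<Longrightarrow>
     norm ((\<integral>\<omega>. (\<Prod>k<m. p k (X l \<omega> (ts k))) \<partial>M) - (\<integral>\<omega>. (\<Prod>k<m. p k (Y \<omega> (ts k))) \<partial>N)) < \<epsilon> / 4" by auto
  have "norm ((\<integral>\<omega>. (\<Prod>k<m. h k (X l \<omega> (ts k))) \<partial>M) - (\<integral>\<omega>. (\<Prod>k<m. h k (Y \<omega> (ts k))) \<partial>N)) < \<epsilon>"
    if "l \<ge> l0" for l
  proof -
    have "\<bar>(\<integral>\<omega>. (\<Prod>k<m. h k (X l \<omega> (ts k))) \<partial>M) - (\<integral>\<omega>. (\<Prod>k<m. p k (X l \<omega> (ts k))) \<partial>M)\<bar> \<le> \<epsilon> / 4"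
      by (rule close[OF M X X2 XC])
    moreover have "\<bar>(\<integral>\<omega>. (\<Prod>k<m. h k (Y \<omega> (ts k))) \<partial>N) - (\<integral>\<omega>. (\<Prod>k<m. p k (Y \<omega> (ts k))) \<partial>N)\<bar> \<le> \<epsilon> / 4"
      by (rule close[OF N Y Y2 YC])
    ultimately show ?thesis using l0[OF that] \<epsilon> unfolding real_norm_def by linarith
  qed
  then show "\<exists>no. \<forall>l\<ge>no. norm ((\<integral>\<omega>. (\<Prod>k<m. h k (X l \<omega> (ts k))) \<partial>M) - (\<integral>\<omega>. (\<Prod>k<m. h k (Y \<omega> (ts k))) \<partial>N)) < \<epsilon>"
    by blast
qed

section \<open>The central limit theorem and Gaussian variables\<close>

text \<open>The central limit theorem for a single sample in a form where sample size
  \<open>n l\<close> and scaling \<open>c l\<close> are linked only by the limit of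
  \<open>n * c^2\<close>, as the sample sizes are arbitrary sequences. The powers of two numbers in
  the closed unit disc differ by at most \<open>n l\<close> times the difference of the
  numbers.\<close>

lemma char_power_limit:
  assumes \<mu>: "real_distribution \<mu>"
    and m1: "integrable \<mu> (\<lambda>x. x)" "(\<integral>x. x \<partial>\<mu>) = 0"
    and m2: "integrable \<mu> (\<lambda>x. x\<^sup>2)" "(\<integral>x. x\<^sup>2 \<partial>\<mu>) = v"
    and c: "c \<longlonglongrightarrow> 0" and s: "(\<lambda>l. real (n l) * (c l)\<^sup>2) \<longlonglongrightarrow> s"
  shows "(\<lambda>l. char \<mu> (c l) ^ n l) \<longlonglongrightarrow> exp (- complex_of_real (s * v / 2))"
proof -
  interpret \<mu>: real_distribution \<mu> by fact
  define u where "u l = (c l)\<^sup>2 * v / 2" for l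
  \<comment> \<open>\<open>(c l)\<^sup>2 / 6 * I l\<close> bounds the remainder of the second-order
    expansion of the characteristic function. The minimum with \<open>6 * x\<^sup>2\<close> lets
    \<open>I\<close> tend to 0 by dominated convergence with second moments alone.\<close>
  define I where "I l = (\<integral>x. min (6 * x\<^sup>2) (\<bar>c l\<bar> * \<bar>x\<bar> ^ 3) \<partial>\<mu>)" for l
  have v: "v \<ge> 0" unfolding m2(2)[symmetric] by simp
  have u: "u l \<ge> 0" for l using v by (simp add: u_def)
  have e1: "\<bar>exp (- u l) - (1 - u l)\<bar> \<le> (u l)\<^sup>2" for l
  proof -
    have "exp (- u l) * (1 + u l) \<le> exp (- u l) * exp (u l)"
      using exp_ge_add_one_self[of "u l"] by (intro mult_left_mono) auto
    then have "exp (- u l) * (1 + u l) \<le> 1" by (simp add: exp_minus)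
    \<comment> \<open>The product on the right equals \<open>1 + u l ^ 3\<close>.\<close>
    also have "1 \<le> (1 - u l + (u l)\<^sup>2) * (1 + u l)"
      using u[of l] by (simp add: algebra_simps power2_eq_square)
    finally have "exp (- u l) \<le> 1 - u l + (u l)\<^sup>2"
      using u[of l] by simp
    moreover have "1 - u l \<le> exp (- u l)" using exp_ge_add_one_self[of "- u l"] by simp
    ultimately show ?thesis by simp
  qed
  have main: "norm (char \<mu> (c l) ^ n l - complex_of_real (exp (- u l)) ^ n l)
      \<le> real (n l) * (c l)\<^sup>2 * (I l / 6) + (real (n l) * (c l)\<^sup>2) * (c l)\<^sup>2 * (v / 2)\<^sup>2" for l
  proof -
    have "norm (char \<mu> (c l) ^ n l - complex_of_real (exp (- u l)) ^ n l)
        \<le> n l * norm (char \<mu> (c l) - complex_of_real (exp (- u l)))"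
      by (rule norm_power_diff[OF \<mu>.cmod_char_le_1]) (use u in simp)
    also have "norm (char \<mu> (c l) - complex_of_real (exp (- u l))) \<le>
        norm (char \<mu> (c l) - (1 - complex_of_real (u l))) + norm (complex_of_real (exp (- u l)) - (1 - complex_of_real (u l)))"
      by norm
    also have "norm (complex_of_real (exp (- u l)) - (1 - complex_of_real (u l))) = \<bar>exp (- u l) - (1 - u l)\<bar>"
      by (metis norm_of_real of_real_1 of_real_diff real_norm_def)
    also have "\<dots> \<le> (u l)\<^sup>2" by (rule e1)
    also have "norm (char \<mu> (c l) - (1 - complex_of_real (u l))) \<le> (c l)\<^sup>2 / 6 * I l"
      using \<mu>.char_approx3[OF m1 m2(1), of v "c l"] m1 m2 by (simp add: u_def I_def)
    finally have "norm (char \<mu> (c l) ^ n l - complex_of_real (exp (- u l)) ^ n l)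
       \<le> real (n l) * ((c l)\<^sup>2 / 6 * I l + (u l)\<^sup>2)" by (simp add: mult_left_mono)
    also have "\<dots> = real (n l) * (c l)\<^sup>2 * (I l / 6) + (real (n l) * (c l)\<^sup>2) * (c l)\<^sup>2 * (v / 2)\<^sup>2"
      by (simp add: u_def algebra_simps power2_eq_square)
    finally show ?thesis .
  qed
  have I_lim: "I \<longlonglongrightarrow> (\<integral>x. 0 \<partial>\<mu>)"
    unfolding I_def
  proof (rule integral_dominated_convergence[where w = "\<lambda>x. 6 * x^2"])
    show "AE x in \<mu>. (\<lambda>l. min (6 * x\<^sup>2) (\<bar>c l\<bar> * \<bar>x\<bar> ^ 3)) \<longlonglongrightarrow> 0"
    proof (rule AE_I2)
      fix x :: real
      have "(\<lambda>l. min (6 * x\<^sup>2) (\<bar>c l\<bar> * \<bar>x\<bar> ^ 3)) \<longlonglongrightarrow> min (6 * x\<^sup>2) (\<bar>0\<bar> * \<bar>x\<bar> ^ 3)"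
        by (intro tendsto_intros c)
      then show "(\<lambda>l. min (6 * x\<^sup>2) (\<bar>c l\<bar> * \<bar>x\<bar> ^ 3)) \<longlonglongrightarrow> 0" by simp
    qed
    show "integrable \<mu> (\<lambda>x. 6 * x\<^sup>2)" using m2 by simp
  qed (auto intro!: AE_I2)
  have I_lim0: "I \<longlonglongrightarrow> 0" using I_lim by simp
  have "(\<lambda>l. real (n l) * (c l)\<^sup>2 * (I l / 6) + (real (n l) * (c l)\<^sup>2) * (c l)\<^sup>2 * (v / 2)\<^sup>2)
      \<longlonglongrightarrow> s * (0 / 6) + s * 0\<^sup>2 * (v / 2)\<^sup>2"
    by (intro tendsto_add tendsto_mult tendsto_power tendsto_const tendsto_divide I_lim0 s c) simp
  then have lim0: "(\<lambda>l. real (n l) * (c l)\<^sup>2 * (I l / 6) + (real (n l) * (c l)\<^sup>2) * (c l)\<^sup>2 * (v / 2)\<^sup>2) \<longlonglongrightarrow> 0"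
    by simp
  have 1: "(\<lambda>l. char \<mu> (c l) ^ n l - complex_of_real (exp (- u l)) ^ n l) \<longlonglongrightarrow> 0"
    by (rule Lim_null_comparison[OF always_eventually lim0]) (use main in blast)
  have "(\<lambda>l. exp (- complex_of_real (real (n l) * (c l)\<^sup>2 * v / 2))) \<longlonglongrightarrow> exp (- complex_of_real (s * v / 2))"
    by (intro tendsto_intros s) simp_all
  also have "(\<lambda>l. exp (- complex_of_real (real (n l) * (c l)\<^sup>2 * v / 2))) = (\<lambda>l. complex_of_real (exp (- u l)) ^ n l)"
  proof
    fix l
    have "exp (- complex_of_real (real (n l) * (c l)\<^sup>2 * v / 2)) = exp (of_nat (n l) * complex_of_real (- u l))"
      by (simp add: u_def mult.assoc)
    also have "\<dots> = complex_of_real (exp (- u l)) ^ n l"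
      by (simp only: exp_of_nat_mult exp_of_real)
    finally show "exp (- complex_of_real (real (n l) * (c l)\<^sup>2 * v / 2)) = complex_of_real (exp (- u l)) ^ n l" .
  qed
  finally have 2: "(\<lambda>l. complex_of_real (exp (- u l)) ^ n l) \<longlonglongrightarrow> exp (- complex_of_real (s * v / 2))" .
  show ?thesis using tendsto_add[OF 1 2] by simp
qed

text \<open>Independence over all pairs \<open>(i, j)\<close> factorizes the characteristic function
  of the double sum into powers, one for each sample, so that the samples pass to the limit
  separately.\<close>

lemma (in prob_space) multi_sample_clt:
  fixes \<xi> :: "'k::finite \<Rightarrow> nat \<Rightarrow> 'a \<Rightarrow> real" and n :: "nat \<Rightarrow> 'k \<Rightarrow> nat"
  assumes indep: "indep_vars (\<lambda>_. borel) (\<lambda>(i, j). \<xi> i j) (UNIV \<times> {1..})"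
    and ident: "\<And>i j. j \<ge> 1 \<Longrightarrow> distr M borel (\<xi> i j) = distr M borel (\<xi> i 1)"
    and mean: "\<And>i. expectation (\<xi> i 1) = 0"
    and sq: "\<And>i. integrable M (\<lambda>\<omega>. (\<xi> i 1 \<omega>)\<^sup>2)"
    and c: "\<And>i. (\<lambda>l. c l i) \<longlonglongrightarrow> 0" and s: "\<And>i. (\<lambda>l. real (n l i) * (c l i)\<^sup>2) \<longlonglongrightarrow> s i"
  shows "(\<lambda>l. \<integral>\<omega>. cis (\<Sum>i\<in>UNIV. c l i * (\<Sum>j=1..n l i. \<xi> i j \<omega>)) \<partial>M)
     \<longlonglongrightarrow> complex_of_real (exp (- (\<Sum>i\<in>UNIV. s i * expectation (\<lambda>\<omega>. (\<xi> i 1 \<omega>)\<^sup>2)) / 2))"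
proof -
  have rv: "\<xi> i j \<in> borel_measurable M" if "j \<ge> 1" for i j
    using indep that unfolding indep_vars_def2 by fastforce
  have rv1[measurable]: "\<xi> i 1 \<in> borel_measurable M" for i by (rule rv) simp
  have X1: "integrable M (\<xi> i 1)" for i
    by (rule square_integrable_imp_integrable[OF _ sq]) measurable
  define A where "A l = (SIGMA i:UNIV. {1..n l i})" for l
  have char_eq: "(\<integral>\<omega>. cis (\<Sum>i\<in>UNIV. c l i * (\<Sum>j=1..n l i. \<xi> i j \<omega>)) \<partial>M)
      = (\<Prod>i\<in>UNIV. char (distr M borel (\<xi> i 1)) (c l i) ^ n l i)" for l
  proof -
    have sum_eq: "(\<Sum>i\<in>UNIV. c l i * (\<Sum>j=1..n l i. \<xi> i j \<omega>)) = (\<Sum>p\<in>A l. c l (fst p) * (case p of (i, j) \<Rightarrow> \<xi> i j) \<omega>)" for \<omega>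
      unfolding A_def by (simp add: sum.Sigma sum_distrib_left split_beta)
    have rvA: "(case p of (i, j) \<Rightarrow> \<xi> i j) \<in> borel_measurable M" if "p \<in> A l" for p
      using that rv by (auto simp: A_def)
    have ind: "indep_vars (\<lambda>_. borel) (\<lambda>p \<omega>. c l (fst p) * (case p of (i, j) \<Rightarrow> \<xi> i j) \<omega>) (A l)"
    proof (rule indep_vars_compose2[where Y="\<lambda>p x. c l (fst p) * x"])
      show "indep_vars (\<lambda>_. borel) (\<lambda>(i, j). \<xi> i j) (A l)"
        by (rule indep_vars_subset[OF indep]) (auto simp: A_def)
    qed simp
    have meas: "(\<lambda>\<omega>. \<Sum>p\<in>A l. c l (fst p) * (case p of (i, j) \<Rightarrow> \<xi> i j) \<omega>) \<in> borel_measurable M"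
      by (intro borel_measurable_sum borel_measurable_times borel_measurable_const rvA)
    have "(\<integral>\<omega>. cis (\<Sum>i\<in>UNIV. c l i * (\<Sum>j=1..n l i. \<xi> i j \<omega>)) \<partial>M)
        = char (distr M borel (\<lambda>\<omega>. \<Sum>p\<in>A l. c l (fst p) * (case p of (i, j) \<Rightarrow> \<xi> i j) \<omega>)) 1"
      unfolding sum_eq char_def using meas by (subst integral_distr) (auto simp: cis_conv_exp)
    also have "\<dots> = (\<Prod>p\<in>A l. char (distr M borel (\<lambda>\<omega>. c l (fst p) * (case p of (i, j) \<Rightarrow> \<xi> i j) \<omega>)) 1)"
      by (rule char_distr_sum[OF ind])
    also have "\<dots> = (\<Prod>p\<in>A l. char (distr M borel (\<xi> (fst p) 1)) (c l (fst p)))"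
    proof (rule prod.cong[OF refl])
      fix p assume p: "p \<in> A l"
      obtain i j where ij: "p = (i, j)" "j \<ge> 1" using p by (auto simp: A_def)
      note [measurable] = rv[OF ij(2), of i]
      have "char (distr M borel (\<lambda>\<omega>. c l i * \<xi> i j \<omega>)) 1 = char (distr M borel (\<xi> i j)) (c l i)"
        unfolding char_def by (subst (1 2) integral_distr) auto
      then show "char (distr M borel (\<lambda>\<omega>. c l (fst p) * (case p of (i, j) \<Rightarrow> \<xi> i j) \<omega>)) 1
          = char (distr M borel (\<xi> (fst p) 1)) (c l (fst p))"
        unfolding ident[OF ij(2), symmetric] ij(1) by simp
    qed
    also have "\<dots> = (\<Prod>i\<in>UNIV. \<Prod>j=1..n l i. char (distr M borel (\<xi> i 1)) (c l i))"
      unfolding A_def by (subst prod.Sigma) (auto simp: split_beta)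
    finally show ?thesis by simp
  qed
  have "(\<lambda>l. \<Prod>i\<in>UNIV. char (distr M borel (\<xi> i 1)) (c l i) ^ n l i)
     \<longlonglongrightarrow> (\<Prod>i\<in>UNIV. exp (- complex_of_real (s i * expectation (\<lambda>\<omega>. (\<xi> i 1 \<omega>)\<^sup>2) / 2)))"
    by (intro tendsto_prod char_power_limit c s)
       (use X1 sq mean in \<open>auto simp: integrable_distr_eq integral_distr intro!: real_distribution_distr\<close>)
  also have "(\<Prod>i\<in>UNIV. exp (- complex_of_real (s i * expectation (\<lambda>\<omega>. (\<xi> i 1 \<omega>)\<^sup>2) / 2)))
     = complex_of_real (exp (- (\<Sum>i\<in>UNIV. s i * expectation (\<lambda>\<omega>. (\<xi> i 1 \<omega>)\<^sup>2)) / 2))"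
  proof -
    have "(\<Prod>i\<in>UNIV. exp (- complex_of_real (s i * expectation (\<lambda>\<omega>. (\<xi> i 1 \<omega>)\<^sup>2) / 2)))
       = exp (\<Sum>i\<in>UNIV. complex_of_real (- (s i * expectation (\<lambda>\<omega>. (\<xi> i 1 \<omega>)\<^sup>2) / 2)))"
      by (simp add: exp_sum)
    also have "\<dots> = exp (complex_of_real (\<Sum>i\<in>UNIV. - (s i * expectation (\<lambda>\<omega>. (\<xi> i 1 \<omega>)\<^sup>2) / 2)))"
      by (simp only: of_real_sum)
    finally show ?thesis by (simp only: exp_of_real sum_negf sum_divide_distrib minus_divide_left[symmetric])
  qed
  finally show ?thesis unfolding char_eq .
qed

lemma gaussian_variable_integrable:
  assumes N: "prob_space N" and X: "gaussian_variable N X"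
  shows "integrable N X" "integrable N (\<lambda>\<omega>. (X \<omega>)\<^sup>2)"
proof -
  interpret prob_space N by fact
  have [measurable]: "X \<in> borel_measurable N" using X by (simp add: gaussian_variable_def)
  have "integrable (distr N borel X) (\<lambda>x. x\<^sup>2)"
    using X unfolding gaussian_variable_def
  proof (elim conjE disjE exE)
    fix \<mu> \<sigma> :: real assume s: "\<sigma> > 0" and d: "distr N borel X = density lborel (\<lambda>y. ennreal (normal_density \<mu> \<sigma> y))"
    have "(\<lambda>x. normal_density \<mu> \<sigma> x * x\<^sup>2) =
      (\<lambda>x. normal_density \<mu> \<sigma> x * (x - \<mu>)^2 + (2 * \<mu>) * (normal_density \<mu> \<sigma> x * x) - \<mu>\<^sup>2 * normal_density \<mu> \<sigma> x)"
      by (simp add: fun_eq_iff algebra_simps power2_eq_square)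
    moreover have "integrable lborel \<dots>"
      using integrable_normal_moment[OF s, of \<mu> 2] integrable_normal_moment_nz_1[OF s, of \<mu>]
        integrable_normal_density[OF s, of \<mu>]
      by (intro Bochner_Integration.integrable_diff Bochner_Integration.integrable_add
          Bochner_Integration.integrable_mult_right) auto
    ultimately show ?thesis unfolding d
      by (subst integrable_density) auto
  next
    fix \<mu> :: real assume d: "distr N borel X = return borel \<mu>"
    show ?thesis unfolding d by (simp add: integrable_iff_bounded nn_integral_return)
  qed
  then show "integrable N (\<lambda>\<omega>. (X \<omega>)\<^sup>2)" by (simp add: integrable_distr_eq)
  then show "integrable N X" by (rule square_integrable_imp_integrable[rotated]) simp
qed

text \<open>The point mass at 0 is the case of variance 0 of the same formula, so singular
  covariance matrices are covered from here on.\<close>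

lemma gaussian_variable_cis:
  assumes N: "prob_space N" and X: "gaussian_variable N X" and mean: "(\<integral>\<omega>. X \<omega> \<partial>N) = 0"
  shows "(\<integral>\<omega>. cis (X \<omega>) \<partial>N) = complex_of_real (exp (- (\<integral>\<omega>. (X \<omega>)\<^sup>2 \<partial>N) / 2))"
proof -
  interpret prob_space N by fact
  have [measurable]: "X \<in> borel_measurable N" using X by (simp add: gaussian_variable_def)
  show ?thesis
    using X unfolding gaussian_variable_def
  proof (elim conjE disjE exE)
    fix \<mu> \<sigma> :: real assume s: "\<sigma> > 0" and d: "distr N borel X = density lborel (\<lambda>y. ennreal (normal_density \<mu> \<sigma> y))"
    have lb: "distr N lborel Y = distr N borel Y" for Y :: "_ \<Rightarrow> real"
      by (rule distr_cong) simp_all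
    have D: "distributed N lborel X (normal_density \<mu> \<sigma>)"
      unfolding distributed_def using d lb[of X] by simp
    have "\<mu> = 0" using normal_distributed_expectation[OF s D] mean by simp
    note D = D[unfolded this]
    have var: "(\<integral>\<omega>. (X \<omega>)\<^sup>2 \<partial>N) = \<sigma>\<^sup>2" using normal_distributed_variance[OF s D] mean by simp
    have "distributed N lborel (\<lambda>x. X x / \<sigma>) std_normal_density"
      using D unfolding normal_standard_normal_convert[OF s] by simp
    then have d': "distr N borel (\<lambda>x. X x / \<sigma>) = std_normal_distribution"
      unfolding distributed_def using lb[of "\<lambda>x. X x / \<sigma>"] by simp
    have "(\<integral>\<omega>. cis (X \<omega>) \<partial>N) = char (distr N borel (\<lambda>x. X x / \<sigma>)) \<sigma>"
      unfolding char_def using s by (subst integral_distr) (auto simp: cis_conv_exp)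
    also have "\<dots> = complex_of_real (exp (- \<sigma>\<^sup>2 / 2))"
      unfolding d' by (simp add: char_std_normal_distribution)
    finally show ?thesis by (simp add: var)
  next
    fix \<mu> :: real assume d: "distr N borel X = return borel \<mu>"
    have "\<mu> = (\<integral>x. x \<partial>distr N borel X)" unfolding d by (simp add: integral_return)
    also have "\<dots> = 0" using mean by (simp add: integral_distr)
    finally have d: "distr N borel X = return borel 0" using d by simp
    have "AE x in distr N borel X. x = 0" unfolding d by (simp add: AE_return)
    then have ae: "AE \<omega> in N. X \<omega> = 0" by (simp add: AE_distr_iff)
    have "(\<integral>\<omega>. cis (X \<omega>) \<partial>N) = (\<integral>\<omega>. 1 \<partial>N)"
    proof (rule integral_cong_AE)
      have "cis \<in> borel_measurable borel"
        by (intro borel_measurable_continuous_onI continuous_intros)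
      then show "(\<lambda>\<omega>. cis (X \<omega>)) \<in> borel_measurable N" by measurable
    qed (use ae in auto)
    moreover have "(\<integral>\<omega>. (X \<omega>)\<^sup>2 \<partial>N) = (\<integral>\<omega>. 0 \<partial>N)"
      by (rule integral_cong_AE) (use ae in auto)
    ultimately show ?thesis by (simp add: prob_space)
  qed
qed

section \<open>The pseudoinverse of a Gram matrix\<close>

text \<open>The four Penrose equations as a relation, so that existence and uniqueness can be proved
  before the definite description in \<open>pinv\<close> is evaluated.\<close>

definition pinv_rel :: "real^'n^'m \<Rightarrow> real^'m^'n \<Rightarrow> bool" where
  "pinv_rel A X \<longleftrightarrow> A ** X ** A = A \<and> X ** A ** X = X \<and>
     transpose (A ** X) = A ** X \<and> transpose (X ** A) = X ** A"

text \<open>\<open>A ** X\<close> and \<open>A ** Y\<close> are both the orthogonal projection onto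
  the range of \<open>A\<close>, and \<open>X ** A\<close> and \<open>Y ** A\<close> both the one
  onto the complement of its kernel. Hence X = XAX = XAY = YAY.\<close>

lemma pinv_rel_unique:
  assumes X: "pinv_rel A X" and Y: "pinv_rel A Y"
  shows "X = Y"
proof -
  have "X = X ** (A ** X)" using X by (simp add: pinv_rel_def matrix_mul_assoc)
  also have "A ** X = A ** Y"
  proof -
    have "A ** X = (A ** Y) ** (A ** X)"
      using Y by (simp add: pinv_rel_def matrix_mul_assoc)
    also have "\<dots> = transpose ((A ** X) ** (A ** Y))"
      using X Y by (metis pinv_rel_def matrix_transpose_mul)
    also have "\<dots> = transpose (A ** Y)"
      using X by (simp add: pinv_rel_def matrix_mul_assoc)
    finally show ?thesis using Y by (simp add: pinv_rel_def)
  qed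
  also have "X ** (A ** Y) = (X ** A) ** Y" by (simp add: matrix_mul_assoc)
  also have "X ** A = Y ** A"
  proof -
    have "X ** A = (X ** A) ** (Y ** A)"
      using Y by (metis pinv_rel_def matrix_mul_assoc)
    also have "\<dots> = transpose ((Y ** A) ** (X ** A))"
      using X Y by (metis pinv_rel_def matrix_transpose_mul)
    also have "\<dots> = transpose (Y ** A)"
      using X by (metis pinv_rel_def matrix_mul_assoc)
    finally show ?thesis using Y by (simp add: pinv_rel_def)
  qed
  also have "(Y ** A) ** Y = Y" using Y by (simp add: pinv_rel_def)
  finally show ?thesis .
qed

lemma pinv_eqI: "pinv_rel A X \<Longrightarrow> pinv A = X"
  unfolding pinv_def pinv_rel_def[symmetric] by (blast intro: the_equality pinv_rel_unique)

text \<open>The range of a symmetric matrix is orthogonal to its kernel, so \<open>S\<close> maps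
  its range onto itself. In the proof the component \<open>z\<close> of \<open>S *v x\<close>
  orthogonal to the range of the square is killed by \<open>S\<close>, hence orthogonal to
  \<open>S *v x\<close> and to itself. The solutions \<open>y\<close> become the columns from which
  the pseudoinverse is assembled.\<close>

lemma symmetric_range_square:
  fixes S :: "real^'n^'n"
  assumes S: "transpose S = S"
  shows "\<exists>y. S *v x = S *v (S *v y)"
proof -
  define R where "R = range (\<lambda>y. S *v (S *v y))"
  have R: "subspace R" unfolding R_def
    by (intro linear_subspace_image subspace_UNIV linear_compose[unfolded o_def, OF matrix_vector_mul_linear matrix_vector_mul_linear])
  obtain y z where y: "y \<in> span R" and z: "\<And>w. w \<in> span R \<Longrightarrow> orthogonal z w" and yz: "S *v x = y + z"
    using orthogonal_subspace_decomp_exists[of R "S *v x"] by blast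
  have y: "y \<in> R" using y R by (simp add: span_eq_iff[THEN iffD2])
  have sym: "(S *v a) \<bullet> b = a \<bullet> (S *v b)" for a b
    using S dot_lmul_matrix[of a S b] by (metis dot_lmul_matrix inner_commute transpose_matrix_vector)
  have "z \<bullet> (S *v (S *v z)) = 0"
    using z[of "S *v (S *v z)"] by (auto simp: R_def orthogonal_def intro: span_base)
  then have "(S *v z) \<bullet> (S *v z) = 0" by (simp add: sym)
  then have Sz: "S *v z = 0" by simp
  have "z \<bullet> z = z \<bullet> (S *v x) - z \<bullet> y" by (simp add: yz inner_add_right)
  also have "z \<bullet> (S *v x) = 0" by (metis Sz sym inner_zero_left)
  also have "z \<bullet> y = 0" using z[of y] y by (auto simp: orthogonal_def intro: span_base)
  finally have "z = 0" by simp
  then show ?thesis using y yz by (auto simp: R_def)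
qed

text \<open>If \<open>S\<^sup>2 B = S\<close>, then \<open>S B\<close> is the orthogonal projection onto the range of \<open>S\<close>, and \<open>B\<^sup>T S B\<close> is the
  pseudoinverse of \<open>S\<close>.\<close>

lemma symmetric_pinv:
  fixes S :: "real^'n^'n"
  assumes S: "transpose S = S"
  shows "pinv_rel S (pinv S)" "transpose (pinv S) = pinv S" "S ** pinv S = pinv S ** S"
proof -
  have "\<forall>i. \<exists>y. S *v axis i 1 = S *v (S *v y)" using symmetric_range_square[OF S] by blast
  then obtain y where y: "\<And>i. S *v axis i 1 = S *v (S *v y i)" by metis
  define B where "B = (\<chi> p q. y q $ p)"
  have col: "B *v axis i 1 = y i" for i
    by (simp add: matrix_vector_mult_basis B_def column_def vec_eq_iff)
  have entry: "A $ p $ q = (A *v axis q 1) $ p" for A :: "real^'n^'n" and p q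
    by (simp add: matrix_vector_mult_basis column_def)
  have SSB: "S ** S ** B = S"
    unfolding vec_eq_iff entry by (simp add: matrix_vector_mul_assoc[symmetric] col y)
  have BSS: "transpose B ** S ** S = S"
    using arg_cong[OF SSB, of transpose] S by (simp add: matrix_transpose_mul matrix_mul_assoc)
  have SB: "S ** B = transpose B ** S"
  proof -
    have "transpose B ** S = transpose B ** (S ** S ** B)" by (simp add: SSB)
    also have "\<dots> = S ** B" by (simp add: matrix_mul_assoc BSS)
    finally show ?thesis ..
  qed
  have SBS: "S ** B ** S = S" by (simp add: SB BSS)
  define X where "X = transpose B ** S ** B"
  have SX: "S ** X = S ** B"
    unfolding X_def SB[symmetric] by (simp only: matrix_mul_assoc SSB)
  have XS: "X ** S = S ** B"
  proof -
    have "X ** S = transpose B ** (S ** B ** S)" by (simp only: X_def matrix_mul_assoc)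
    also have "\<dots> = transpose B ** S" by (simp only: SBS)
    finally show ?thesis by (simp only: SB)
  qed
  have Xt: "transpose X = X" by (simp add: X_def matrix_transpose_mul S matrix_mul_assoc)
  have SBt: "transpose (S ** B) = S ** B" by (simp only: matrix_transpose_mul S SB transpose_transpose)
  have rel: "pinv_rel S X"
    unfolding pinv_rel_def
  proof (intro conjI)
    show "S ** X ** S = S" by (simp add: SX SBS)
    have "X ** S ** X = (transpose B ** S) ** X" by (simp only: XS SB)
    also have "\<dots> = transpose B ** (S ** X)" by (simp only: matrix_mul_assoc)
    also have "\<dots> = transpose B ** (S ** B)" by (simp only: SX)
    also have "\<dots> = X" by (simp only: X_def matrix_mul_assoc)
    finally show "X ** S ** X = X" .
    show "transpose (S ** X) = S ** X" by (simp only: SX SBt)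
    show "transpose (X ** S) = X ** S" by (simp only: XS SBt)
  qed
  have eq: "pinv S = X" by (rule pinv_eqI[OF rel])
  show "pinv_rel S (pinv S)" "transpose (pinv S) = pinv S" "S ** pinv S = pinv S ** S"
    by (simp_all add: eq rel Xt SX XS)
qed

lemma transpose_diag_matrix: "transpose (diag_matrix d) = diag_matrix d"
  by (simp add: diag_matrix_def transpose_def vec_eq_iff)

lemma diag_matrix_mult_vec: "(diag_matrix d *v w) $ i = d i * w $ i"
proof -
  have "(diag_matrix d *v w) $ i = (\<Sum>j\<in>UNIV. if i = j then d j * w $ j else 0)"
    unfolding diag_matrix_def matrix_vector_mult_def vec_lambda_beta by (intro sum.cong) auto
  then show ?thesis by simp
qed

lemma inner_transpose_mult: "(A *v x) \<bullet> y = x \<bullet> (transpose A *v y)" for A :: "real^'n^'m"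
  by (metis dot_lmul_matrix transpose_matrix_vector transpose_transpose inner_commute)

declare transpose_matrix_vector [simp del]

section \<open>Gram matrices weighted by a positive diagonal\<close>

context
  fixes H :: "real^'k::finite^'r::finite"
begin

text \<open>The Gram matrix of the rows of \<open>H\<close> in the inner product weighted by
  \<open>d\<close>; equally, the covariance matrix of \<open>H u\<close> if the entries of
  \<open>u\<close> are uncorrelated with variances \<open>d\<close>.\<close>

abbreviation (input) gram :: "('k \<Rightarrow> real) \<Rightarrow> real^'r^'r" where
  "gram d \<equiv> H ** diag_matrix d ** transpose H"

lemma transpose_gram: "transpose (gram d) = gram d"
  by (simp add: matrix_transpose_mul transpose_diag_matrix matrix_mul_assoc)

lemma gram_quadratic: "p \<bullet> (gram d *v p) = (\<Sum>i\<in>UNIV. d i * ((transpose H *v p) $ i)\<^sup>2)"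
proof -
  have "p \<bullet> (gram d *v p) = (transpose H *v p) \<bullet> (diag_matrix d *v (transpose H *v p))"
    by (simp add: inner_transpose_mult matrix_vector_mul_assoc[symmetric])
  then show ?thesis
    by (simp add: inner_vec_def diag_matrix_mult_vec power2_eq_square mult_ac)
qed

lemma pinv_gram_nonneg:
  assumes "\<And>i. d i > 0"
  shows "0 \<le> y \<bullet> (pinv (gram d) *v y)"
proof -
  note A = symmetric_pinv[OF transpose_gram[of d]]
  have "pinv (gram d) = transpose (pinv (gram d)) ** gram d ** pinv (gram d)"
    using A by (simp add: pinv_rel_def)
  then have "y \<bullet> (pinv (gram d) *v y) = (pinv (gram d) *v y) \<bullet> (gram d *v (pinv (gram d) *v y))"
    by (metis inner_transpose_mult matrix_vector_mul_assoc)
  also have "\<dots> \<ge> 0" unfolding gram_quadratic by (intro sum_nonneg mult_nonneg_nonneg less_imp_le[OF assms]) auto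
  finally show ?thesis .
qed

text \<open>A vector orthogonal to the range of the Gram matrix has vanishing quadratic form, so
  positivity of the weights forces \<open>transpose H\<close> to annihilate it, which makes it
  orthogonal to \<open>H *v u\<close>. Thus \<open>H\<close> and all these Gram matrices have the
  same range, whatever the rank of \<open>H\<close>.\<close>

lemma gram_range:
  assumes d: "\<And>i. d i > 0"
  shows "\<exists>p. H *v u = gram d *v p"
proof -
  define R where "R = range ((*v) (gram d))"
  have R: "subspace R" unfolding R_def
    by (intro linear_subspace_image subspace_UNIV matrix_vector_mul_linear)
  obtain y z where y: "y \<in> span R" and z: "\<And>w. w \<in> span R \<Longrightarrow> orthogonal z w" and yz: "H *v u = y + z"
    using orthogonal_subspace_decomp_exists[of R "H *v u"] by blast
  have "z \<bullet> (gram d *v z) = 0"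
    using z[of "gram d *v z"] by (auto simp: R_def orthogonal_def intro: span_base)
  then have "\<forall>i\<in>UNIV. d i * ((transpose H *v z) $ i)\<^sup>2 = 0"
    unfolding gram_quadratic
    by (subst (asm) sum_nonneg_eq_0_iff) (auto intro!: mult_nonneg_nonneg less_imp_le[OF d])
  then have Hz: "transpose H *v z = 0"
    using less_imp_neq[OF d] by (auto simp: vec_eq_iff)
  have "z \<bullet> z = z \<bullet> (H *v u) - z \<bullet> y" by (simp add: yz inner_add_right)
  also have "z \<bullet> (H *v u) = 0"
    by (metis Hz inner_commute inner_transpose_mult inner_zero_right)
  also have "z \<bullet> y = 0" using z[OF y] by (simp add: orthogonal_def)
  finally have "z = 0" by simp
  moreover have "y \<in> R" using y R by (simp add: span_eq_iff[THEN iffD2])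
  ultimately show ?thesis using yz by (auto simp: R_def)
qed

text \<open>A minimum of functions that are antimonotone and homogeneous in \<open>d\<close>: continuity in \<open>d\<close>
  follows without any discussion of the rank.\<close>

lemma pinv_gram_minimum:
  assumes d: "\<And>i. d i > 0"
  shows "\<exists>w. H *v w = H *v u \<and> (H *v u) \<bullet> (pinv (gram d) *v (H *v u)) = (\<Sum>i\<in>UNIV. (w $ i)\<^sup>2 / d i)"
    and "H *v w = H *v u \<Longrightarrow> (H *v u) \<bullet> (pinv (gram d) *v (H *v u)) \<le> (\<Sum>i\<in>UNIV. (w $ i)\<^sup>2 / d i)"
proof -
  obtain p where p: "H *v u = gram d *v p" using gram_range[of d u, OF d] by blast
  define h where "h = transpose H *v p"
  \<comment> \<open>The minimizer: \<open>p\<close> is the Lagrange multiplier of the constraint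
    \<open>H w = H u\<close>, and \<open>w0\<close> solves the stationarity equation
    \<open>w $ i / d i = h $ i\<close>.\<close>
  define w0 where "w0 = diag_matrix d *v h"
  have w0: "H *v w0 = H *v u" unfolding p w0_def h_def by (simp add: matrix_vector_mul_assoc matrix_mul_assoc)
  have q: "(H *v u) \<bullet> (pinv (gram d) *v (H *v u)) = (\<Sum>i\<in>UNIV. d i * (h $ i)\<^sup>2)"
  proof -
    have "(H *v u) \<bullet> (pinv (gram d) *v (H *v u)) = p \<bullet> ((gram d ** pinv (gram d) ** gram d) *v p)"
      unfolding p inner_transpose_mult transpose_gram by (simp add: matrix_vector_mul_assoc matrix_mul_assoc)
    also have "gram d ** pinv (gram d) ** gram d = gram d"
      using symmetric_pinv(1)[OF transpose_gram[of d]] by (simp add: pinv_rel_def)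
    finally show ?thesis unfolding gram_quadratic h_def .
  qed
  have "(\<Sum>i\<in>UNIV. (w0 $ i)\<^sup>2 / d i) = (\<Sum>i\<in>UNIV. d i * (h $ i)\<^sup>2)"
    using less_imp_neq[OF d] by (intro sum.cong) (auto simp: w0_def diag_matrix_mult_vec power2_eq_square)
  then show "\<exists>w. H *v w = H *v u \<and> (H *v u) \<bullet> (pinv (gram d) *v (H *v u)) = (\<Sum>i\<in>UNIV. (w $ i)\<^sup>2 / d i)"
    using w0 q by auto
  assume w: "H *v w = H *v u"
  have "0 = (H *v (w - w0)) \<bullet> p" using w w0 by (simp add: matrix_vector_mult_diff_distrib)
  also have "\<dots> = (\<Sum>i\<in>UNIV. (w $ i - w0 $ i) * h $ i)"
    unfolding inner_transpose_mult h_def by (simp add: inner_vec_def)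
  finally have orth: "(\<Sum>i\<in>UNIV. (w $ i - w0 $ i) * h $ i) = 0" ..
  \<comment> \<open>Adding twice the vanishing cross term completes the square in every coordinate:
    the gap is \<open>(w - d * h)^2 / d\<close>.\<close>
  have "(\<Sum>i\<in>UNIV. d i * (h $ i)\<^sup>2) = (\<Sum>i\<in>UNIV. d i * (h $ i)\<^sup>2 + 2 * ((w $ i - w0 $ i) * h $ i))"
    by (simp add: sum.distrib sum_distrib_left[symmetric] orth)
  also have "\<dots> \<le> (\<Sum>i\<in>UNIV. (w $ i)\<^sup>2 / d i)"
  proof (rule sum_mono)
    fix i
    have "(w $ i)\<^sup>2 / d i - (d i * (h $ i)\<^sup>2 + 2 * ((w $ i - w0 $ i) * h $ i)) = (w $ i - d i * h $ i)\<^sup>2 / d i"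
      using d[of i] by (simp add: w0_def diag_matrix_mult_vec field_simps power2_eq_square)
    also have "\<dots> \<ge> 0" using d[of i] by simp
    finally show "d i * (h $ i)\<^sup>2 + 2 * ((w $ i - w0 $ i) * h $ i) \<le> (w $ i)\<^sup>2 / d i" by simp
  qed
  finally show "(H *v u) \<bullet> (pinv (gram d) *v (H *v u)) \<le> (\<Sum>i\<in>UNIV. (w $ i)\<^sup>2 / d i)" unfolding q .
qed

text \<open>The constraint does not involve the weights, so the minimizer for \<open>e\<close> is a
  competitor for \<open>d\<close>.\<close>

lemma pinv_gram_antimono:
  assumes d: "\<And>i. d i > 0" and e: "\<And>i. e i > 0" and c: "c > 0" "\<And>i. e i \<le> c * d i"
  shows "(H *v u) \<bullet> (pinv (gram d) *v (H *v u)) \<le> c * ((H *v u) \<bullet> (pinv (gram e) *v (H *v u)))"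
proof -
  obtain w where w: "H *v w = H *v u"
    "(H *v u) \<bullet> (pinv (gram e) *v (H *v u)) = (\<Sum>i\<in>UNIV. (w $ i)\<^sup>2 / e i)"
    using pinv_gram_minimum(1)[of e u, OF e] by blast
  have "(\<Sum>i\<in>UNIV. (w $ i)\<^sup>2 / d i) \<le> (\<Sum>i\<in>UNIV. c * ((w $ i)\<^sup>2 / e i))"
  proof (rule sum_mono)
    fix i
    have "(w $ i)\<^sup>2 * e i \<le> (w $ i)\<^sup>2 * (c * d i)" by (intro mult_left_mono c) auto
    then show "(w $ i)\<^sup>2 / d i \<le> c * ((w $ i)\<^sup>2 / e i)"
      using d[of i] e[of i] by (simp add: field_simps)
  qed
  then show ?thesis using pinv_gram_minimum(2)[of d, OF d w(1)] w(2) by (simp add: sum_distrib_left)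
qed

text \<open>Antimonotonicity in both directions, with the constants \<open>1 + \<epsilon>\<close>
  and \<open>1 / (1 - \<epsilon>)\<close>. The bound is uniform in \<open>u\<close>; this is what
  allows it to be integrated over time.\<close>

lemma pinv_gram_relative_error:
  assumes d: "\<And>i. d i > 0" and \<epsilon>: "0 \<le> \<epsilon>" "\<epsilon> \<le> 1/2" and e: "\<And>i. \<bar>e i - d i\<bar> \<le> \<epsilon> * d i"
  shows "\<bar>(H *v u) \<bullet> (pinv (gram e) *v (H *v u)) - (H *v u) \<bullet> (pinv (gram d) *v (H *v u))\<bar>
      \<le> 2 * \<epsilon> * ((H *v u) \<bullet> (pinv (gram d) *v (H *v u)))"
proof -
  define qd where "qd = (H *v u) \<bullet> (pinv (gram d) *v (H *v u))"
  define qe where "qe = (H *v u) \<bullet> (pinv (gram e) *v (H *v u))"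
  have low: "(1 - \<epsilon>) * d i \<le> e i" and up: "e i \<le> (1 + \<epsilon>) * d i" for i
    using e[of i] by (auto simp: algebra_simps abs_le_iff)
  have epos: "e i > 0" for i
    using low[of i] mult_pos_pos[of "1 - \<epsilon>" "d i"] d[of i] \<epsilon> by linarith
  have qd0: "0 \<le> qd" unfolding qd_def by (rule pinv_gram_nonneg) (rule d)
  have "qd \<le> (1 + \<epsilon>) * qe"
    unfolding qd_def qe_def by (rule pinv_gram_antimono) (use d epos \<epsilon> up in auto)
  moreover have "qe \<le> (1 / (1 - \<epsilon>)) * qd"
    unfolding qd_def qe_def
    by (rule pinv_gram_antimono) (use d epos \<epsilon> low in \<open>auto simp: field_simps\<close>)
  \<comment> \<open>This inequality is what the bound 1/2 on the relative error is for.\<close>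
  moreover have "1 / (1 - \<epsilon>) \<le> 1 + 2 * \<epsilon>"
  proof -
    have "0 \<le> \<epsilon> * (1 - 2 * \<epsilon>)" using \<epsilon> by simp
    then show ?thesis using \<epsilon> by (simp add: field_simps)
  qed
  ultimately have up': "qe \<le> (1 + 2 * \<epsilon>) * qd"
    using qd0 by (meson mult_right_mono order_trans)
  have "(1 - 2 * \<epsilon>) * qd \<le> (1 - 2 * \<epsilon>) * ((1 + \<epsilon>) * qe)"
    using \<open>qd \<le> (1 + \<epsilon>) * qe\<close> \<epsilon> by (intro mult_left_mono) auto
  also have "\<dots> = ((1 - 2 * \<epsilon>) * (1 + \<epsilon>)) * qe" by simp
  also have "\<dots> \<le> 1 * qe"
  proof (rule mult_right_mono)
    show "(1 - 2 * \<epsilon>) * (1 + \<epsilon>) \<le> 1" using \<epsilon> by (simp add: algebra_simps)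
    show "0 \<le> qe" unfolding qe_def by (rule pinv_gram_nonneg) (rule epos)
  qed
  finally show ?thesis using up' unfolding qd_def[symmetric] qe_def[symmetric]
    by (simp add: abs_le_iff algebra_simps)
qed

end

section \<open>Uniform consistency of the sample variance\<close>

text \<open>An infimum below \<open>e\<close> is undercut by a single measurable majorant. The pairs
  with \<open>t = s\<close> make the supremum nonnegative, so the expectation of the majorant is an
  ordinary nonnegative integral and outer expectations can be left behind.\<close>

lemma equicontinuous_majorant:
  fixes w :: "'w \<Rightarrow> real \<Rightarrow> real"
  assumes T: "T \<noteq> {}"
    and lim: "((\<lambda>\<delta>. outer_expectation M (\<lambda>\<omega>.
               SUP (t, s) \<in> {(t, s). t \<in> T \<and> s \<in> T \<and> \<bar>t - s\<bar> < \<delta>}. ereal \<bar>w \<omega> t - w \<omega> s\<bar>))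
            \<longlongrightarrow> 0) (at_right 0)"
    and e: "e > 0" and d: "d > 0"
  obtains \<delta> U where "0 < \<delta>" "\<delta> < d" "U \<in> borel_measurable M" "(\<integral>\<^sup>+\<omega>. U \<omega> \<partial>M) < ennreal e"
    "\<And>\<omega> s t. \<omega> \<in> space M \<Longrightarrow> s \<in> T \<Longrightarrow> t \<in> T \<Longrightarrow> \<bar>t - s\<bar> < \<delta> \<Longrightarrow> ennreal \<bar>w \<omega> t - w \<omega> s\<bar> \<le> U \<omega>"
proof -
  define osc where "osc \<delta> \<omega> = (SUP (t, s) \<in> {(t, s). t \<in> T \<and> s \<in> T \<and> \<bar>t - s\<bar> < \<delta>}. ereal \<bar>w \<omega> t - w \<omega> s\<bar>)" for \<delta> \<omega>
  have "\<forall>\<^sub>F \<delta> in at_right 0. outer_expectation M (osc \<delta>) < ereal e"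
    using order_tendstoD(2)[OF lim, of "ereal e"] e unfolding osc_def by simp
  moreover have "\<forall>\<^sub>F \<delta> in at_right 0. \<delta> < d" by (rule eventually_at_right_real[OF d, THEN eventually_mono]) auto
  moreover have "\<forall>\<^sub>F \<delta> in at_right (0::real). \<delta> > 0" by (simp add: eventually_at_right_less)
  ultimately have "\<forall>\<^sub>F \<delta> in at_right 0. outer_expectation M (osc \<delta>) < ereal e \<and> \<delta> < d \<and> \<delta> > 0"
    by eventually_elim auto
  then obtain \<delta> where \<delta>: "outer_expectation M (osc \<delta>) < ereal e" "\<delta> < d" "\<delta> > 0"
    using eventually_happens[of _ "at_right (0::real)"] trivial_limit_at_right_real by blast
  then obtain U where U: "U \<in> borel_measurable M" "\<And>\<omega>. \<omega> \<in> space M \<Longrightarrow> osc \<delta> \<omega> \<le> U \<omega>"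
      "ereal_expectation M U < ereal e"
    unfolding outer_expectation_def Inf_less_iff by auto
  have le: "ereal \<bar>w \<omega> t - w \<omega> s\<bar> \<le> U \<omega>" if "\<omega> \<in> space M" "s \<in> T" "t \<in> T" "\<bar>t - s\<bar> < \<delta>" for \<omega> s t
  proof -
    have "ereal \<bar>w \<omega> t - w \<omega> s\<bar> \<le> osc \<delta> \<omega>"
      unfolding osc_def by (rule SUP_upper2[of "(t, s)"]) (use that in auto)
    then show ?thesis using U(2)[OF that(1)] by (rule order_trans)
  qed
  \<comment> \<open>Over an empty set of times the supremum would be minus infinity and the majorant
    could be negative.\<close>
  obtain t0 where t0: "t0 \<in> T" using T by auto
  have U0: "0 \<le> U \<omega>" if "\<omega> \<in> space M" for \<omega>
    using le[OF that t0 t0] \<delta> by (simp add: zero_ereal_def)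
  have "(\<integral>\<^sup>+\<omega>. e2ennreal (- U \<omega>) \<partial>M) = (\<integral>\<^sup>+\<omega>. 0 \<partial>M)"
    by (rule nn_integral_cong) (use U0 in \<open>simp add: e2ennreal_neg\<close>)
  then have E: "ereal_expectation M U = enn2ereal (\<integral>\<^sup>+\<omega>. e2ennreal (U \<omega>) \<partial>M)"
    by (simp add: ereal_expectation_def zero_ennreal.rep_eq)
  show thesis
  proof (rule that[of \<delta> "\<lambda>\<omega>. e2ennreal (U \<omega>)"])
    have "enn2ereal (\<integral>\<^sup>+\<omega>. e2ennreal (U \<omega>) \<partial>M) < enn2ereal (ennreal e)" using U(3) E e by (simp add: enn2ereal_ennreal)
    then show "(\<integral>\<^sup>+\<omega>. e2ennreal (U \<omega>) \<partial>M) < ennreal e" by (simp add: less_ennreal.rep_eq)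
    show "ennreal \<bar>w \<omega> t - w \<omega> s\<bar> \<le> e2ennreal (U \<omega>)"
      if "\<omega> \<in> space M" "s \<in> T" "t \<in> T" "\<bar>t - s\<bar> < \<delta>" for \<omega> s t
      using e2ennreal_mono[OF le[OF that]] by simp
    show "(\<lambda>\<omega>. e2ennreal (U \<omega>)) \<in> borel_measurable M" using U(1) by measurable
  qed (use \<delta> in auto)
qed

text \<open>Majorants with integrals below \<open>1 / Suc n\<close> have an infimum of integral 0,
  hence almost surely 0; at such a point some \<open>U n\<close> falls below any given bound. The
  uniform continuity so obtained will carry inequalities from a dense set of times to every
  time.\<close>

lemma equicontinuous_AE:
  fixes w :: "'w \<Rightarrow> real \<Rightarrow> real"
  assumes T: "T \<noteq> {}"
    and lim: "((\<lambda>\<delta>. outer_expectation M (\<lambda>\<omega>.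
               SUP (t, s) \<in> {(t, s). t \<in> T \<and> s \<in> T \<and> \<bar>t - s\<bar> < \<delta>}. ereal \<bar>w \<omega> t - w \<omega> s\<bar>))
            \<longlongrightarrow> 0) (at_right 0)"
  shows "AE \<omega> in M. \<forall>\<epsilon>>0. \<exists>\<delta>>0. \<forall>s\<in>T. \<forall>t\<in>T. \<bar>t - s\<bar> < \<delta> \<longrightarrow> \<bar>w \<omega> t - w \<omega> s\<bar> < \<epsilon>"
proof -
  have "\<exists>\<delta> U. 0 < \<delta> \<and> U \<in> borel_measurable M \<and> (\<integral>\<^sup>+\<omega>. U \<omega> \<partial>M) < ennreal (1 / real (Suc n)) \<and>
     (\<forall>\<omega>\<in>space M. \<forall>s\<in>T. \<forall>t\<in>T. \<bar>t - s\<bar> < \<delta> \<longrightarrow> ennreal \<bar>w \<omega> t - w \<omega> s\<bar> \<le> U \<omega>)" for n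
  proof -
    obtain \<delta> U where "0 < \<delta>" "U \<in> borel_measurable M" "(\<integral>\<^sup>+\<omega>. U \<omega> \<partial>M) < ennreal (1 / real (Suc n))"
      "\<And>\<omega> s t. \<omega> \<in> space M \<Longrightarrow> s \<in> T \<Longrightarrow> t \<in> T \<Longrightarrow> \<bar>t - s\<bar> < \<delta> \<Longrightarrow> ennreal \<bar>w \<omega> t - w \<omega> s\<bar> \<le> U \<omega>"
      using equicontinuous_majorant[OF T lim, of "1 / real (Suc n)" 1] by (metis of_nat_0_less_iff zero_less_Suc zero_less_divide_1_iff zero_less_one)
    then show ?thesis by blast
  qed
  then obtain \<delta> U where \<delta>: "\<And>n. 0 < \<delta> n" and U[measurable]: "\<And>n. U n \<in> borel_measurable M"
    and Ui: "\<And>n. (\<integral>\<^sup>+\<omega>. U n \<omega> \<partial>M) < ennreal (1 / real (Suc n))"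
    and Ub: "\<And>n \<omega> s t. \<omega> \<in> space M \<Longrightarrow> s \<in> T \<Longrightarrow> t \<in> T \<Longrightarrow> \<bar>t - s\<bar> < \<delta> n \<Longrightarrow> ennreal \<bar>w \<omega> t - w \<omega> s\<bar> \<le> U n \<omega>"
    by metis
  have "(\<integral>\<^sup>+\<omega>. (INF n. U n \<omega>) \<partial>M) \<le> ennreal (1 / real (Suc n))" for n
  proof -
    have "(\<integral>\<^sup>+\<omega>. (INF n. U n \<omega>) \<partial>M) \<le> (\<integral>\<^sup>+\<omega>. U n \<omega> \<partial>M)" by (intro nn_integral_mono INF_lower) simp
    then show ?thesis using Ui[of n] by (meson less_imp_le order_trans)
  qed
  moreover have "(\<lambda>n. ennreal (1 / real (Suc n))) \<longlonglongrightarrow> ennreal 0"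
    using LIMSEQ_inverse_real_of_nat by (intro tendsto_ennrealI) (simp add: inverse_eq_divide)
  ultimately have "(\<integral>\<^sup>+\<omega>. (INF n. U n \<omega>) \<partial>M) \<le> ennreal 0"
    by (intro LIMSEQ_le_const) auto
  then have "(\<integral>\<^sup>+\<omega>. (INF n. U n \<omega>) \<partial>M) = 0" by simp
  then have "AE \<omega> in M. (INF n. U n \<omega>) = 0" by (subst (asm) nn_integral_0_iff_AE) simp_all
  then show ?thesis
    using AE_space
  proof eventually_elim
    case (elim \<omega>)
    show ?case
    proof (intro allI impI)
      fix \<epsilon> :: real assume "\<epsilon> > 0"
      then have "(INF n. U n \<omega>) < ennreal \<epsilon>" using elim by simp
      then obtain n where "U n \<omega> < ennreal \<epsilon>" by (auto simp: INF_less_iff)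
      then have "\<bar>w \<omega> t - w \<omega> s\<bar> < \<epsilon>" if "s \<in> T" "t \<in> T" "\<bar>t - s\<bar> < \<delta> n" for s t
        using Ub[OF elim(2) that] by (metis abs_ge_zero ennreal_less_iff le_less_trans)
      then show "\<exists>\<delta>>0. \<forall>s\<in>T. \<forall>t\<in>T. \<bar>t - s\<bar> < \<delta> \<longrightarrow> \<bar>w \<omega> t - w \<omega> s\<bar> < \<epsilon>"
        using \<delta>[of n] by blast
    qed
  qed
qed

section \<open>Second moments of sums and a weak law in mean\<close>

lemma integrable_mult_of_squares:
  fixes f g :: "'w \<Rightarrow> real"
  assumes "f \<in> borel_measurable M" "g \<in> borel_measurable M"
    and "integrable M (\<lambda>\<omega>. (f \<omega>)\<^sup>2)" "integrable M (\<lambda>\<omega>. (g \<omega>)\<^sup>2)"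
  shows "integrable M (\<lambda>\<omega>. f \<omega> * g \<omega>)"
proof (rule Bochner_Integration.integrable_bound)
  show "integrable M (\<lambda>\<omega>. (f \<omega>)\<^sup>2 + (g \<omega>)\<^sup>2)" using assms by auto
  show "AE \<omega> in M. norm (f \<omega> * g \<omega>) \<le> norm ((f \<omega>)\<^sup>2 + (g \<omega>)\<^sup>2)"
  proof (rule AE_I2)
    fix \<omega>
    have "2 * \<bar>f \<omega> * g \<omega>\<bar> \<le> (f \<omega>)\<^sup>2 + (g \<omega>)\<^sup>2"
      using sum_squares_bound[of "\<bar>f \<omega>\<bar>" "\<bar>g \<omega>\<bar>"] by (simp add: abs_mult)
    moreover have "0 \<le> (f \<omega>)\<^sup>2 + (g \<omega>)\<^sup>2" by simp
    ultimately show "norm (f \<omega> * g \<omega>) \<le> norm ((f \<omega>)\<^sup>2 + (g \<omega>)\<^sup>2)" by simp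
  qed
qed (use assms in auto)

lemma (in prob_space) uncorrelated_sum_sq:
  fixes Z :: "nat \<Rightarrow> 'a \<Rightarrow> real"
  assumes fin: "finite A"
    and sq: "\<And>j. j \<in> A \<Longrightarrow> integrable M (\<lambda>\<omega>. (Z j \<omega>)\<^sup>2)"
    and rv: "\<And>j. j \<in> A \<Longrightarrow> Z j \<in> borel_measurable M"
    and unc: "\<And>j k. j \<in> A \<Longrightarrow> k \<in> A \<Longrightarrow> j \<noteq> k \<Longrightarrow> expectation (\<lambda>\<omega>. Z j \<omega> * Z k \<omega>) = 0"
  shows "integrable M (\<lambda>\<omega>. (\<Sum>j\<in>A. Z j \<omega>)\<^sup>2)"
    and "expectation (\<lambda>\<omega>. (\<Sum>j\<in>A. Z j \<omega>)\<^sup>2) = (\<Sum>j\<in>A. expectation (\<lambda>\<omega>. (Z j \<omega>)\<^sup>2))"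
proof -
  have int: "integrable M (\<lambda>\<omega>. Z j \<omega> * Z k \<omega>)" if "j \<in> A" "k \<in> A" for j k
    by (rule integrable_mult_of_squares) (use rv sq that in auto)
  have eq: "(\<Sum>j\<in>A. Z j \<omega>)\<^sup>2 = (\<Sum>j\<in>A. \<Sum>k\<in>A. Z j \<omega> * Z k \<omega>)" for \<omega>
    by (simp add: power2_eq_square sum_product)
  show "integrable M (\<lambda>\<omega>. (\<Sum>j\<in>A. Z j \<omega>)\<^sup>2)"
    unfolding eq by (intro Bochner_Integration.integrable_sum int)
  have "expectation (\<lambda>\<omega>. (\<Sum>j\<in>A. Z j \<omega>)\<^sup>2) = (\<Sum>j\<in>A. \<Sum>k\<in>A. expectation (\<lambda>\<omega>. Z j \<omega> * Z k \<omega>))"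
    unfolding eq by (subst Bochner_Integration.integral_sum, intro Bochner_Integration.integrable_sum int, assumption+)
       (intro sum.cong refl Bochner_Integration.integral_sum int)
  also have "\<dots> = (\<Sum>j\<in>A. \<Sum>k\<in>A. if k = j then expectation (\<lambda>\<omega>. (Z j \<omega>)\<^sup>2) else 0)"
    using unc by (intro sum.cong refl) (auto simp: power2_eq_square)
  also have "\<dots> = (\<Sum>j\<in>A. expectation (\<lambda>\<omega>. (Z j \<omega>)\<^sup>2))" using fin by (intro sum.cong refl) simp
  finally show "expectation (\<lambda>\<omega>. (\<Sum>j\<in>A. Z j \<omega>)\<^sup>2) = (\<Sum>j\<in>A. expectation (\<lambda>\<omega>. (Z j \<omega>)\<^sup>2))" .
qed

text \<open>Truncation at \<open>K\<close>: the centred truncated parts \<open>Z j\<close> are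
  bounded, so their sum \<open>S\<close> has second moment of order \<open>n\<close>, while
  nonnegativity makes the discarded part \<open>R\<close> nonnegative with mean
  \<open>n * (\<mu> - m K)\<close>. Convergence in mean, rather than in probability, is what
  Markov's inequality consumes later.\<close>

lemma (in prob_space) weak_law_L1:
  fixes Y :: "nat \<Rightarrow> 'a \<Rightarrow> real"
  assumes indep: "indep_vars (\<lambda>_. borel) Y {1..}"
    and ident: "\<And>j. j \<ge> 1 \<Longrightarrow> distr M borel (Y j) = distr M borel (Y 1)"
    and int: "integrable M (Y 1)" and nonneg: "\<And>j \<omega>. j \<ge> 1 \<Longrightarrow> \<omega> \<in> space M \<Longrightarrow> 0 \<le> Y j \<omega>"
  shows "(\<lambda>n. expectation (\<lambda>\<omega>. \<bar>(\<Sum>j=1..n. Y j \<omega>) / real n - expectation (Y 1)\<bar>)) \<longlonglongrightarrow> 0"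
proof -
  have rv[measurable]: "Y j \<in> borel_measurable M" if "j \<ge> 1" for j
    using indep that unfolding indep_vars_def2 by auto
  have rv1[measurable]: "Y 1 \<in> borel_measurable M" by (rule rv) simp
  have E_eq: "expectation (\<lambda>\<omega>. f (Y j \<omega>)) = expectation (\<lambda>\<omega>. f (Y 1 \<omega>))"
    and I_eq: "integrable M (\<lambda>\<omega>. f (Y j \<omega>)) \<longleftrightarrow> integrable M (\<lambda>\<omega>. f (Y 1 \<omega>))"
    if j: "j \<ge> 1" and f: "f \<in> borel_measurable borel" for j and f :: "real \<Rightarrow> real"
  proof -
    have "expectation (\<lambda>\<omega>. f (Y j \<omega>)) = (\<integral>y. f y \<partial>distr M borel (Y j))"
      using rv[OF j] f by (simp add: integral_distr)
    also have "\<dots> = expectation (\<lambda>\<omega>. f (Y 1 \<omega>))"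
      unfolding ident[OF j] using rv1 f by (simp add: integral_distr)
    finally show "expectation (\<lambda>\<omega>. f (Y j \<omega>)) = expectation (\<lambda>\<omega>. f (Y 1 \<omega>))" .
    have "integrable M (\<lambda>\<omega>. f (Y j \<omega>)) \<longleftrightarrow> integrable (distr M borel (Y j)) f"
      using rv[OF j] f by (simp add: integrable_distr_eq)
    also have "\<dots> \<longleftrightarrow> integrable M (\<lambda>\<omega>. f (Y 1 \<omega>))"
      unfolding ident[OF j] using rv1 f by (simp add: integrable_distr_eq)
    finally show "integrable M (\<lambda>\<omega>. f (Y j \<omega>)) \<longleftrightarrow> integrable M (\<lambda>\<omega>. f (Y 1 \<omega>))" .
  qed
  define m where "m K = expectation (\<lambda>\<omega>. min (Y 1 \<omega>) K)" for K
  define \<mu> where "\<mu> = expectation (Y 1)"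
  have Yint: "integrable M (Y j)" if "j \<ge> 1" for j
    using I_eq[OF that, of "\<lambda>x. x"] int by simp
  have bound: "expectation (\<lambda>\<omega>. \<bar>(\<Sum>j=1..n. Y j \<omega>) / real n - \<mu>\<bar>) \<le> 2 * (\<mu> - m K) + (K\<^sup>2 / (real n * c) + c) / 2"
    if K: "K > 0" and n: "n \<ge> 1" and c: "c > 0" for n K c
  proof -
    define Z where "Z j \<omega> = min (Y j \<omega>) K - m K" for j \<omega>
    have Zrv: "Z j \<in> borel_measurable M" if "j \<ge> 1" for j
      unfolding Z_def using rv[OF that] by measurable
    have m_le: "0 \<le> m K" "m K \<le> K" unfolding m_def
      using nonneg[of 1] K int by (auto intro!: integral_nonneg_AE integral_le_const)
    have Zb: "\<bar>Z j \<omega>\<bar> \<le> K" if "j \<ge> 1" "\<omega> \<in> space M" for j \<omega>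
      using nonneg[OF that] m_le K unfolding Z_def by (auto simp: min_def)
    have Zi: "integrable M (Z j)" if "j \<ge> 1" for j
      using Zb[OF that] Zrv[OF that] by (intro integrable_const_bound[where B=K]) auto
    have Zsq: "integrable M (\<lambda>\<omega>. (Z j \<omega>)\<^sup>2)" if "j \<ge> 1" for j
    proof (rule integrable_const_bound[where B="K\<^sup>2"])
      show "AE \<omega> in M. norm ((Z j \<omega>)\<^sup>2) \<le> K\<^sup>2"
        using Zb[OF that] K by (intro AE_I2) (auto simp: abs_le_square_iff[symmetric])
    qed (use Zrv[OF that] in measurable)
    have Zm: "expectation (Z j) = 0" if "j \<ge> 1" for j
    proof -
      have "expectation (Z j) = expectation (\<lambda>\<omega>. min (Y j \<omega>) K) - m K"
        unfolding Z_def using Yint[OF that] by (simp add: prob_space)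
      then show ?thesis using E_eq[OF that, of "\<lambda>x. min x K"] by (simp add: m_def)
    qed
    have Zunc: "expectation (\<lambda>\<omega>. Z j \<omega> * Z k \<omega>) = 0" if "j \<ge> 1" "k \<ge> 1" "j \<noteq> k" for j k
    proof -
      have "indep_vars (\<lambda>_. borel) Z {1..}"
        unfolding Z_def by (rule indep_vars_compose2[OF indep]) measurable
      then have "indep_vars (\<lambda>_. borel) Z {j, k}" by (rule indep_vars_subset) (use that in auto)
      then have "expectation (\<lambda>\<omega>. \<Prod>i\<in>{j, k}. Z i \<omega>) = (\<Prod>i\<in>{j, k}. expectation (Z i))"
        by (intro indep_vars_lebesgue_integral) (use that Zi in auto)
      then show ?thesis using that Zm by simp
    qed
    define S where "S \<omega> = (\<Sum>j=1..n. Z j \<omega>)" for \<omega>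
    have Ssq: "integrable M (\<lambda>\<omega>. (S \<omega>)\<^sup>2)" "expectation (\<lambda>\<omega>. (S \<omega>)\<^sup>2) = (\<Sum>j=1..n. expectation (\<lambda>\<omega>. (Z j \<omega>)\<^sup>2))"
      unfolding S_def by (rule uncorrelated_sum_sq; use Zsq Zrv Zunc in auto)+
    have "(\<Sum>j=1..n. expectation (\<lambda>\<omega>. (Z j \<omega>)\<^sup>2)) \<le> (\<Sum>j=1..n. K\<^sup>2)"
    proof (rule sum_mono)
      fix j assume j: "j \<in> {1..n}"
      show "expectation (\<lambda>\<omega>. (Z j \<omega>)\<^sup>2) \<le> K\<^sup>2"
        by (rule integral_le_const) (use Zsq[of j] Zb[of j] K j in \<open>auto intro!: AE_I2 simp: abs_le_square_iff[symmetric]\<close>)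
    qed
    then have Sb: "expectation (\<lambda>\<omega>. (S \<omega>)\<^sup>2) \<le> real n * K\<^sup>2" unfolding Ssq by simp
    define R where "R \<omega> = (\<Sum>j=1..n. Y j \<omega> - min (Y j \<omega>) K)" for \<omega>
    have Ri: "integrable M R" unfolding R_def using Yint by auto
    have RE: "expectation R = real n * (\<mu> - m K)"
    proof -
      have "expectation R = (\<Sum>j=1..n. expectation (\<lambda>\<omega>. Y j \<omega> - min (Y j \<omega>) K))"
        unfolding R_def by (rule Bochner_Integration.integral_sum) (use Yint in auto)
      also have "\<dots> = (\<Sum>j=1..n. \<mu> - m K)"
      proof (rule sum.cong[OF refl])
        fix j assume j: "j \<in> {1..n}"
        have "expectation (\<lambda>\<omega>. Y j \<omega> - min (Y j \<omega>) K) = expectation (\<lambda>\<omega>. Y 1 \<omega> - min (Y 1 \<omega>) K)"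
          by (rule E_eq[of j "\<lambda>y. y - min y K"]) (use j in auto)
        then show "expectation (\<lambda>\<omega>. Y j \<omega> - min (Y j \<omega>) K) = \<mu> - m K" using int by (simp add: \<mu>_def m_def)
      qed
      finally show ?thesis by simp
    qed
    have Si: "integrable M S" unfolding S_def using Zi by auto
    have \<mu>m: "0 \<le> \<mu> - m K" unfolding \<mu>_def m_def using int by (simp add: integral_mono)
    have pt: "\<bar>(\<Sum>j=1..n. Y j \<omega>) / real n - \<mu>\<bar> \<le> R \<omega> / real n + ((S \<omega>)\<^sup>2 / ((real n)\<^sup>2 * c) + c) / 2 + (\<mu> - m K)"
      if w: "\<omega> \<in> space M" for \<omega>
    proof -
      have eq: "(\<Sum>j=1..n. Y j \<omega>) / real n - \<mu> = R \<omega> / real n + S \<omega> / real n - (\<mu> - m K)"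
        using n by (simp add: R_def S_def Z_def sum_subtractf field_simps)
      have "0 \<le> R \<omega>" unfolding R_def by (rule sum_nonneg) simp
      \<comment> \<open>The inequality of arithmetic and geometric means with free weight
        \<open>c\<close> trades the modulus of \<open>S\<close> for its square, the only moment of
        \<open>S\<close> under control.\<close>
      moreover have "\<bar>S \<omega> / real n\<bar> \<le> ((S \<omega> / real n)\<^sup>2 / c + c) / 2"
      proof -
        have amgm: "a \<le> (a\<^sup>2 / c + c) / 2" for a
          using sum_squares_bound[of a c] c by (simp add: field_simps power2_eq_square)
        show ?thesis using amgm[of "\<bar>S \<omega> / real n\<bar>"] unfolding power2_abs .
      qed
      moreover have "(S \<omega> / real n)\<^sup>2 / c = (S \<omega>)\<^sup>2 / ((real n)\<^sup>2 * c)" by (simp add: power_divide)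
      moreover have "0 \<le> R \<omega> / real n" using \<open>0 \<le> R \<omega>\<close> by simp
      ultimately have *: "0 \<le> R \<omega> / real n" "\<bar>S \<omega> / real n\<bar> \<le> ((S \<omega>)\<^sup>2 / ((real n)\<^sup>2 * c) + c) / 2"
        by (simp_all only:)
      have "\<bar>r + s - u\<bar> \<le> r + k + u" if "0 \<le> r" "\<bar>s\<bar> \<le> k" "0 \<le> u" for r s k u :: real
        using that by linarith
      from this[OF * \<mu>m] show ?thesis unfolding eq .
    qed
    have "expectation (\<lambda>\<omega>. \<bar>(\<Sum>j=1..n. Y j \<omega>) / real n - \<mu>\<bar>)
       \<le> expectation (\<lambda>\<omega>. R \<omega> / real n + ((S \<omega>)\<^sup>2 / ((real n)\<^sup>2 * c) + c) / 2 + (\<mu> - m K))"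
    proof (rule integral_mono)
      show "integrable M (\<lambda>\<omega>. \<bar>(\<Sum>j=1..n. Y j \<omega>) / real n - \<mu>\<bar>)"
        by (intro integrable_abs Bochner_Integration.integrable_diff integrable_divide
            Bochner_Integration.integrable_sum integrable_const Yint) auto
      show "integrable M (\<lambda>\<omega>. R \<omega> / real n + ((S \<omega>)\<^sup>2 / ((real n)\<^sup>2 * c) + c) / 2 + (\<mu> - m K))"
        using Ri Ssq(1) by auto
    qed (rule pt)
    also have "\<dots> = expectation R / real n + (expectation (\<lambda>\<omega>. (S \<omega>)\<^sup>2) / ((real n)\<^sup>2 * c) + c) / 2 + (\<mu> - m K)"
      using Ri Ssq(1) by (simp add: prob_space)
    also have "\<dots> \<le> (\<mu> - m K) + (real n * K\<^sup>2 / ((real n)\<^sup>2 * c) + c) / 2 + (\<mu> - m K)"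
      using Sb c n by (intro add_mono divide_right_mono order_refl) (auto simp: RE)
    also have "real n * K\<^sup>2 / ((real n)\<^sup>2 * c) = K\<^sup>2 / (real n * c)" using n c by (simp add: power2_eq_square)
    finally show ?thesis by simp
  qed
  have mlim: "(\<lambda>n. m (real (Suc n))) \<longlonglongrightarrow> \<mu>"
    unfolding m_def \<mu>_def
  proof (rule integral_dominated_convergence[where w="Y 1"])
    show "AE \<omega> in M. (\<lambda>n. min (Y 1 \<omega>) (real (Suc n))) \<longlonglongrightarrow> Y 1 \<omega>"
    proof (rule AE_I2)
      fix \<omega>
      obtain n0 :: nat where n0: "Y 1 \<omega> \<le> real n0" using real_arch_simple by blast
      have "\<forall>\<^sub>F n in sequentially. min (Y 1 \<omega>) (real (Suc n)) = Y 1 \<omega>"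
        using eventually_ge_at_top[of n0] by eventually_elim (use n0 in auto)
      then show "(\<lambda>n. min (Y 1 \<omega>) (real (Suc n))) \<longlonglongrightarrow> Y 1 \<omega>" by (rule tendsto_eventually)
    qed
  qed (use int nonneg[of 1] in \<open>auto intro!: AE_I2\<close>)
  show ?thesis
    unfolding \<mu>_def[symmetric]
  proof (rule LIMSEQ_I)
    fix \<epsilon> :: real assume \<epsilon>: "\<epsilon> > 0"
    from LIMSEQ_D[OF mlim, of "\<epsilon>/8"] \<epsilon> obtain p where p: "\<bar>m (real (Suc p)) - \<mu>\<bar> < \<epsilon> / 8" by auto
    define K where "K = real (Suc p)"
    \<comment> \<open>With \<open>c = \<epsilon> / 2\<close>, this size of \<open>n\<close> pushes
      the second-moment term below a quarter of \<open>\<epsilon>\<close>.\<close>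
    obtain n0 :: nat where n0: "real n0 > 8 * K\<^sup>2 / \<epsilon>\<^sup>2" using reals_Archimedean2 by blast
    have "norm (expectation (\<lambda>\<omega>. \<bar>(\<Sum>j=1..n. Y j \<omega>) / real n - \<mu>\<bar>) - 0) < \<epsilon>" if n: "n \<ge> max 1 n0" for n
    proof -
      have "8 * K\<^sup>2 / \<epsilon>\<^sup>2 < real n" using n0 n by linarith
      then have "K\<^sup>2 / (real n * (\<epsilon>/2)) < \<epsilon> / 4"
        using \<epsilon> n by (simp add: field_simps power2_eq_square)
      moreover have "(k + \<epsilon>/2) / 2 < \<epsilon> / 2" if "k < \<epsilon> / 4" for k :: real using that \<epsilon> by (simp add: field_simps)
      ultimately have "(K\<^sup>2 / (real n * (\<epsilon>/2)) + \<epsilon>/2) / 2 < \<epsilon> / 2" by blast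
      moreover have "- (m K - \<mu>) < \<epsilon> / 8" using p[folded K_def] unfolding abs_less_iff by blast
      then have "2 * (\<mu> - m K) < \<epsilon> / 4" by simp
      ultimately have small: "2 * (\<mu> - m K) + (K\<^sup>2 / (real n * (\<epsilon>/2)) + \<epsilon>/2) / 2 < \<epsilon> / 4 + \<epsilon> / 2"
        by (intro add_strict_mono)
      have "expectation (\<lambda>\<omega>. \<bar>(\<Sum>j=1..n. Y j \<omega>) / real n - \<mu>\<bar>)
          \<le> 2 * (\<mu> - m K) + (K\<^sup>2 / (real n * (\<epsilon>/2)) + \<epsilon>/2) / 2"
        by (rule bound) (use n \<epsilon> in \<open>auto simp: K_def\<close>)
      also note small
      also have "\<epsilon> / 4 + \<epsilon> / 2 \<le> \<epsilon>" using \<epsilon> by simp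
      finally have "expectation (\<lambda>\<omega>. \<bar>(\<Sum>j=1..n. Y j \<omega>) / real n - \<mu>\<bar>) < \<epsilon>" .
      then show ?thesis by simp
    qed
    then show "\<exists>no. \<forall>n\<ge>no. norm (expectation (\<lambda>\<omega>. \<bar>(\<Sum>j=1..n. Y j \<omega>) / real n - \<mu>\<bar>) - 0) < \<epsilon>" by blast
  qed
qed

section \<open>A single sample of independent paths\<close>

locale iid_paths = prob_space M for M :: "'w measure" +
  fixes a b :: real and T :: "real set" and X :: "nat \<Rightarrow> 'w \<Rightarrow> real \<Rightarrow> real" and m :: "real \<Rightarrow> real"
    and g :: "real \<Rightarrow> real \<Rightarrow> real"
  assumes T: "T = {a..b}" "a \<le> b"
    and indep: "indep_vars (\<lambda>_. path_space T) (\<lambda>j. path_on T (X j)) {1..}"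
    and ident: "\<And>j. j \<ge> 1 \<Longrightarrow> distr M (path_space T) (path_on T (X j)) = distr M (path_space T) (path_on T (X 1))"
    and mean: "\<And>j. j \<ge> 1 \<Longrightarrow> has_mean_function M T (X j) m"
    and cov: "\<And>j. j \<ge> 1 \<Longrightarrow> has_covariance_function M T (X j) g"
    and L2: "\<And>j. j \<ge> 1 \<Longrightarrow> L2_process M T (X j)"
    and m_meas: "m \<in> borel_measurable (lebesgue_on T)"
begin

definition v :: "nat \<Rightarrow> 'w \<Rightarrow> real \<Rightarrow> real" where "v j \<omega> t = X j \<omega> t - m t"

definition w :: "nat \<Rightarrow> nat \<Rightarrow> 'w \<Rightarrow> real \<Rightarrow> real" where "w j k \<omega> t = v j \<omega> t * v k \<omega> t"

definition P :: "nat \<Rightarrow> 'w \<Rightarrow> real \<Rightarrow> real" where "P j = path_on T (X j)"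

text \<open>The product \<open>w\<close> as a fixed functional of a pair of paths: statements about
  \<open>w j k\<close> become statements about the joint law of \<open>P j\<close> and
  \<open>P k\<close>, which depends only on whether the indices coincide.\<close>

definition cprod :: "(real \<Rightarrow> real) \<times> (real \<Rightarrow> real) \<Rightarrow> real \<Rightarrow> real" where
  "cprod x t = (fst x t - m t) * (snd x t - m t)"

lemma w_eq_cprod: "t \<in> T \<Longrightarrow> w j k \<omega> t = cprod (P j \<omega>, P k \<omega>) t"
  by (simp add: w_def v_def cprod_def P_def path_on_def)

lemma P_measurable: "j \<ge> 1 \<Longrightarrow> P j \<in> M \<rightarrow>\<^sub>M path_space T"
  using indep unfolding indep_vars_def2 P_def by auto

lemma X_measurable: "j \<ge> 1 \<Longrightarrow> t \<in> T \<Longrightarrow> (\<lambda>\<omega>. X j \<omega> t) \<in> borel_measurable M"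
proof -
  assume j: "j \<ge> 1" and t: "t \<in> T"
  have "(\<lambda>\<omega>. P j \<omega> t) \<in> borel_measurable M"
    using measurable_component_singleton[OF t] P_measurable[OF j] by (rule measurable_compose[rotated])
  then show ?thesis using t by (simp add: P_def path_on_def)
qed

lemma v_measurable: "j \<ge> 1 \<Longrightarrow> t \<in> T \<Longrightarrow> (\<lambda>\<omega>. v j \<omega> t) \<in> borel_measurable M"
  unfolding v_def by (intro borel_measurable_diff X_measurable) auto

lemma w_measurable: "j \<ge> 1 \<Longrightarrow> k \<ge> 1 \<Longrightarrow> t \<in> T \<Longrightarrow> (\<lambda>\<omega>. w j k \<omega> t) \<in> borel_measurable M"
  unfolding w_def by (intro borel_measurable_times v_measurable)

lemma cprod_measurable: "t \<in> T \<Longrightarrow> (\<lambda>x. cprod x t) \<in> borel_measurable (path_space T \<Otimes>\<^sub>M path_space T)"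
  unfolding cprod_def by measurable

lemma indep_pair:
  assumes "j \<ge> 1" "k \<ge> 1" "j \<noteq> k"
  shows "indep_var (path_space T) (P j) (path_space T) (P k)"
proof -
  let ?S = "\<lambda>_::nat. path_space T"
  have "indep_var (PiM {j} ?S) (\<lambda>\<omega>. restrict (\<lambda>i. path_on T (X i) \<omega>) {j}) (PiM {k} ?S) (\<lambda>\<omega>. restrict (\<lambda>i. path_on T (X i) \<omega>) {k})"
    by (rule indep_var_restrict[OF indep]) (use assms in auto)
  then have "indep_var (path_space T) ((\<lambda>f. f j) \<circ> (\<lambda>\<omega>. restrict (\<lambda>i. path_on T (X i) \<omega>) {j}))
      (path_space T) ((\<lambda>f. f k) \<circ> (\<lambda>\<omega>. restrict (\<lambda>i. path_on T (X i) \<omega>) {k}))"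
    by (rule indep_var_compose) (auto intro!: measurable_component_singleton)
  then show ?thesis by (simp add: comp_def P_def)
qed

text \<open>For equal indices the joint law is the image of the common law under the diagonal map,
  for distinct ones its product with itself. The pairs \<open>(1, 1)\<close> and
  \<open>(1, 2)\<close> therefore represent all pairs; this is why condition (v) is posed for
  exactly these two.\<close>

lemma law_pair:
  assumes "j \<ge> 1" "k \<ge> 1"
  shows "distr M (path_space T \<Otimes>\<^sub>M path_space T) (\<lambda>\<omega>. (P j \<omega>, P k \<omega>))
    = distr M (path_space T \<Otimes>\<^sub>M path_space T) (\<lambda>\<omega>. (P 1 \<omega>, P (if j = k then 1 else 2) \<omega>))"
proof (cases "j = k")
  case True
  have *: "distr M (path_space T \<Otimes>\<^sub>M path_space T) (\<lambda>\<omega>. (P j \<omega>, P j \<omega>))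
      = distr (distr M (path_space T) (P j)) (path_space T \<Otimes>\<^sub>M path_space T) (\<lambda>p. (p, p))" if "j \<ge> 1" for j
    using P_measurable[OF that] by (subst distr_distr) (auto simp: comp_def)
  show ?thesis
    using True *[OF assms(1)] *[of 1] ident[OF assms(1)] by (simp add: P_def)
next
  case False
  have *: "distr M (path_space T \<Otimes>\<^sub>M path_space T) (\<lambda>\<omega>. (P j \<omega>, P k \<omega>))
      = distr M (path_space T) (P 1) \<Otimes>\<^sub>M distr M (path_space T) (P 1)"
    if "j \<ge> 1" "k \<ge> 1" "j \<noteq> k" for j k
    using indep_pair[OF that] ident[OF that(1)] ident[OF that(2)]
    unfolding indep_var_distribution_eq by (simp add: P_def)
  show ?thesis using False *[OF assms] *[of 1 2] by simp
qed

lemma pair_measurable: "j \<ge> 1 \<Longrightarrow> k \<ge> 1 \<Longrightarrow> (\<lambda>\<omega>. (P j \<omega>, P k \<omega>)) \<in> M \<rightarrow>\<^sub>M path_space T \<Otimes>\<^sub>M path_space T"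
  by (intro measurable_Pair P_measurable)

lemma nn_integral_transfer:
  assumes "j \<ge> 1" "k \<ge> 1" "\<Phi> \<in> borel_measurable (path_space T \<Otimes>\<^sub>M path_space T)"
  shows "(\<integral>\<^sup>+\<omega>. \<Phi> (P j \<omega>, P k \<omega>) \<partial>M) = (\<integral>\<^sup>+\<omega>. \<Phi> (P 1 \<omega>, P (if j = k then 1 else 2) \<omega>) \<partial>M)"
proof -
  have "(\<integral>\<^sup>+\<omega>. \<Phi> (P j \<omega>, P k \<omega>) \<partial>M) = (\<integral>\<^sup>+x. \<Phi> x \<partial>distr M (path_space T \<Otimes>\<^sub>M path_space T) (\<lambda>\<omega>. (P j \<omega>, P k \<omega>)))"
    by (rule nn_integral_distr[OF pair_measurable, symmetric]) (use assms in auto)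
  also have "\<dots> = (\<integral>\<^sup>+\<omega>. \<Phi> (P 1 \<omega>, P (if j = k then 1 else 2) \<omega>) \<partial>M)"
    unfolding law_pair[OF assms(1,2)] by (rule nn_integral_distr[OF pair_measurable]) (use assms in auto)
  finally show ?thesis .
qed

lemma AE_transfer:
  assumes "j \<ge> 1" "k \<ge> 1" "{x \<in> space (path_space T \<Otimes>\<^sub>M path_space T). Q x} \<in> sets (path_space T \<Otimes>\<^sub>M path_space T)"
    and "AE \<omega> in M. Q (P 1 \<omega>, P (if j = k then 1 else 2) \<omega>)"
  shows "AE \<omega> in M. Q (P j \<omega>, P k \<omega>)"
proof -
  have "AE x in distr M (path_space T \<Otimes>\<^sub>M path_space T) (\<lambda>\<omega>. (P 1 \<omega>, P (if j = k then 1 else 2) \<omega>)). Q x"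
    by (subst AE_distr_iff[OF pair_measurable]) (use assms in auto)
  then have "AE x in distr M (path_space T \<Otimes>\<^sub>M path_space T) (\<lambda>\<omega>. (P j \<omega>, P k \<omega>)). Q x"
    unfolding law_pair[OF assms(1,2)] .
  then show ?thesis by (subst (asm) AE_distr_iff[OF pair_measurable]) (use assms in auto)
qed

lemma v_moments:
  assumes j: "j \<ge> 1" and t: "t \<in> T"
  shows "integrable M (\<lambda>\<omega>. v j \<omega> t)" "expectation (\<lambda>\<omega>. v j \<omega> t) = 0"
    "integrable M (\<lambda>\<omega>. (v j \<omega> t)\<^sup>2)" "expectation (\<lambda>\<omega>. (v j \<omega> t)\<^sup>2) = g t t"
proof -
  have iX: "integrable M (\<lambda>\<omega>. X j \<omega> t)" and eX: "expectation (\<lambda>\<omega>. X j \<omega> t) = m t"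
    using mean[OF j] t by (auto simp: has_mean_function_def)
  show "integrable M (\<lambda>\<omega>. v j \<omega> t)" "expectation (\<lambda>\<omega>. v j \<omega> t) = 0"
    using iX eX by (auto simp: v_def prob_space)
  have "integrable M (\<lambda>\<omega>. (X j \<omega> t)\<^sup>2)" using cov[OF j] t by (auto simp: has_covariance_function_def)
  then show "integrable M (\<lambda>\<omega>. (v j \<omega> t)\<^sup>2)"
    using iX by (simp add: v_def power2_diff)
  have "covariance M (\<lambda>\<omega>. X j \<omega> t) (\<lambda>\<omega>. X j \<omega> t) = g t t"
    using cov[OF j] t by (auto simp: has_covariance_function_def)
  then show "expectation (\<lambda>\<omega>. (v j \<omega> t)\<^sup>2) = g t t"
    by (simp add: covariance_def eX v_def power2_eq_square)
qed

lemma v_uncorrelated: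
  assumes "j \<ge> 1" "k \<ge> 1" "j \<noteq> k" and t: "t \<in> T"
  shows "expectation (\<lambda>\<omega>. v j \<omega> t * v k \<omega> t) = 0"
proof -
  have "indep_var borel ((\<lambda>p. p t - m t) \<circ> P j) borel ((\<lambda>p. p t - m t) \<circ> P k)"
    using t by (intro indep_var_compose[OF indep_pair[OF assms(1-3)]]) measurable
  then have "indep_var borel (\<lambda>\<omega>. v j \<omega> t) borel (\<lambda>\<omega>. v k \<omega> t)"
    using t by (simp add: comp_def P_def path_on_def v_def)
  from indep_var_lebesgue_integral[OF this] show ?thesis
    using v_moments[OF assms(1) t] v_moments[OF assms(2) t] by simp
qed

lemma sum_v_sq:
  assumes t: "t \<in> T"
  shows "integrable M (\<lambda>\<omega>. (\<Sum>j=1..n. v j \<omega> t)\<^sup>2)" "expectation (\<lambda>\<omega>. (\<Sum>j=1..n. v j \<omega> t)\<^sup>2) = real n * g t t"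
proof -
  show "integrable M (\<lambda>\<omega>. (\<Sum>j=1..n. v j \<omega> t)\<^sup>2)"
    by (rule uncorrelated_sum_sq; use v_moments v_measurable v_uncorrelated t in auto)
  have "expectation (\<lambda>\<omega>. (\<Sum>j=1..n. v j \<omega> t)\<^sup>2) = (\<Sum>j=1..n. expectation (\<lambda>\<omega>. (v j \<omega> t)\<^sup>2))"
    by (rule uncorrelated_sum_sq; use v_moments v_measurable v_uncorrelated t in auto)
  then show "expectation (\<lambda>\<omega>. (\<Sum>j=1..n. v j \<omega> t)\<^sup>2) = real n * g t t" using v_moments t by simp
qed

definition scov :: "nat \<Rightarrow> 'w \<Rightarrow> real \<Rightarrow> real" where
  "scov n \<omega> t = (\<Sum>j=1..n. (X j \<omega> t - (\<Sum>j=1..n. X j \<omega> t) / real n) * (X j \<omega> t - (\<Sum>j=1..n. X j \<omega> t) / real n)) / (real n - 1)"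

lemma scov_eq:
  assumes "n \<ge> 1"
  shows "scov n \<omega> t = ((\<Sum>j=1..n. (v j \<omega> t)\<^sup>2) - (\<Sum>j=1..n. v j \<omega> t)\<^sup>2 / real n) / (real n - 1)"
proof -
  define V where "V = (\<Sum>j=1..n. v j \<omega> t)"
  have n: "real n > 0" using assms by simp
  have 1: "X j \<omega> t - (\<Sum>j=1..n. X j \<omega> t) / real n = v j \<omega> t - V / real n" for j
    using n by (simp add: V_def v_def sum_subtractf diff_divide_distrib)
  have "(\<Sum>j=1..n. (v j \<omega> t - V / real n) * (v j \<omega> t - V / real n))
      = (\<Sum>j=1..n. (v j \<omega> t)\<^sup>2 - 2 * (V / real n) * v j \<omega> t + (V / real n)\<^sup>2)"
    by (intro sum.cong) (auto simp: algebra_simps power2_eq_square)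
  also have "\<dots> = (\<Sum>j=1..n. (v j \<omega> t)\<^sup>2) - 2 * (V / real n) * V + real n * (V / real n)\<^sup>2"
  proof -
    have "(\<Sum>j=1..n. 2 * (V / real n) * v j \<omega> t) = 2 * (V / real n) * V"
      by (subst sum_distrib_left[symmetric]) (simp add: V_def)
    then show ?thesis by (simp add: sum.distrib sum_subtractf)
  qed
  also have "\<dots> = (\<Sum>j=1..n. (v j \<omega> t)\<^sup>2) - V\<^sup>2 / real n"
    using n by (simp add: field_simps power2_eq_square)
  finally show ?thesis unfolding scov_def 1 V_def by simp
qed

lemma scov_measurable: "t \<in> T \<Longrightarrow> (\<lambda>\<omega>. scov n \<omega> t) \<in> borel_measurable M"
  unfolding scov_def
  by (intro borel_measurable_divide borel_measurable_sum borel_measurable_times borel_measurable_diff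
      borel_measurable_const X_measurable) auto

text \<open>The error splits into \<open>n / (n - 1)\<close> times the error of the mean of squares
  about the true mean, which the weak law handles, and a term \<open>(g - V / n) / (n - 1)\<close>
  whose mean is of order \<open>1 / n\<close> since the squared sum \<open>V\<close> has mean
  \<open>n * g\<close>.\<close>

lemma scov_consistent:
  assumes t: "t \<in> T"
  shows "(\<lambda>n. expectation (\<lambda>\<omega>. \<bar>scov n \<omega> t - g t t\<bar>)) \<longlonglongrightarrow> 0"
    and "integrable M (\<lambda>\<omega>. \<bar>scov n \<omega> t - g t t\<bar>)"
proof -
  define D where "D n \<omega> = \<bar>(\<Sum>j=1..n. (v j \<omega> t)\<^sup>2) / real n - g t t\<bar>" for n \<omega>
  have g0: "g t t \<ge> 0" using v_moments(4)[OF order_refl t, symmetric] by simp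
  have wl: "(\<lambda>n. expectation (D n)) \<longlonglongrightarrow> 0"
  proof -
    have "(\<lambda>n. expectation (\<lambda>\<omega>. \<bar>(\<Sum>j=1..n. (v j \<omega> t)\<^sup>2) / real n - expectation (\<lambda>\<omega>. (v 1 \<omega> t)\<^sup>2)\<bar>)) \<longlonglongrightarrow> 0"
    proof (rule weak_law_L1)
      have "indep_vars (\<lambda>_. borel) (\<lambda>j \<omega>. (path_on T (X j) \<omega> t - m t)\<^sup>2) {1..}"
        using t by (intro indep_vars_compose2[OF indep, of "\<lambda>_ p. (p t - m t)\<^sup>2"]) measurable
      then show "indep_vars (\<lambda>_. borel) (\<lambda>j \<omega>. (v j \<omega> t)\<^sup>2) {1..}" using t by (simp add: path_on_def v_def)
      have *: "distr M borel (\<lambda>\<omega>. (v j \<omega> t)\<^sup>2) = distr (distr M (path_space T) (P j)) borel (\<lambda>p. (p t - m t)\<^sup>2)"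
        if "j \<ge> 1" for j
        using P_measurable[OF that] t by (subst distr_distr) (auto simp: comp_def P_def path_on_def v_def)
      show "distr M borel (\<lambda>\<omega>. (v j \<omega> t)\<^sup>2) = distr M borel (\<lambda>\<omega>. (v 1 \<omega> t)\<^sup>2)" if "j \<ge> 1" for j
        using *[OF that] *[of 1] ident[OF that] by (simp add: P_def)
    qed (use v_moments t in auto)
    then show ?thesis using v_moments(4)[of 1 t] t by (simp add: D_def[abs_def])
  qed
  have Dint: "integrable M (D n)" for n
    unfolding D_def
    by (intro integrable_abs Bochner_Integration.integrable_diff integrable_divide
        Bochner_Integration.integrable_sum integrable_const v_moments(3) t) auto
  show int: "integrable M (\<lambda>\<omega>. \<bar>scov n \<omega> t - g t t\<bar>)" for n
  proof (cases "n \<ge> 1")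
    case True
    show ?thesis unfolding scov_eq[OF True]
      by (intro integrable_abs Bochner_Integration.integrable_diff integrable_divide
          Bochner_Integration.integrable_sum integrable_const v_moments(3) sum_v_sq(1) t) auto
  next
    case False
    then show ?thesis by (simp add: scov_def)
  qed
  have bound: "expectation (\<lambda>\<omega>. \<bar>scov n \<omega> t - g t t\<bar>) \<le> 2 * expectation (D n) + (2 * g t t) / (real n - 1)"
    if n: "n \<ge> 2" for n
  proof -
    define V where "V \<omega> = (\<Sum>j=1..n. v j \<omega> t)\<^sup>2" for \<omega>
    have n1: "real n - 1 > 0" "real n > 0" using n by auto
    \<comment> \<open>Here \<open>n \<ge> 2\<close> matters: it bounds the correction factor by 2
      and keeps the denominator positive.\<close>
    have r: "real n / (real n - 1) \<le> 2" using n n1 by (simp add: field_simps)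
    have "\<bar>scov n \<omega> t - g t t\<bar> \<le> 2 * D n \<omega> + (g t t + V \<omega> / real n) / (real n - 1)" for \<omega>
    proof -
      define A where "A = (\<Sum>j=1..n. (v j \<omega> t)\<^sup>2)"
      have "n \<ge> 1" using n by simp
      note sc = scov_eq[OF this, of \<omega> t, folded A_def V_def]
      have "scov n \<omega> t - g t t = (real n / (real n - 1)) * (A / real n - g t t) + (g t t - V \<omega> / real n) / (real n - 1)"
      proof -
        have split: "real n / (real n - 1) * y + z / (real n - 1) = (real n * y + z) / (real n - 1)" for y z
          by (simp add: add_divide_distrib)
        have num: "real n * (A / real n - g t t) + (g t t - V \<omega> / real n) = A - V \<omega> / real n - g t t * (real n - 1)"
          using n1 by (simp add: right_diff_distrib algebra_simps)
        have "(A - V \<omega> / real n) / (real n - 1) - g t t = ((A - V \<omega> / real n) - g t t * (real n - 1)) / (real n - 1)"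
          using n1 by (simp add: diff_divide_distrib)
        then show ?thesis unfolding sc split num .
      qed
      also have "\<bar>\<dots>\<bar> \<le> (real n / (real n - 1)) * D n \<omega> + (g t t + V \<omega> / real n) / (real n - 1)"
      proof (rule order_trans[OF abs_triangle_ineq add_mono])
        show "\<bar>real n / (real n - 1) * (A / real n - g t t)\<bar> \<le> real n / (real n - 1) * D n \<omega>"
          using n1 by (simp add: D_def A_def abs_mult)
        have "0 \<le> V \<omega> / real n" by (simp add: V_def)
        then have "\<bar>g t t - V \<omega> / real n\<bar> \<le> g t t + V \<omega> / real n" using g0 by linarith
        then show "\<bar>(g t t - V \<omega> / real n) / (real n - 1)\<bar> \<le> (g t t + V \<omega> / real n) / (real n - 1)"
          using n1 by (simp add: abs_divide divide_right_mono)
      qed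
      also have "\<dots> \<le> 2 * D n \<omega> + (g t t + V \<omega> / real n) / (real n - 1)"
        using r by (intro add_right_mono mult_right_mono) (auto simp: D_def)
      finally show ?thesis .
    qed
    then have "expectation (\<lambda>\<omega>. \<bar>scov n \<omega> t - g t t\<bar>)
        \<le> expectation (\<lambda>\<omega>. 2 * D n \<omega> + (g t t + V \<omega> / real n) / (real n - 1))"
      using int[of n] Dint[of n] sum_v_sq(1)[OF t, of n] by (intro integral_mono) (auto simp: V_def)
    also have "\<dots> = 2 * expectation (D n) + (g t t + expectation V / real n) / (real n - 1)"
    proof -
      have "integrable M V" unfolding V_def using sum_v_sq(1)[OF t] by simp
      then show ?thesis using Dint[of n] by (simp add: prob_space)
    qed
    also have "expectation V / real n = g t t" unfolding V_def sum_v_sq(2)[OF t] using n1 by simp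
    finally show ?thesis by simp
  qed
  show "(\<lambda>n. expectation (\<lambda>\<omega>. \<bar>scov n \<omega> t - g t t\<bar>)) \<longlonglongrightarrow> 0"
  proof (rule tendsto_sandwich[OF _ _ tendsto_const])
    show "\<forall>\<^sub>F n in sequentially. expectation (\<lambda>\<omega>. \<bar>scov n \<omega> t - g t t\<bar>) \<le> 2 * expectation (D n) + (2 * g t t) / (real n - 1)"
      using eventually_ge_at_top[of 2] by eventually_elim (rule bound)
    have "(\<lambda>n. (2 * g t t) / (real n - 1)) \<longlonglongrightarrow> 0" by real_asymp
    from tendsto_add[OF tendsto_mult_left[OF wl, of 2] this]
    show "(\<lambda>n. 2 * expectation (D n) + (2 * g t t) / (real n - 1)) \<longlonglongrightarrow> 0" by simp
  qed simp
qed
end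

section \<open>From a finite grid to almost every time\<close>

context iid_paths begin

context
  assumes equicont: "\<And>j. j \<in> {1, 2} \<Longrightarrow>
          ((\<lambda>\<delta>. outer_expectation M (\<lambda>\<omega>.
               SUP (t, s) \<in> {(t, s). t \<in> T \<and> s \<in> T \<and> \<bar>t - s\<bar> < \<delta>}.
                 ereal \<bar>w 1 j \<omega> t - w 1 j \<omega> s\<bar>))
            \<longlongrightarrow> 0) (at_right 0)"
begin

text \<open>The supremum over a countable dense set of times depends measurably on the path, so that
  its distribution is the same for all samples; the supremum over all times has no such property.\<close>

lemma oscillation_majorant:
  assumes e: "e > 0" and d: "d > 0"
  obtains \<delta> G W where "0 < \<delta>" "\<delta> < d" "finite G" "G \<subseteq> T" "\<And>t. t \<in> T \<Longrightarrow> \<exists>h\<in>G. \<bar>t - h\<bar> < \<delta>"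
    "\<And>j k. j \<ge> 1 \<Longrightarrow> k \<ge> 1 \<Longrightarrow> W j k \<in> borel_measurable M"
    "\<And>j k. j \<ge> 1 \<Longrightarrow> k \<ge> 1 \<Longrightarrow> (\<integral>\<^sup>+\<omega>. W j k \<omega> \<partial>M) \<le> ennreal e"
    "\<And>j k t h. j \<ge> 1 \<Longrightarrow> k \<ge> 1 \<Longrightarrow> t \<in> T \<Longrightarrow> h \<in> G \<Longrightarrow> \<bar>t - h\<bar> < \<delta> \<Longrightarrow>
       AE \<omega> in M. ennreal \<bar>w j k \<omega> t - w j k \<omega> h\<bar> \<le> W j k \<omega>"
proof -
  have T_ne: "T \<noteq> {}" using T by auto
  obtain \<delta>1 U1 where 1: "0 < \<delta>1" "\<delta>1 < d" "(\<integral>\<^sup>+\<omega>. U1 \<omega> \<partial>M) < ennreal e"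
    "\<And>\<omega> s t. \<omega> \<in> space M \<Longrightarrow> s \<in> T \<Longrightarrow> t \<in> T \<Longrightarrow> \<bar>t - s\<bar> < \<delta>1 \<Longrightarrow> ennreal \<bar>w 1 1 \<omega> t - w 1 1 \<omega> s\<bar> \<le> U1 \<omega>"
    by (rule equicontinuous_majorant[OF T_ne equicont[OF insertI1] e d]) (rule that)
  \<comment> \<open>Starting the second choice from \<open>\<delta>1\<close> produces one
    \<open>\<delta>\<close> for both products, since \<open>U1\<close> also serves all smaller
    distances.\<close>
  obtain \<delta> U2 where 2: "0 < \<delta>" "\<delta> < \<delta>1" "(\<integral>\<^sup>+\<omega>. U2 \<omega> \<partial>M) < ennreal e"
    "\<And>\<omega> s t. \<omega> \<in> space M \<Longrightarrow> s \<in> T \<Longrightarrow> t \<in> T \<Longrightarrow> \<bar>t - s\<bar> < \<delta> \<Longrightarrow> ennreal \<bar>w 1 2 \<omega> t - w 1 2 \<omega> s\<bar> \<le> U2 \<omega>"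
    by (rule equicontinuous_majorant[OF T_ne equicont[OF insertI2[OF singletonI]] e 1(1)]) (rule that)
  have "compact T" using T by simp
  obtain G where G: "G \<subseteq> T" "finite G" "T \<subseteq> (\<Union>h\<in>G. ball h \<delta>)"
  proof (rule compactE_image[OF \<open>compact T\<close>, of T "\<lambda>h. ball h \<delta>"])
    show "T \<subseteq> (\<Union>h\<in>T. ball h \<delta>)" using 2(1) by auto
  qed auto
  obtain Q where Q: "countable Q" "Q \<subseteq> T" "T \<subseteq> closure Q" by (rule separable)
  \<comment> \<open>Only increments to a grid point will be estimated, so one of the two times
    ranges over the finite \<open>G\<close> and the other over the dense \<open>Q\<close>.\<close>
  define I where "I = {(s, h). s \<in> Q \<and> h \<in> G \<and> \<bar>s - h\<bar> < \<delta>}"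
  have I: "countable I"
    by (rule countable_subset[of _ "Q \<times> G"]) (use Q(1) countable_finite[OF G(2)] in \<open>auto simp: I_def\<close>)
  define Osc where "Osc x = (SUP (s, h)\<in>I. ennreal \<bar>cprod x s - cprod x h\<bar>)" for x
  have Osc_meas: "Osc \<in> borel_measurable (path_space T \<Otimes>\<^sub>M path_space T)"
    unfolding Osc_def split_beta
  proof (rule borel_measurable_SUP[OF I])
    fix p assume "p \<in> I"
    then have "fst p \<in> T" "snd p \<in> T" using Q(2) G(1) by (auto simp: I_def)
    note [measurable] = cprod_measurable[OF this(1)] cprod_measurable[OF this(2)]
    show "(\<lambda>x. ennreal \<bar>cprod x (fst p) - cprod x (snd p)\<bar>) \<in> borel_measurable (path_space T \<Otimes>\<^sub>M path_space T)"
      by measurable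
  qed
  define W where "W j k \<omega> = Osc (P j \<omega>, P k \<omega>)" for j k \<omega>
  have W_eq: "W j k \<omega> = (SUP (s, h)\<in>I. ennreal \<bar>w j k \<omega> s - w j k \<omega> h\<bar>)" for j k \<omega>
    unfolding W_def Osc_def using Q(2) G(1) by (intro SUP_cong) (auto simp: I_def w_eq_cprod subset_iff)
  have W_meas: "W j k \<in> borel_measurable M" if "j \<ge> 1" "k \<ge> 1" for j k
    unfolding W_def by (rule measurable_compose[OF pair_measurable[OF that] Osc_meas])
  have W_int: "(\<integral>\<^sup>+\<omega>. W j k \<omega> \<partial>M) \<le> ennreal e" if jk: "j \<ge> 1" "k \<ge> 1" for j k
  proof -
    have "(\<integral>\<^sup>+\<omega>. W j k \<omega> \<partial>M) = (\<integral>\<^sup>+\<omega>. W 1 (if j = k then 1 else 2) \<omega> \<partial>M)"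
      unfolding W_def by (rule nn_integral_transfer[OF jk Osc_meas])
    also have "\<dots> \<le> ennreal e"
    proof (cases "j = k")
      case True
      have "(\<integral>\<^sup>+\<omega>. W 1 1 \<omega> \<partial>M) \<le> (\<integral>\<^sup>+\<omega>. U1 \<omega> \<partial>M)"
        unfolding W_eq
      proof (intro nn_integral_mono SUP_least, clarify)
        fix \<omega> s h assume "\<omega> \<in> space M" "(s, h) \<in> I"
        then show "ennreal \<bar>w 1 1 \<omega> s - w 1 1 \<omega> h\<bar> \<le> U1 \<omega>"
          using Q(2) G(1) 2(2) by (intro 1(4)) (auto simp: I_def)
      qed
      then show ?thesis using 1(3) True by simp
    next
      case False
      have "(\<integral>\<^sup>+\<omega>. W 1 2 \<omega> \<partial>M) \<le> (\<integral>\<^sup>+\<omega>. U2 \<omega> \<partial>M)"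
        unfolding W_eq
      proof (intro nn_integral_mono SUP_least, clarify)
        fix \<omega> s h assume "\<omega> \<in> space M" "(s, h) \<in> I"
        then show "ennreal \<bar>w 1 2 \<omega> s - w 1 2 \<omega> h\<bar> \<le> U2 \<omega>"
          using Q(2) G(1) 2(2) by (intro 2(4)) (auto simp: I_def)
      qed
      then show ?thesis using 2(3) False by simp
    qed
    finally show ?thesis .
  qed
  have W_ae: "AE \<omega> in M. ennreal \<bar>w j k \<omega> t - w j k \<omega> h\<bar> \<le> W j k \<omega>"
    if jk: "j \<ge> 1" "k \<ge> 1" and t: "t \<in> T" and h: "h \<in> G" and th: "\<bar>t - h\<bar> < \<delta>" for j k t h
  proof -
    have hT: "h \<in> T" using h G(1) by auto
    \<comment> \<open>For fixed \<open>t\<close> and \<open>h\<close> the inequality is an event of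
      the pair of paths and can be transferred; its conjunction over all \<open>t\<close> need not
      be one. Hence the null set depends on the time.\<close>
    have "AE \<omega> in M. ennreal \<bar>cprod (P j \<omega>, P k \<omega>) t - cprod (P j \<omega>, P k \<omega>) h\<bar> \<le> Osc (P j \<omega>, P k \<omega>)"
    proof (rule AE_transfer[OF jk])
      note [measurable] = cprod_measurable[OF t] cprod_measurable[OF hT] Osc_meas
      show "{x \<in> space (path_space T \<Otimes>\<^sub>M path_space T). ennreal \<bar>cprod x t - cprod x h\<bar> \<le> Osc x} \<in> sets (path_space T \<Otimes>\<^sub>M path_space T)"
        by measurable
      let ?J = "if j = k then 1 else (2::nat)"
      have "AE \<omega> in M. \<forall>\<epsilon>>0. \<exists>\<delta>>0. \<forall>s\<in>T. \<forall>t\<in>T. \<bar>t - s\<bar> < \<delta> \<longrightarrow> \<bar>w 1 ?J \<omega> t - w 1 ?J \<omega> s\<bar> < \<epsilon>"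
        by (rule equicontinuous_AE[OF T_ne equicont]) simp
      then show "AE \<omega> in M. ennreal \<bar>cprod (P 1 \<omega>, P ?J \<omega>) t - cprod (P 1 \<omega>, P ?J \<omega>) h\<bar> \<le> Osc (P 1 \<omega>, P ?J \<omega>)"
      proof eventually_elim
        case (elim \<omega>)
        have "ennreal \<bar>w 1 ?J \<omega> t - w 1 ?J \<omega> h\<bar> \<le> W 1 ?J \<omega>"
        proof (rule ennreal_le_epsilon)
          fix \<epsilon> :: real assume "\<epsilon> > 0"
          then obtain \<delta>' where \<delta>': "\<delta>' > 0" "\<And>s t. s \<in> T \<Longrightarrow> t \<in> T \<Longrightarrow> \<bar>t - s\<bar> < \<delta>' \<Longrightarrow> \<bar>w 1 ?J \<omega> t - w 1 ?J \<omega> s\<bar> < \<epsilon>"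
            using elim by blast
          \<comment> \<open>The strict inequality between \<open>t\<close> and \<open>h\<close>
            leaves room: a dense time \<open>s\<close> close to \<open>t\<close> is still within
            \<open>\<delta>\<close> of \<open>h\<close>, so \<open>(s, h)\<close> belongs to
            \<open>I\<close>.\<close>
          have "min \<delta>' (\<delta> - \<bar>t - h\<bar>) > 0" using \<delta>' th by simp
          then obtain s where s: "s \<in> Q" "dist s t < min \<delta>' (\<delta> - \<bar>t - h\<bar>)"
            using Q(3) t unfolding closure_approachable subset_iff by blast
          have "\<bar>t - s\<bar> < \<delta>'" "\<bar>s - h\<bar> < \<delta>" using s(2) by (auto simp: dist_real_def)
          have "\<bar>w 1 ?J \<omega> t - w 1 ?J \<omega> h\<bar> \<le> \<bar>w 1 ?J \<omega> s - w 1 ?J \<omega> h\<bar> + \<epsilon>"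
            using \<delta>'(2)[of s t] s(1) Q(2) t \<open>\<bar>t - s\<bar> < \<delta>'\<close> by force
          then have "ennreal \<bar>w 1 ?J \<omega> t - w 1 ?J \<omega> h\<bar> \<le> ennreal (\<bar>w 1 ?J \<omega> s - w 1 ?J \<omega> h\<bar> + \<epsilon>)"
            by (rule ennreal_leI)
          also have "\<dots> = ennreal \<bar>w 1 ?J \<omega> s - w 1 ?J \<omega> h\<bar> + ennreal \<epsilon>"
            by (rule ennreal_plus) (use \<open>\<epsilon> > 0\<close> in auto)
          also have "ennreal \<bar>w 1 ?J \<omega> s - w 1 ?J \<omega> h\<bar> \<le> W 1 ?J \<omega>"
            unfolding W_eq by (rule SUP_upper2[of "(s, h)"]) (use s h \<open>\<bar>s - h\<bar> < \<delta>\<close> in \<open>auto simp: I_def\<close>)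
          finally show "ennreal \<bar>w 1 ?J \<omega> t - w 1 ?J \<omega> h\<bar> \<le> W 1 ?J \<omega> + ennreal \<epsilon>"
            by (simp add: add_right_mono)
        qed
        then show ?case unfolding W_def w_eq_cprod[OF t] w_eq_cprod[OF hT] .
      qed
    qed
    then show ?thesis unfolding W_def w_eq_cprod[OF t] w_eq_cprod[OF hT] .
  qed
  show thesis
  proof (rule that[of \<delta> G W])
    show "\<exists>h\<in>G. \<bar>t - h\<bar> < \<delta>" if "t \<in> T" for t
    proof -
      obtain h where "h \<in> G" "dist h t < \<delta>" using G(3) \<open>t \<in> T\<close> by auto
      then show ?thesis by (intro bexI[of _ h]) (simp_all add: dist_real_def abs_minus_commute)
    qed
    show "\<delta> < d" using 1(2) 2(2) by simp
  qed (use 2(1) G(1,2) W_meas W_int W_ae in auto)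
qed

lemma w_joint_measurable:
  assumes "j \<ge> 1" "k \<ge> 1"
  shows "(\<lambda>(\<omega>, t). w j k \<omega> t) \<in> borel_measurable (M \<Otimes>\<^sub>M lebesgue_on T)"
proof -
  have [measurable]: "(\<lambda>x. X i (fst x) (snd x)) \<in> borel_measurable (M \<Otimes>\<^sub>M lebesgue_on T)" if "i \<ge> 1" for i
    using L2[OF that] by (simp add: L2_process_def split_beta')
  note [measurable] = m_meas
  show ?thesis unfolding w_def v_def split_beta using assms by measurable
qed

text \<open>The numerator of the sample variance is the sum of the \<open>n\<close> squares minus
  \<open>1 / n\<close> times the sum of all \<open>n^2\<close> products. Its increment to the
  nearest grid point is bounded by \<open>S\<close>, whose mean is at most \<open>2 * n * e\<close>:
  the factor \<open>1 / n\<close> makes the many mixed products as cheap as the squares. After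
  division by \<open>n - 1\<close> the bound no longer depends on \<open>n\<close>. Three thirds of
  \<open>\<epsilon>\<close> go to this increment, to consistency at the grid point, and to the
  oscillation of the true variance.\<close>

lemma scov_uniformly_consistent:
  assumes g: "continuous_on T (\<lambda>t. g t t)" and \<epsilon>: "\<epsilon> > 0"
  shows "\<exists>N0. \<forall>n\<ge>N0. \<exists>E\<in>sets M. prob E \<le> \<epsilon> \<and> (\<forall>\<omega>\<in>space M - E. AE t in lebesgue_on T. \<bar>scov n \<omega> t - g t t\<bar> \<le> \<epsilon>)"
proof -
  have "uniformly_continuous_on T (\<lambda>t. g t t)"
    using T by (intro compact_uniformly_continuous g) simp
  then obtain d where d: "d > 0" "\<And>s t. s \<in> T \<Longrightarrow> t \<in> T \<Longrightarrow> \<bar>t - s\<bar> < d \<Longrightarrow> \<bar>g t t - g s s\<bar> < \<epsilon> / 3"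
    unfolding uniformly_continuous_on_def dist_real_def using \<epsilon> by (metis zero_less_divide_iff zero_less_numeral)
  \<comment> \<open>Chosen for Markov's inequality with threshold
    \<open>\<epsilon> / 3 * (n - 1)\<close>: by \<open>n \<le> 2 * (n - 1)\<close>, the mean
    \<open>2 * n * e\<close> is at most \<open>\<epsilon> / 2\<close> times that threshold.\<close>
  define e where "e = \<epsilon>\<^sup>2 / 24"
  have e: "e > 0" using \<epsilon> by (simp add: e_def)
  obtain \<delta> G W where \<delta>: "0 < \<delta>" "\<delta> < d" and G: "finite G" "G \<subseteq> T" "\<And>t. t \<in> T \<Longrightarrow> \<exists>h\<in>G. \<bar>t - h\<bar> < \<delta>"
    and W_meas: "\<And>j k. j \<ge> 1 \<Longrightarrow> k \<ge> 1 \<Longrightarrow> W j k \<in> borel_measurable M"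
    and W_int: "\<And>j k. j \<ge> 1 \<Longrightarrow> k \<ge> 1 \<Longrightarrow> (\<integral>\<^sup>+\<omega>. W j k \<omega> \<partial>M) \<le> ennreal e"
    and W_ae: "\<And>j k t h. j \<ge> 1 \<Longrightarrow> k \<ge> 1 \<Longrightarrow> t \<in> T \<Longrightarrow> h \<in> G \<Longrightarrow> \<bar>t - h\<bar> < \<delta> \<Longrightarrow>
       AE \<omega> in M. ennreal \<bar>w j k \<omega> t - w j k \<omega> h\<bar> \<le> W j k \<omega>"
    by (rule oscillation_majorant[OF e d(1)]) (rule that)
  \<comment> \<open>Markov with threshold \<open>\<epsilon> / 3\<close> turns this into a
    probability that sums over the grid to at most \<open>\<epsilon> / 2\<close>; the
    \<open>+ 1\<close> keeps the denominator positive in any case.\<close>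
  have "\<exists>n0. \<forall>n\<ge>n0. expectation (\<lambda>\<omega>. \<bar>scov n \<omega> h - g h h\<bar>) \<le> (\<epsilon> / (2 * (real (card G) + 1))) * (\<epsilon> / 3)" if "h \<in> G" for h
  proof -
    define k where "k = (\<epsilon> / (2 * (real (card G) + 1))) * (\<epsilon> / 3)"
    have k: "k > 0" using \<epsilon> by (simp add: k_def)
    have "h \<in> T" using that G(2) by auto
    from LIMSEQ_D[OF scov_consistent(1)[OF this] k] show ?thesis
      unfolding k_def[symmetric] by (auto intro: less_imp_le)
  qed
  then obtain n0 where n0: "\<And>h n. h \<in> G \<Longrightarrow> n \<ge> n0 h \<Longrightarrow>
      expectation (\<lambda>\<omega>. \<bar>scov n \<omega> h - g h h\<bar>) \<le> (\<epsilon> / (2 * (real (card G) + 1))) * (\<epsilon> / 3)" by metis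
  define N0 where "N0 = Max (insert 2 (n0 ` G))"
  have N0: "n \<ge> 2" "\<And>h. h \<in> G \<Longrightarrow> n \<ge> n0 h" if "n \<ge> N0" for n
    using that G(1) by (auto simp: N0_def)
  show ?thesis
  proof (intro exI[of _ N0] allI impI)
    fix n assume n: "n \<ge> N0"
    have n2: "n \<ge> 2" using N0 n by auto
    then have n1: "real n - 1 > 0" "real n > 0" "n \<ge> 1" by auto
    define J where "J = {1..n}"
    define S where "S \<omega> = (\<Sum>j\<in>J. W j j \<omega>) + (\<Sum>j\<in>J. \<Sum>k\<in>J. W j k \<omega>) * ennreal (1 / real n)" for \<omega>
    have S_meas[measurable]: "S \<in> borel_measurable M"
      unfolding S_def J_def using W_meas by (intro borel_measurable_add borel_measurable_times borel_measurable_sum borel_measurable_const) auto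
    have S_int: "(\<integral>\<^sup>+\<omega>. S \<omega> \<partial>M) \<le> ennreal (2 * real n * e)"
    proof -
      have "(\<integral>\<^sup>+\<omega>. S \<omega> \<partial>M) = (\<integral>\<^sup>+\<omega>. (\<Sum>j\<in>J. W j j \<omega>) \<partial>M) + (\<integral>\<^sup>+\<omega>. (\<Sum>j\<in>J. \<Sum>k\<in>J. W j k \<omega>) \<partial>M) * ennreal (1 / real n)"
        unfolding S_def J_def using W_meas
        by (subst nn_integral_add) (auto intro!: borel_measurable_times borel_measurable_sum nn_integral_multc)
      also have "(\<integral>\<^sup>+\<omega>. (\<Sum>j\<in>J. W j j \<omega>) \<partial>M) = (\<Sum>j\<in>J. (\<integral>\<^sup>+\<omega>. W j j \<omega> \<partial>M))"
        unfolding J_def using W_meas by (intro nn_integral_sum) auto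
      also have "\<dots> \<le> (\<Sum>j\<in>J. ennreal e)" unfolding J_def by (intro sum_mono W_int) auto
      also have "(\<integral>\<^sup>+\<omega>. (\<Sum>j\<in>J. \<Sum>k\<in>J. W j k \<omega>) \<partial>M) = (\<Sum>j\<in>J. (\<integral>\<^sup>+\<omega>. (\<Sum>k\<in>J. W j k \<omega>) \<partial>M))"
        unfolding J_def using W_meas by (intro nn_integral_sum borel_measurable_sum) auto
      also have "\<dots> = (\<Sum>j\<in>J. \<Sum>k\<in>J. (\<integral>\<^sup>+\<omega>. W j k \<omega> \<partial>M))"
        unfolding J_def using W_meas by (intro sum.cong refl nn_integral_sum) auto
      also have "\<dots> \<le> (\<Sum>j\<in>J. \<Sum>k\<in>J. ennreal e)" unfolding J_def by (intro sum_mono W_int) auto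
      also have "(\<Sum>j\<in>J. ennreal e) + (\<Sum>j\<in>J. \<Sum>k\<in>J. ennreal e) * ennreal (1 / real n)
          = ennreal (real n * e + real n * (real n * e) * (1 / real n))"
      proof -
        have const: "(\<Sum>j\<in>J. ennreal r) = ennreal (real n * r)" if "r \<ge> 0" for r
          using that by (subst sum_ennreal) (auto simp: J_def)
        have "0 \<le> real n * e" using e by simp
        then show ?thesis
          unfolding const[OF less_imp_le[OF e]] const[OF \<open>0 \<le> real n * e\<close>] using e
          by (subst ennreal_mult[symmetric], simp, simp, subst ennreal_plus[symmetric]) simp_all
      qed
      also have "real n * e + real n * (real n * e) * (1 / real n) = 2 * real n * e" using n1 by simp
      finally show ?thesis by (simp add: add_mono mult_right_mono)
    qed
    define B where "B = {\<omega> \<in> space M. ennreal (\<epsilon> / 3 * (real n - 1)) \<le> S \<omega>}"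
    have B: "B \<in> sets M" unfolding B_def by measurable
    have B_prob: "prob B \<le> \<epsilon> / 2"
    proof -
      define c where "c = \<epsilon> / 3 * (real n - 1)"
      have c: "c > 0" using \<epsilon> n1 by (simp add: c_def)
      have "ennreal c * emeasure M B = (\<integral>\<^sup>+\<omega>. ennreal c * indicator B \<omega> \<partial>M)" using B by (simp add: nn_integral_cmult_indicator)
      also have "\<dots> \<le> (\<integral>\<^sup>+\<omega>. S \<omega> \<partial>M)"
        by (intro nn_integral_mono) (auto simp: B_def c_def indicator_def)
      also have "\<dots> \<le> ennreal (2 * real n * e)" by (rule S_int)
      finally have "ennreal (c * prob B) \<le> ennreal (2 * real n * e)"
        using c by (simp add: emeasure_eq_measure ennreal_mult)
      then have "c * prob B \<le> 2 * real n * e" using e by (subst (asm) ennreal_le_iff) auto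
      also have "\<dots> \<le> 4 * (real n - 1) * e" using n2 e by (intro mult_right_mono) auto
      also have "\<dots> = c * (\<epsilon> / 2)" by (simp add: c_def e_def power2_eq_square)
      finally show ?thesis using c by simp
    qed
    define A where "A h = {\<omega> \<in> space M. \<epsilon> / 3 \<le> \<bar>scov n \<omega> h - g h h\<bar>}" for h
    have A_meas: "A h \<in> sets M" if "h \<in> G" for h
    proof -
      have [measurable]: "(\<lambda>\<omega>. scov n \<omega> h) \<in> borel_measurable M" using that G by (intro scov_measurable) auto
      show ?thesis unfolding A_def by measurable
    qed
    have A_prob: "prob (A h) \<le> \<epsilon> / (2 * (real (card G) + 1))" if h: "h \<in> G" for h
    proof -
      have "prob (A h) \<le> expectation (\<lambda>\<omega>. \<bar>scov n \<omega> h - g h h\<bar>) / (\<epsilon> / 3)"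
        unfolding A_def by (rule integral_Markov_inequality_measure[where A="{}"])
          (use scov_consistent(2)[of h] h G \<epsilon> in auto)
      also have "\<dots> \<le> (\<epsilon> / (2 * (real (card G) + 1))) * (\<epsilon> / 3) / (\<epsilon> / 3)"
        using \<epsilon> by (intro divide_right_mono n0 h N0 n) auto
      also have "\<dots> = \<epsilon> / (2 * (real (card G) + 1))"
        by (rule nonzero_mult_div_cancel_right) (use \<epsilon> in simp)
      finally show ?thesis .
    qed
    have A_union: "prob (\<Union>h\<in>G. A h) \<le> \<epsilon> / 2"
    proof -
      have "prob (\<Union>h\<in>G. A h) \<le> (\<Sum>h\<in>G. prob (A h))"
        using A_meas G(1) by (intro finite_measure_subadditive_finite) auto
      also have "\<dots> \<le> (\<Sum>h\<in>G. \<epsilon> / (2 * (real (card G) + 1)))" by (intro sum_mono A_prob)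
      also have "\<dots> \<le> \<epsilon> / 2" using \<epsilon> by (simp add: field_simps)
      finally show ?thesis .
    qed
    \<comment> \<open>\<open>W_ae\<close> holds almost surely for each fixed time. Joint
      measurability of the paths allows the two quantifiers to be exchanged.\<close>
    have "AE \<omega> in M. AE t in lebesgue_on T. \<forall>j\<in>J. \<forall>k\<in>J. \<forall>h\<in>G. \<bar>t - h\<bar> < \<delta> \<longrightarrow> ennreal \<bar>w j k \<omega> t - w j k \<omega> h\<bar> \<le> W j k \<omega>"
    proof -
      have "finite_measure (lebesgue_on T)" using T by (intro finite_measure_lebesgue_on) simp
      then interpret L: finite_measure "lebesgue_on T" .
      interpret PL: pair_sigma_finite M "lebesgue_on T" ..
      have id_meas: "(\<lambda>t. t) \<in> borel_measurable (lebesgue_on T)"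
        by (rule measurable_restrict_space1) (rule measurable_completion, simp)
      have "AE \<omega> in M. AE t in lebesgue_on T. \<bar>t - h\<bar> < \<delta> \<longrightarrow> ennreal \<bar>w j k \<omega> t - w j k \<omega> h\<bar> \<le> W j k \<omega>"
        if j: "j \<in> J" and k: "k \<in> J" and h: "h \<in> G" for j k h
      proof -
        have jk: "j \<ge> 1" "k \<ge> 1" using j k by (auto simp: J_def)
        have hT: "h \<in> T" using h G by auto
        note [measurable] = w_joint_measurable[OF jk] W_meas[OF jk] w_measurable[OF jk hT] id_meas
        have [measurable]: "(\<lambda>x. w j k (fst x) (snd x)) \<in> borel_measurable (M \<Otimes>\<^sub>M lebesgue_on T)"
          using w_joint_measurable[OF jk] by (simp add: split_beta')
        have [measurable]: "(\<lambda>x. snd x) \<in> borel_measurable (M \<Otimes>\<^sub>M lebesgue_on T)"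
          using measurable_compose[OF measurable_snd id_meas] by simp
        have sets: "{x \<in> space (M \<Otimes>\<^sub>M lebesgue_on T). \<bar>snd x - h\<bar> < \<delta> \<longrightarrow>
            ennreal \<bar>w j k (fst x) (snd x) - w j k (fst x) h\<bar> \<le> W j k (fst x)} \<in> sets (M \<Otimes>\<^sub>M lebesgue_on T)"
          by measurable
        show ?thesis
        proof (rule PL.AE_commute[THEN iffD2], rule sets, rule AE_I2)
          fix t assume "t \<in> space (lebesgue_on T)"
          then have "t \<in> T" by simp
          then show "AE \<omega> in M. \<bar>t - h\<bar> < \<delta> \<longrightarrow> ennreal \<bar>w j k \<omega> t - w j k \<omega> h\<bar> \<le> W j k \<omega>"
            using W_ae[OF jk _ h, of t] by (cases "\<bar>t - h\<bar> < \<delta>") simp_all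
        qed
      qed
      then show ?thesis
        using G(1) by (simp add: AE_finite_all J_def del: atLeastAtMost_iff) 
    qed
    then obtain Z where Z: "{\<omega> \<in> space M. \<not> (AE t in lebesgue_on T. \<forall>j\<in>J. \<forall>k\<in>J. \<forall>h\<in>G. \<bar>t - h\<bar> < \<delta> \<longrightarrow>
        ennreal \<bar>w j k \<omega> t - w j k \<omega> h\<bar> \<le> W j k \<omega>)} \<subseteq> Z" "emeasure M Z = 0" "Z \<in> sets M"
      by (rule AE_E)
    define E where "E = B \<union> (\<Union>h\<in>G. A h) \<union> Z"
    have E: "E \<in> sets M" unfolding E_def by (intro sets.Un sets.finite_UN B A_meas Z(3) G(1))
    have "prob E \<le> prob (B \<union> (\<Union>h\<in>G. A h)) + prob Z"
      unfolding E_def by (intro measure_Un_le sets.Un sets.finite_UN B A_meas Z(3) G(1))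
    also have "prob Z = 0" using Z(2) by (simp add: measure_def)
    also have "prob (B \<union> (\<Union>h\<in>G. A h)) \<le> prob B + prob (\<Union>h\<in>G. A h)"
      by (intro measure_Un_le sets.finite_UN B A_meas G(1))
    finally have E_prob: "prob E \<le> \<epsilon>" using B_prob A_union by simp
    have close: "AE t in lebesgue_on T. \<bar>scov n \<omega> t - g t t\<bar> \<le> \<epsilon>" if \<omega>: "\<omega> \<in> space M - E" for \<omega>
    proof -
      have "AE t in lebesgue_on T. \<forall>j\<in>J. \<forall>k\<in>J. \<forall>h\<in>G. \<bar>t - h\<bar> < \<delta> \<longrightarrow>
        ennreal \<bar>w j k \<omega> t - w j k \<omega> h\<bar> \<le> W j k \<omega>" using \<omega> Z(1) by (auto simp: E_def)
      then show ?thesis using AE_space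
      proof eventually_elim
        case (elim t)
        then have t: "t \<in> T" by simp
        obtain h where h: "h \<in> G" "\<bar>t - h\<bar> < \<delta>" using G(3)[OF t] by blast
        have hT: "h \<in> T" using h G by auto
        define D where "D j k = \<bar>w j k \<omega> t - w j k \<omega> h\<bar>" for j k
        have DW: "ennreal (D j k) \<le> W j k \<omega>" if "j \<in> J" "k \<in> J" for j k
          using elim(1) that h unfolding D_def by blast
        define DS where "DS = (\<Sum>j\<in>J. D j j) + (\<Sum>j\<in>J. \<Sum>k\<in>J. D j k) * (1 / real n)"
        have DS0: "0 \<le> DS" unfolding DS_def D_def by (intro add_nonneg_nonneg mult_nonneg_nonneg sum_nonneg) auto
        have "ennreal DS = (\<Sum>j\<in>J. ennreal (D j j)) + (\<Sum>j\<in>J. \<Sum>k\<in>J. ennreal (D j k)) * ennreal (1 / real n)"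
        proof -
          have D0: "D j k \<ge> 0" for j k by (simp add: D_def)
          have s1: "(\<Sum>j\<in>J. ennreal (D j j)) = ennreal (\<Sum>j\<in>J. D j j)" by (rule sum_ennreal[OF D0])
          have s2: "(\<Sum>j\<in>J. \<Sum>k\<in>J. ennreal (D j k)) = ennreal (\<Sum>j\<in>J. \<Sum>k\<in>J. D j k)"
            by (simp add: sum_ennreal D0 sum_nonneg)
          have "ennreal ((\<Sum>j\<in>J. \<Sum>k\<in>J. D j k) * (1 / real n)) = ennreal (\<Sum>j\<in>J. \<Sum>k\<in>J. D j k) * ennreal (1 / real n)"
            by (rule ennreal_mult) (auto intro!: sum_nonneg D0)
          moreover have "ennreal DS = ennreal (\<Sum>j\<in>J. D j j) + ennreal ((\<Sum>j\<in>J. \<Sum>k\<in>J. D j k) * (1 / real n))"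
            unfolding DS_def by (rule ennreal_plus) (auto intro!: sum_nonneg divide_nonneg_nonneg D0)
          ultimately show ?thesis unfolding s1 s2 by simp
        qed
        also have "\<dots> \<le> S \<omega>" unfolding S_def by (intro add_mono mult_right_mono sum_mono DW) auto
        also have "\<dots> < ennreal (\<epsilon> / 3 * (real n - 1))" using \<omega> by (auto simp: E_def B_def)
        finally have DS: "DS < \<epsilon> / 3 * (real n - 1)" using DS0 by (simp add: ennreal_less_iff)
        have sc: "scov n \<omega> s = ((\<Sum>j\<in>J. w j j \<omega> s) - (\<Sum>j\<in>J. \<Sum>k\<in>J. w j k \<omega> s) * (1 / real n)) / (real n - 1)" for s
          unfolding scov_eq[OF n1(3)] J_def w_def by (simp add: power2_eq_square sum_product)
        have "scov n \<omega> t - scov n \<omega> h = ((\<Sum>j\<in>J. w j j \<omega> t - w j j \<omega> h)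
            - (\<Sum>j\<in>J. \<Sum>k\<in>J. w j k \<omega> t - w j k \<omega> h) * (1 / real n)) / (real n - 1)"
          unfolding sc by (simp add: sum_subtractf diff_divide_distrib)
        also have "\<bar>\<dots>\<bar> \<le> DS / (real n - 1)"
        proof -
          have "\<bar>\<Sum>j\<in>J. w j j \<omega> t - w j j \<omega> h\<bar> \<le> (\<Sum>j\<in>J. D j j)"
            unfolding D_def by (rule sum_abs)
          moreover have "\<bar>\<Sum>j\<in>J. \<Sum>k\<in>J. w j k \<omega> t - w j k \<omega> h\<bar> \<le> (\<Sum>j\<in>J. \<Sum>k\<in>J. D j k)"
            unfolding D_def by (rule order_trans[OF sum_abs sum_mono[OF sum_abs]])
          then have "\<bar>(\<Sum>j\<in>J. \<Sum>k\<in>J. w j k \<omega> t - w j k \<omega> h) * (1 / real n)\<bar> \<le> (\<Sum>j\<in>J. \<Sum>k\<in>J. D j k) * (1 / real n)"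
            using n1 by (simp add: abs_mult divide_right_mono)
          ultimately have "\<bar>(\<Sum>j\<in>J. w j j \<omega> t - w j j \<omega> h) - (\<Sum>j\<in>J. \<Sum>k\<in>J. w j k \<omega> t - w j k \<omega> h) * (1 / real n)\<bar> \<le> DS"
            unfolding DS_def by linarith
          then show ?thesis using n1 by (simp add: abs_divide divide_right_mono)
        qed
        also have "DS / (real n - 1) \<le> \<epsilon> / 3" using DS n1 by (simp add: pos_divide_le_eq)
        finally have 1: "\<bar>scov n \<omega> t - scov n \<omega> h\<bar> \<le> \<epsilon> / 3" .
        have 2: "\<bar>scov n \<omega> h - g h h\<bar> < \<epsilon> / 3" using \<omega> h by (auto simp: E_def A_def not_le)
        have 3: "\<bar>g t t - g h h\<bar> < \<epsilon> / 3" using d(2)[OF hT t] h(2) \<delta>(2) by simp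
        show ?case using 1 2 3 by linarith
      qed
    qed
    show "\<exists>E\<in>sets M. prob E \<le> \<epsilon> \<and> (\<forall>\<omega>\<in>space M - E. AE t in lebesgue_on T. \<bar>scov n \<omega> t - g t t\<bar> \<le> \<epsilon>)"
      using E E_prob close by blast
  qed
qed

end
end

section \<open>Slutsky's theorem for outer expectations\<close>

lemma ereal_expectation_mono:
  assumes "\<And>\<omega>. \<omega> \<in> space M \<Longrightarrow> U \<omega> \<le> V \<omega>"
  shows "ereal_expectation M U \<le> ereal_expectation M V"
  unfolding ereal_expectation_def
proof (rule ereal_minus_mono)
  show "enn2ereal (\<integral>\<^sup>+ \<omega>. e2ennreal (U \<omega>) \<partial>M) \<le> enn2ereal (\<integral>\<^sup>+ \<omega>. e2ennreal (V \<omega>) \<partial>M)"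
    unfolding less_eq_ennreal.rep_eq[symmetric] by (intro nn_integral_mono e2ennreal_mono assms)
  show "enn2ereal (\<integral>\<^sup>+ \<omega>. e2ennreal (- V \<omega>) \<partial>M) \<le> enn2ereal (\<integral>\<^sup>+ \<omega>. e2ennreal (- U \<omega>) \<partial>M)"
    unfolding less_eq_ennreal.rep_eq[symmetric] by (intro nn_integral_mono e2ennreal_mono) (simp add: assms)
qed

lemma ereal_expectation_real:
  assumes "integrable M f"
  shows "ereal_expectation M (\<lambda>\<omega>. ereal (f \<omega>)) = ereal (\<integral>\<omega>. f \<omega> \<partial>M)"
    and "ereal_expectation_exists M (\<lambda>\<omega>. ereal (f \<omega>))"
proof -
  have fin: "(\<integral>\<^sup>+ \<omega>. ennreal (f \<omega>) \<partial>M) < \<infinity>" "(\<integral>\<^sup>+ \<omega>. ennreal (- f \<omega>) \<partial>M) < \<infinity>"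
    using assms by (auto simp: real_integrable_def less_top)
  then obtain a b where ab: "(\<integral>\<^sup>+ \<omega>. ennreal (f \<omega>) \<partial>M) = ennreal a" "a \<ge> 0"
      "(\<integral>\<^sup>+ \<omega>. ennreal (- f \<omega>) \<partial>M) = ennreal b" "b \<ge> 0"
    by (metis ennreal_cases infinity_ennreal_def less_irrefl)
  show "ereal_expectation M (\<lambda>\<omega>. ereal (f \<omega>)) = ereal (\<integral>\<omega>. f \<omega> \<partial>M)"
    using ab by (simp add: ereal_expectation_def real_lebesgue_integral_def[OF assms] enn2ereal_ennreal)
  show "ereal_expectation_exists M (\<lambda>\<omega>. ereal (f \<omega>))" using fin by (simp add: ereal_expectation_exists_def)
qed

lemma outer_expectation_le:
  assumes "integrable M g" "\<And>\<omega>. \<omega> \<in> space M \<Longrightarrow> f \<omega> \<le> g \<omega>"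
  shows "outer_expectation M (\<lambda>\<omega>. ereal (f \<omega>)) \<le> ereal (\<integral>\<omega>. g \<omega> \<partial>M)"
  unfolding outer_expectation_def
proof (rule Inf_lower, safe)
  show "\<exists>U. ereal (\<integral>\<omega>. g \<omega> \<partial>M) = ereal_expectation M U \<and> U \<in> borel_measurable M \<and>
      ereal_expectation_exists M U \<and> (\<forall>\<omega>\<in>space M. ereal (f \<omega>) \<le> U \<omega>)"
    using assms by (intro exI[of _ "\<lambda>\<omega>. ereal (g \<omega>)"]) (auto simp: ereal_expectation_real)
qed

lemma outer_expectation_ge:
  assumes "integrable M g" "\<And>\<omega>. \<omega> \<in> space M \<Longrightarrow> g \<omega> \<le> f \<omega>"
  shows "ereal (\<integral>\<omega>. g \<omega> \<partial>M) \<le> outer_expectation M (\<lambda>\<omega>. ereal (f \<omega>))"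
  unfolding outer_expectation_def
proof (rule Inf_greatest, safe)
  fix U assume U: "\<forall>\<omega>\<in>space M. ereal (f \<omega>) \<le> U \<omega>"
  show "ereal (\<integral>\<omega>. g \<omega> \<partial>M) \<le> ereal_expectation M U"
    unfolding ereal_expectation_real(1)[OF assms(1), symmetric]
    by (rule ereal_expectation_mono) (use U assms(2) in \<open>meson ereal_less_eq(3) order_trans\<close>)
qed

text \<open>\<open>S l\<close> may be non-measurable, but \<open>f (S l)\<close> lies between
  \<open>f (Q l) - R\<close> and \<open>f (Q l) + R\<close> with \<open>R\<close> integrable, which
  encloses its outer expectation between ordinary integrals. Off the exceptional set
  \<open>R\<close> comes from the modulus and the relative error; on it, from the trivial bound
  \<open>2 * B\<close>.\<close>

lemma outer_slutsky:
  fixes S Q :: "nat \<Rightarrow> 'w \<Rightarrow> real" and f :: "real \<Rightarrow> real"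
  assumes M: "prob_space M"
    and Q: "\<And>l. integrable M (Q l)" "\<And>l. AE \<omega> in M. 0 \<le> Q l \<omega>" "\<And>l. (\<integral>\<omega>. Q l \<omega> \<partial>M) \<le> C" and C: "C \<ge> 0"
    and approx: "\<And>\<epsilon>. \<epsilon> > 0 \<Longrightarrow> \<forall>\<^sub>F l in sequentially. \<exists>E\<in>sets M. measure M E \<le> \<epsilon> \<and>
        (\<forall>\<omega>\<in>space M - E. \<bar>S l \<omega> - Q l \<omega>\<bar> \<le> \<epsilon> * \<bar>Q l \<omega>\<bar>)"
    and f: "continuous_on UNIV f" "bounded (range f)"
    and conv: "(\<lambda>l. \<integral>\<omega>. f (Q l \<omega>) \<partial>M) \<longlonglongrightarrow> y"
  shows "(\<lambda>l. outer_expectation M (\<lambda>\<omega>. ereal (f (S l \<omega>)))) \<longlonglongrightarrow> ereal y"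
proof -
  interpret M: prob_space M by fact
  obtain B where B: "B > 0" "\<And>x. \<bar>f x\<bar> \<le> B"
    using f(2) unfolding bounded_pos by auto
  have f_meas[measurable]: "f \<in> borel_measurable borel"
    by (rule borel_measurable_continuous_onI[OF f(1)])
  \<comment> \<open>The outer expectation lies between \<open>- B\<close> and \<open>B\<close>, so
    nothing is lost by passing to a real number.\<close>
  define r where "r l = real_of_ereal (outer_expectation M (\<lambda>\<omega>. ereal (f (S l \<omega>))))" for l
  have r: "outer_expectation M (\<lambda>\<omega>. ereal (f (S l \<omega>))) = ereal (r l)" for l
  proof -
    have "f (S l \<omega>) \<le> B" "- B \<le> f (S l \<omega>)" for \<omega> using B(2)[of "S l \<omega>"] by auto
    then have "outer_expectation M (\<lambda>\<omega>. ereal (f (S l \<omega>))) \<le> ereal (\<integral>\<omega>. B \<partial>M)"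
      "ereal (\<integral>\<omega>. - B \<partial>M) \<le> outer_expectation M (\<lambda>\<omega>. ereal (f (S l \<omega>)))"
      by (intro outer_expectation_le outer_expectation_ge; simp)+
    then show ?thesis unfolding r_def
      by (cases "outer_expectation M (\<lambda>\<omega>. ereal (f (S l \<omega>)))") auto
  qed
  have fQ: "integrable M (\<lambda>\<omega>. f (Q l \<omega>))" for l
    by (rule M.integrable_const_bound[where B=B]) (use B Q(1) in auto)
  have close: "\<forall>\<^sub>F l in sequentially. \<bar>r l - (\<integral>\<omega>. f (Q l \<omega>) \<partial>M)\<bar> \<le> \<eta>" if \<eta>: "\<eta> > 0" for \<eta>
  proof -
    define e where "e = \<eta> / (3 * (1 + C))"
    have e: "e > 0" using \<eta> C by (simp add: e_def)
    obtain \<kappa> where \<kappa>: "\<kappa> \<ge> 0" "\<And>x y. \<bar>f x - f y\<bar> \<le> e * (1 + \<bar>x\<bar>) + \<kappa> * \<bar>x - y\<bar>"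
      using bounded_continuous_modulus[OF f e] by blast
    \<comment> \<open>The mean of \<open>R\<close> has three parts, each at most a third of
      \<open>\<eta>\<close>: \<open>e * (1 + C)\<close>, \<open>\<kappa> * \<epsilon> * C\<close>
      and \<open>2 * B * \<epsilon>\<close>.\<close>
    define \<epsilon> where "\<epsilon> = min (\<eta> / (3 * (\<kappa> * C + 1))) (\<eta> / (6 * B))"
    have kC: "\<kappa> * C + 1 > 0" using \<kappa> C by (smt (verit) mult_nonneg_nonneg)
    have \<epsilon>: "\<epsilon> > 0" using \<eta> B kC by (simp add: \<epsilon>_def)
    have \<epsilon>1: "\<kappa> * \<epsilon> * C \<le> \<eta> / 3"
    proof -
      have "\<kappa> * \<epsilon> * C \<le> (\<kappa> * C + 1) * \<epsilon>" using \<epsilon> by (simp add: algebra_simps)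
      also have "\<dots> \<le> (\<kappa> * C + 1) * (\<eta> / (3 * (\<kappa> * C + 1)))"
        using kC by (intro mult_left_mono) (auto simp: \<epsilon>_def)
      also have "\<dots> = \<eta> / 3" using kC by (simp add: field_simps)
      finally show ?thesis .
    qed
    have \<epsilon>2: "2 * B * \<epsilon> \<le> \<eta> / 3"
    proof -
      have "2 * B * \<epsilon> \<le> 2 * B * (\<eta> / (6 * B))" using B by (intro mult_left_mono) (auto simp: \<epsilon>_def)
      also have "\<dots> = \<eta> / 3" using B by simp
      finally show ?thesis .
    qed
    from approx[OF \<epsilon>] show ?thesis
    proof eventually_elim
      case (elim l)
      then obtain E where E: "E \<in> sets M" "measure M E \<le> \<epsilon>"
        "\<And>\<omega>. \<omega> \<in> space M - E \<Longrightarrow> \<bar>S l \<omega> - Q l \<omega>\<bar> \<le> \<epsilon> * \<bar>Q l \<omega>\<bar>" by blast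
      define R where "R \<omega> = e * (1 + \<bar>Q l \<omega>\<bar>) + \<kappa> * (\<epsilon> * \<bar>Q l \<omega>\<bar>) + 2 * B * indicator E \<omega>" for \<omega>
      have R_int: "integrable M R" unfolding R_def using Q(1)[of l] E(1) by (auto simp: M.emeasure_eq_measure)
      have EQ: "(\<integral>\<omega>. \<bar>Q l \<omega>\<bar> \<partial>M) \<le> C"
      proof -
        have "(\<integral>\<omega>. \<bar>Q l \<omega>\<bar> \<partial>M) = (\<integral>\<omega>. Q l \<omega> \<partial>M)"
          by (rule integral_cong_AE) (use Q(1)[of l] Q(2)[of l] in auto)
        then show ?thesis using Q(3) by simp
      qed
      have "(\<integral>\<omega>. R \<omega> \<partial>M) = e * (1 + (\<integral>\<omega>. \<bar>Q l \<omega>\<bar> \<partial>M)) + \<kappa> * (\<epsilon> * (\<integral>\<omega>. \<bar>Q l \<omega>\<bar> \<partial>M)) + 2 * B * measure M E"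
        unfolding R_def using Q(1)[of l] E(1) by (simp add: M.emeasure_eq_measure M.prob_space)
      also have "\<dots> \<le> e * (1 + C) + \<kappa> * (\<epsilon> * C) + 2 * B * \<epsilon>"
        using EQ E(2) e \<kappa>(1) \<epsilon> B by (intro add_mono mult_left_mono) auto
      also have "e * (1 + C) = \<eta> / 3"
      proof -
        have "\<eta> / (3 * W) * W = \<eta> / 3" if "W \<noteq> 0" for W using that by (simp add: field_simps)
        from this[of "1 + C"] show ?thesis unfolding e_def using C by auto
      qed
      finally have R: "(\<integral>\<omega>. R \<omega> \<partial>M) \<le> \<eta>" using \<epsilon>1 \<epsilon>2 by (simp add: mult.assoc)
      have fS: "\<bar>f (Q l \<omega>) - f (S l \<omega>)\<bar> \<le> R \<omega>" if \<omega>: "\<omega> \<in> space M" for \<omega>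
      proof (cases "\<omega> \<in> E")
        case True
        have "\<bar>f (Q l \<omega>) - f (S l \<omega>)\<bar> \<le> 2 * B" using B(2)[of "Q l \<omega>"] B(2)[of "S l \<omega>"] by linarith
        moreover have "0 \<le> e * (1 + \<bar>Q l \<omega>\<bar>)" "0 \<le> \<kappa> * (\<epsilon> * \<bar>Q l \<omega>\<bar>)" using e \<kappa>(1) \<epsilon> by auto
        ultimately show ?thesis using True by (simp add: R_def)
      next
        case False
        have "\<kappa> * \<bar>Q l \<omega> - S l \<omega>\<bar> \<le> \<kappa> * (\<epsilon> * \<bar>Q l \<omega>\<bar>)"
          using E(3)[of \<omega>] False \<omega> \<kappa>(1) by (intro mult_left_mono) (auto simp: abs_minus_commute)
        then show ?thesis using \<kappa>(2)[of "Q l \<omega>" "S l \<omega>"] False by (simp add: R_def)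
      qed
      have "outer_expectation M (\<lambda>\<omega>. ereal (f (S l \<omega>))) \<le> ereal (\<integral>\<omega>. f (Q l \<omega>) + R \<omega> \<partial>M)"
        by (intro outer_expectation_le Bochner_Integration.integrable_add fQ R_int)
           (use fS in \<open>auto simp: abs_le_iff algebra_simps\<close>)
      then have up: "r l \<le> (\<integral>\<omega>. f (Q l \<omega>) \<partial>M) + (\<integral>\<omega>. R \<omega> \<partial>M)" unfolding r using fQ R_int by simp
      have "ereal (\<integral>\<omega>. f (Q l \<omega>) - R \<omega> \<partial>M) \<le> outer_expectation M (\<lambda>\<omega>. ereal (f (S l \<omega>)))"
        by (intro outer_expectation_ge Bochner_Integration.integrable_diff fQ R_int)
           (use fS in \<open>auto simp: abs_le_iff algebra_simps\<close>)
      then have low: "(\<integral>\<omega>. f (Q l \<omega>) \<partial>M) - (\<integral>\<omega>. R \<omega> \<partial>M) \<le> r l" unfolding r using fQ R_int by simp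
      show ?case using up low R by (simp add: abs_le_iff)
    qed
  qed
  have "(\<lambda>l. r l - (\<integral>\<omega>. f (Q l \<omega>) \<partial>M)) \<longlonglongrightarrow> 0"
  proof (rule tendstoI)
    fix \<eta> :: real assume "\<eta> > 0"
    then have "\<forall>\<^sub>F l in sequentially. \<bar>r l - (\<integral>\<omega>. f (Q l \<omega>) \<partial>M)\<bar> \<le> \<eta> / 2" by (intro close) simp
    then show "\<forall>\<^sub>F l in sequentially. dist (r l - (\<integral>\<omega>. f (Q l \<omega>) \<partial>M)) 0 < \<eta>"
      by eventually_elim (use \<open>\<eta> > 0\<close> in \<open>simp add: dist_real_def\<close>)
  qed
  from tendsto_add[OF this conv] have "r \<longlonglongrightarrow> y" by simp
  then show ?thesis unfolding r lim_ereal .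
qed

section \<open>Measurable dependence of the pseudoinverse on the diagonal\<close>

context
  fixes H :: "real^'k::finite^'r::finite"
begin

text \<open>\<open>H ** K\<close> is the orthogonal projection onto the range of \<open>H\<close>, so that the pseudoinverse is determined
  by its quadratic form on this range.\<close>

lemma pinv_gram_factor:
  assumes d: "\<And>i. d i > 0"
  defines "K \<equiv> diag_matrix (\<lambda>_. 1) ** transpose H ** pinv (gram H (\<lambda>_. 1))"
  shows "x \<bullet> (pinv (gram H d) *v y) = (H *v (K *v x)) \<bullet> (pinv (gram H d) *v (H *v (K *v y)))"
proof -
  define S where "S = gram H (\<lambda>_. 1)"
  define A where "A = pinv (gram H d)"
  note S = symmetric_pinv[OF transpose_gram[of H "\<lambda>_. 1"], folded S_def]
  note A = symmetric_pinv[OF transpose_gram[of H d], folded A_def]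
  have HK: "H *v (K *v w) = S *v (pinv S *v w)" for w
    by (simp add: K_def S_def matrix_vector_mul_assoc matrix_mul_assoc)
  have PH: "S *v (pinv S *v (H *v u)) = H *v u" for u
  proof -
    obtain p where p: "H *v u = S *v p" using gram_range[of "\<lambda>_. 1" H u] unfolding S_def by auto
    have "S *v (pinv S *v (S *v p)) = (S ** pinv S ** S) *v p" by (simp add: matrix_vector_mul_assoc matrix_mul_assoc)
    then show ?thesis using S(1) by (simp add: p pinv_rel_def)
  qed
  \<comment> \<open>Since \<open>A\<close> commutes with the symmetric Gram matrix, \<open>A\<close>
    equals the Gram matrix times \<open>A ** A\<close>. Its range therefore lies in that of
    \<open>H\<close>, where the projection acts as the identity.\<close>
  have PA: "S *v (pinv S *v (A *v w)) = A *v w" for w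
  proof -
    have "A = A ** gram H d ** A" using A(1) by (simp add: pinv_rel_def)
    also have "A ** gram H d = gram H d ** A" using A(3) by simp
    finally have "A *v w = H *v ((diag_matrix d ** transpose H ** A ** A) *v w)"
      by (metis matrix_mul_assoc matrix_vector_mul_assoc)
    then show ?thesis using PH by metis
  qed
  have symP: "(S *v (pinv S *v a)) \<bullet> b = a \<bullet> (S *v (pinv S *v b))" for a b
  proof -
    have "transpose (S ** pinv S) = S ** pinv S" using S(1) by (simp add: pinv_rel_def)
    then have "((S ** pinv S) *v a) \<bullet> b = a \<bullet> ((S ** pinv S) *v b)" by (simp add: inner_transpose_mult)
    then show ?thesis by (simp add: matrix_vector_mul_assoc)
  qed
  have symA: "(A *v a) \<bullet> b = a \<bullet> (A *v b)" for a b
    using A(2) by (simp add: inner_transpose_mult)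
  have "(H *v (K *v x)) \<bullet> (A *v (H *v (K *v y))) = x \<bullet> (A *v (S *v (pinv S *v y)))"
    unfolding HK symP PA ..
  also have "\<dots> = (A *v x) \<bullet> (S *v (pinv S *v y))" by (simp add: symA)
  also have "\<dots> = (A *v x) \<bullet> y" by (metis PA symP)
  also have "\<dots> = x \<bullet> (A *v y)" by (rule symA)
  finally show ?thesis unfolding A_def ..
qed

text \<open>In logarithmic coordinates the positive diagonals fill the whole space, and a small
  additive change of \<open>s\<close> is a small relative change of the diagonal, just as
  \<open>pinv_gram_relative_error\<close> demands.\<close>

lemma continuous_pinv_gram_exp:
  "continuous_on UNIV (\<lambda>s::real^'k. (H *v u) \<bullet> (pinv (gram H (\<lambda>i. exp (s $ i))) *v (H *v u)))"
  unfolding continuous_on_iff dist_real_def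
proof (intro ballI allI impI)
  fix s :: "real^'k" and \<eta> :: real assume \<eta>: "\<eta> > 0"
  define q where "q s = (H *v u) \<bullet> (pinv (gram H (\<lambda>i. exp (s $ i))) *v (H *v u))" for s :: "real^'k"
  have q0: "q s \<ge> 0" unfolding q_def by (rule pinv_gram_nonneg) simp
  \<comment> \<open>The denominator contains \<open>q s + 1\<close> so that the case of a vanishing
    form is included.\<close>
  define \<epsilon> where "\<epsilon> = min (1/2) (\<eta> / (4 * (q s + 1)))"
  have \<epsilon>: "\<epsilon> > 0" "\<epsilon> \<le> 1/2" using \<eta> q0 unfolding \<epsilon>_def by (simp, simp only: min.cobounded1)
  have "isCont exp (0::real)" by simp
  then obtain \<delta> where \<delta>: "\<delta> > 0" "\<And>x::real. \<bar>x\<bar> < \<delta> \<Longrightarrow> \<bar>exp x - 1\<bar> < \<epsilon>"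
    using \<epsilon>(1) unfolding continuous_at_eps_delta by (auto simp: dist_real_def)
  have "\<bar>q s' - q s\<bar> < \<eta>" if "dist s' s < \<delta>" for s'
  proof -
    have "\<bar>exp (s' $ i) - exp (s $ i)\<bar> \<le> \<epsilon> * exp (s $ i)" for i
    proof -
      have "\<bar>s' $ i - s $ i\<bar> < \<delta>" using dist_vec_nth_le[of s' i s] that by (simp add: dist_real_def)
      from \<delta>(2)[OF this] have "\<bar>exp (s' $ i - s $ i) - 1\<bar> * exp (s $ i) \<le> \<epsilon> * exp (s $ i)"
        by (intro mult_right_mono) auto
      also have "\<bar>exp (s' $ i - s $ i) - 1\<bar> * exp (s $ i) = \<bar>(exp (s' $ i - s $ i) - 1) * exp (s $ i)\<bar>"
        by (simp add: abs_mult)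
      also have "(exp (s' $ i - s $ i) - 1) * exp (s $ i) = exp (s' $ i) - exp (s $ i)"
        by (simp add: left_diff_distrib exp_add[symmetric])
      finally show ?thesis .
    qed
    then have "\<bar>q s' - q s\<bar> \<le> 2 * \<epsilon> * q s"
      unfolding q_def using \<epsilon> by (intro pinv_gram_relative_error) auto
    also have "\<dots> \<le> 2 * (\<eta> / (4 * (q s + 1))) * q s"
      using q0 by (intro mult_right_mono mult_left_mono) (auto simp: \<epsilon>_def)
    also have "\<dots> < \<eta>" using q0 \<eta> by (auto simp: field_simps intro!: add_pos_nonneg)
    finally show ?thesis .
  qed
  then show "\<exists>\<delta>>0. \<forall>s'\<in>UNIV. dist s' s < \<delta> \<longrightarrow>
      \<bar>(H *v u) \<bullet> (pinv (gram H (\<lambda>i. exp (s' $ i))) *v (H *v u)) -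
       (H *v u) \<bullet> (pinv (gram H (\<lambda>i. exp (s $ i))) *v (H *v u))\<bar> < \<eta>"
    unfolding q_def using \<delta>(1) by blast
qed

text \<open>The quadratic form at \<open>H *v u\<close> is a continuous function of the logarithms
  of the weights. Polarization then gives the entries, because the projection \<open>H ** K\<close>
  reduces arbitrary vectors to the range of \<open>H\<close>.\<close>

lemma pinv_gram_measurable:
  fixes d :: "'t \<Rightarrow> 'k \<Rightarrow> real"
  assumes d: "\<And>i. (\<lambda>t. d t i) \<in> borel_measurable L" and pos: "\<And>t i. t \<in> space L \<Longrightarrow> d t i > 0"
  shows "(\<lambda>t. pinv (gram H (d t)) $ p $ q) \<in> borel_measurable L"
proof -
  define Q where "Q u t = (H *v u) \<bullet> (pinv (gram H (d t)) *v (H *v u))" for u t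
  have Q: "Q u \<in> borel_measurable L" for u
  proof -
    have m1: "(\<lambda>t. (H *v u) \<bullet> (pinv (gram H (\<lambda>i. exp ((\<chi> i. ln (d t i)) $ i))) *v (H *v u))) \<in> borel_measurable L"
    proof (rule measurable_compose[OF _ borel_measurable_continuous_onI[OF continuous_pinv_gram_exp]])
      show "(\<lambda>t. (\<chi> i. ln (d t i))) \<in> borel_measurable L"
        using d by (subst borel_measurable_euclidean_space) (auto simp: Basis_vec_def inner_axis)
    qed
    have eq: "(H *v u) \<bullet> (pinv (gram H (\<lambda>i. exp ((\<chi> i. ln (d t i)) $ i))) *v (H *v u)) = Q u t" if "t \<in> space L" for t
      using pos[OF that] by (simp add: Q_def)
    show ?thesis by (rule iffD1[OF measurable_cong[OF eq] m1])
  qed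
  define K where "K = diag_matrix (\<lambda>_. 1) ** transpose H ** pinv (gram H (\<lambda>_. 1))"
  have "pinv (gram H (d t)) $ p $ q
      = (Q (K *v axis p 1 + K *v axis q 1) t - Q (K *v axis p 1 - K *v axis q 1) t) / 4" if t: "t \<in> space L" for t
  proof -
    define A where "A = pinv (gram H (d t))"
    have sym: "(A *v a) \<bullet> b = a \<bullet> (A *v b)" for a b
      using symmetric_pinv(2)[OF transpose_gram[of H "d t"]] by (simp add: inner_transpose_mult A_def)
    have pol: "a \<bullet> (A *v b) = ((a + b) \<bullet> (A *v (a + b)) - (a - b) \<bullet> (A *v (a - b))) / 4" for a b
    proof -
      have "b \<bullet> (A *v a) = a \<bullet> (A *v b)" by (metis sym inner_commute)
      then show ?thesis
        by (simp add: matrix_vector_right_distrib matrix_vector_mult_diff_distrib inner_add_left inner_add_right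
            inner_diff_left inner_diff_right)
    qed
    have "A $ p $ q = axis p 1 \<bullet> (A *v axis q 1)"
      by (simp add: matrix_vector_mult_basis column_def inner_axis')
    also have "\<dots> = (H *v (K *v axis p 1)) \<bullet> (A *v (H *v (K *v axis q 1)))"
      unfolding A_def K_def by (rule pinv_gram_factor) (rule pos[OF t])
    finally show ?thesis unfolding Q_def A_def[symmetric] pol[of "H *v (K *v axis p 1)"]
      by (simp add: matrix_vector_right_distrib matrix_vector_mult_diff_distrib)
  qed
  then show ?thesis
    by (subst measurable_cong, assumption) (intro borel_measurable_divide borel_measurable_diff Q borel_measurable_const)
qed

end

section \<open>Quadratic forms in a Gaussian process\<close>

lemma gram_bilinear:
  fixes H :: "real^'k::finite^'r::finite"
  shows "p \<bullet> (gram H d *v q) = (\<Sum>i\<in>UNIV. d i * ((transpose H *v p) $ i * (transpose H *v q) $ i))"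
proof -
  have "p \<bullet> (gram H d *v q) = (transpose H *v p) \<bullet> (diag_matrix d *v (transpose H *v q))"
    by (simp add: inner_transpose_mult matrix_vector_mul_assoc[symmetric])
  then show ?thesis by (simp add: inner_vec_def diag_matrix_mult_vec mult_ac)
qed

lemma inner_mult_sum: "x \<bullet> (B *v y) = (\<Sum>p\<in>UNIV. \<Sum>q\<in>UNIV. B $ p $ q * (x $ p * y $ q))"
  for B :: "real^'n^'m"
  by (simp add: inner_vec_def matrix_vector_mult_def sum_distrib_left mult_ac)

locale centered_gaussian = prob_space N for N :: "'v measure" +
  fixes T :: "real set" and \<Gamma> :: "real \<Rightarrow> real \<Rightarrow> real^'r^'r" and z :: "'v \<Rightarrow> real \<Rightarrow> real^'r::finite"
  assumes z: "centered_gaussian_process N T \<Gamma> z"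
begin

lemma linear_combination:
  assumes "finite F" "F \<subseteq> T"
  shows "gaussian_variable N (\<lambda>v. \<Sum>t\<in>F. a t \<bullet> z v t)"
proof -
  have "\<forall>F a. finite F \<longrightarrow> F \<subseteq> T \<longrightarrow> gaussian_variable N (\<lambda>v. \<Sum>t\<in>F. a t \<bullet> z v t)"
    by (rule z[unfolded centered_gaussian_process_def, THEN conjunct2, THEN conjunct1])
  from this[rule_format, OF assms] show ?thesis .
qed

lemma gaussian_component: "t \<in> T \<Longrightarrow> gaussian_variable N (\<lambda>v. z v t $ p)"
proof -
  assume t: "t \<in> T"
  have "gaussian_variable N (\<lambda>v. \<Sum>t\<in>{t}. (\<lambda>_. axis p 1) t \<bullet> z v t)"
    by (rule linear_combination) (use t in auto)
  then show ?thesis by (simp add: inner_axis')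
qed

lemma component:
  assumes t: "t \<in> T"
  shows "(\<lambda>v. z v t $ p) \<in> borel_measurable N" "integrable N (\<lambda>v. (z v t $ p)\<^sup>2)" "integrable N (\<lambda>v. z v t $ p)"
    "(\<integral>v. z v t $ p \<partial>N) = 0"
  using gaussian_component[OF t, of p] gaussian_variable_integrable[OF prob_space_axioms gaussian_component[OF t, of p]] z t
  by (auto simp: gaussian_variable_def centered_gaussian_process_def)

lemma vector_measurable: "t \<in> T \<Longrightarrow> (\<lambda>v. z v t) \<in> borel_measurable N"
  using component(1) by (subst borel_measurable_euclidean_space) (auto simp: Basis_vec_def inner_axis)

lemma product:
  assumes "t \<in> T" "s \<in> T"
  shows "integrable N (\<lambda>v. z v t $ p * z v s $ q)" "(\<integral>v. z v t $ p * z v s $ q \<partial>N) = \<Gamma> t s $ p $ q"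
proof -
  show "integrable N (\<lambda>v. z v t $ p * z v s $ q)"
    by (rule integrable_mult_of_squares) (use component assms in auto)
  have "covariance N (\<lambda>v. z v t $ p) (\<lambda>v. z v s $ q) = \<Gamma> t s $ p $ q"
    using z assms by (auto simp: centered_gaussian_process_def)
  then show "(\<integral>v. z v t $ p * z v s $ q \<partial>N) = \<Gamma> t s $ p $ q"
    using component(4) assms by (simp add: covariance_def)
qed

lemma quadratic:
  assumes "t \<in> T" "s \<in> T"
  shows "integrable N (\<lambda>v. z v t \<bullet> (B *v z v s))"
    "(\<integral>v. z v t \<bullet> (B *v z v s) \<partial>N) = (\<Sum>p\<in>UNIV. \<Sum>q\<in>UNIV. B $ p $ q * \<Gamma> t s $ p $ q)"
  unfolding inner_mult_sum using product[OF assms] by auto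

text \<open>The double sum is written exactly as in \<open>characteristic_function_lim\<close>, so
  the limits of the finite-dimensional distributions match without further rewriting.\<close>

lemma characteristic_function:
  assumes F: "finite F" "F \<subseteq> T"
  shows "(\<integral>v. cis (\<Sum>t\<in>F. a t \<bullet> z v t) \<partial>N)
    = complex_of_real (exp (- (\<Sum>t\<in>F. \<Sum>s\<in>F. a t \<bullet> (\<Gamma> t s *v a s)) / 2))"
proof -
  have int1: "integrable N (\<lambda>v. a t \<bullet> z v t)" if "t \<in> F" for t
    using component(3) that F(2) by (auto simp: inner_vec_def)
  have gv: "gaussian_variable N (\<lambda>v. \<Sum>t\<in>F. a t \<bullet> z v t)"
    by (rule linear_combination[OF F])
  have mean: "(\<integral>v. (\<Sum>t\<in>F. a t \<bullet> z v t) \<partial>N) = 0"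
  proof -
    have "(\<integral>v. a t \<bullet> z v t \<partial>N) = 0" if "t \<in> F" for t
      using component(3,4) that F(2) by (auto simp: inner_vec_def subset_iff)
    then show ?thesis using int1 by simp
  qed
  have "(\<integral>v. (\<Sum>t\<in>F. a t \<bullet> z v t)\<^sup>2 \<partial>N) = (\<integral>v. (\<Sum>t\<in>F. \<Sum>s\<in>F. \<Sum>p\<in>UNIV. \<Sum>q\<in>UNIV. (a t $ p * a s $ q) * (z v t $ p * z v s $ q)) \<partial>N)"
    by (simp add: power2_eq_square sum_product inner_vec_def mult_ac)
  also have "\<dots> = (\<Sum>t\<in>F. \<Sum>s\<in>F. \<Sum>p\<in>UNIV. \<Sum>q\<in>UNIV. (a t $ p * a s $ q) * \<Gamma> t s $ p $ q)"
  proof -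
    have i: "integrable N (\<lambda>v. (a t $ p * a s $ q) * (z v t $ p * z v s $ q))" if "t \<in> F" "s \<in> F" for t s p q
      by (intro Bochner_Integration.integrable_mult_right product(1)) (use that F(2) in auto)
    have "(\<integral>v. (\<Sum>t\<in>F. \<Sum>s\<in>F. \<Sum>p\<in>UNIV. \<Sum>q\<in>UNIV. (a t $ p * a s $ q) * (z v t $ p * z v s $ q)) \<partial>N)
        = (\<Sum>t\<in>F. \<Sum>s\<in>F. \<Sum>p\<in>UNIV. \<Sum>q\<in>UNIV. (a t $ p * a s $ q) * (\<integral>v. z v t $ p * z v s $ q \<partial>N))"
      using i by simp
    also have "\<dots> = (\<Sum>t\<in>F. \<Sum>s\<in>F. \<Sum>p\<in>UNIV. \<Sum>q\<in>UNIV. (a t $ p * a s $ q) * \<Gamma> t s $ p $ q)"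
      by (intro sum.cong refl arg_cong2[where f="(*)"] product(2)) (use F(2) in auto)
    finally show ?thesis .
  qed
  also have "\<dots> = (\<Sum>t\<in>F. \<Sum>s\<in>F. a t \<bullet> (\<Gamma> t s *v a s))"
    unfolding inner_mult_sum by (simp add: mult_ac)
  finally show ?thesis using gaussian_variable_cis[OF prob_space_axioms gv mean] by simp
qed

end

section \<open>The limit of the test statistic\<close>

text \<open>The estimated variances are controlled for almost every time only. Completeness makes
  the integrand of the statistic measurable once it agrees almost everywhere with a measurable
  function.\<close>

lemma complete_measure_lebesgue_on:
  assumes "S \<in> sets lebesgue"
  shows "complete_measure (lebesgue_on S)"
proof
  fix A B assume "A \<subseteq> B" "B \<in> null_sets (lebesgue_on S)"
  then have B: "B \<in> null_sets lebesgue" "B \<subseteq> S"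
    using assms by (simp_all add: null_sets_restrict_space)
  then have "A \<in> sets lebesgue" using \<open>A \<subseteq> B\<close> by (intro null_sets_completion_subset[of A B lborel, THEN null_setsD2])
  then show "A \<in> sets (lebesgue_on S)" using assms \<open>A \<subseteq> B\<close> B(2) by (auto simp: sets_restrict_space_iff)
qed

lemma (in complete_measure) borel_measurable_AE_cong:
  fixes f g :: "'a \<Rightarrow> 'b::topological_space"
  assumes g: "g \<in> borel_measurable M" and ae: "AE x in M. f x = g x"
  shows "f \<in> borel_measurable M"
proof (rule measurableI)
  fix A :: "'b set" assume A: "A \<in> sets borel"
  show "f -` A \<inter> space M \<in> sets M"
  proof (rule in_sets_AE)
    show "g -` A \<inter> space M \<in> sets M" using g A by (rule measurable_sets)
    show "AE x in M. (x \<in> g -` A \<inter> space M) \<longleftrightarrow> (x \<in> f -` A \<inter> space M)" using ae by eventually_elim auto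
  qed auto
qed simp

text \<open>Independence is assumed for the family indexed by all pairs; along the injection
  \<open>Pair i\<close> it becomes independence within the sample \<open>i\<close>.\<close>

lemma (in prob_space) indep_vars_reindex_inj:
  assumes indep: "indep_vars M' X (f ` I)" and inj: "inj_on f I"
  shows "indep_vars (\<lambda>i. M' (f i)) (\<lambda>i. X (f i)) I"
proof -
  define F where "F i = {X i -` A \<inter> space M | A. A \<in> sets (M' i)}" for i
  have F: "indep_sets F (f ` I)" and rv: "\<forall>i\<in>f ` I. random_variable (M' i) (X i)"
    using indep unfolding indep_vars_def2 F_def by auto
  have "indep_sets (\<lambda>i. F (f i)) I"
  proof (rule indep_setsI)
    fix i assume "i \<in> I" then show "F (f i) \<subseteq> events" using F unfolding indep_sets_def by auto
  next
    fix A J assume J: "J \<noteq> {}" "J \<subseteq> I" "finite J" and A: "\<forall>j\<in>J. A j \<in> F (f j)"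
    have injJ: "inj_on f J" using inj J(2) by (rule inj_on_subset)
    define B where "B = A \<circ> inv_into J f"
    have B: "B (f j) = A j" if "j \<in> J" for j using that injJ by (simp add: B_def)
    have "\<forall>A\<in>Pi (f ` J) F. prob (\<Inter>j\<in>f ` J. A j) = (\<Prod>j\<in>f ` J. prob (A j))"
      using F J unfolding indep_sets_def by (metis finite_imageI image_is_empty image_mono)
    moreover have "B \<in> Pi (f ` J) F" using A B by auto
    ultimately have "prob (\<Inter>j\<in>f ` J. B j) = (\<Prod>j\<in>f ` J. prob (B j))" by blast
    also have "(\<Inter>j\<in>f ` J. B j) = (\<Inter>j\<in>J. A j)" using B by auto
    also have "(\<Prod>j\<in>f ` J. prob (B j)) = (\<Prod>j\<in>J. prob (A j))"
      using B by (simp add: prod.reindex[OF injJ])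
    finally show "prob (\<Inter>j\<in>J. A j) = (\<Prod>j\<in>J. prob (A j))" .
  qed
  then show ?thesis using rv unfolding indep_vars_def2 F_def by auto
qed

section \<open>Several samples and their normalized deviations\<close>

locale samples = prob_space M for M :: "'w measure" +
  fixes a b :: real and T :: "real set" and H :: "real^'k::finite^'r::finite"
    and x :: "'k \<Rightarrow> nat \<Rightarrow> 'w \<Rightarrow> real \<Rightarrow> real" and \<eta> :: "'k \<Rightarrow> real \<Rightarrow> real" and \<gamma> :: "'k \<Rightarrow> real \<Rightarrow> real \<Rightarrow> real"
    and ns :: "nat \<Rightarrow> 'k \<Rightarrow> nat" and \<tau> :: "'k \<Rightarrow> real"
  assumes interval: "a \<le> b" "T = {a..b}"
    and indep: "indep_vars (\<lambda>_. path_space T) (\<lambda>(i, j). path_on T (x i j)) (UNIV \<times> {1..})"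
    and ident: "\<And>i j. j \<ge> 1 \<Longrightarrow>
                  distr M (path_space T) (path_on T (x i j)) = distr M (path_space T) (path_on T (x i 1))"
    and mean: "\<And>i j. j \<ge> 1 \<Longrightarrow> has_mean_function M T (x i j) (\<eta> i)"
    and cov: "\<And>i j. j \<ge> 1 \<Longrightarrow> has_covariance_function M T (x i j) (\<gamma> i)"
    and L2: "\<And>i j. j \<ge> 1 \<Longrightarrow> L2_process M T (x i j)"
    and eta_L2: "\<And>i. square_integrable T (\<eta> i)"
    and gamma_cont: "\<And>i. continuous_on T (\<lambda>t. \<gamma> i t t)"
    and gamma_pos: "\<And>i t. t \<in> T \<Longrightarrow> \<gamma> i t t > 0"
    and size: "filterlim (\<lambda>l. total_size (ns l)) at_top sequentially"
    and tau_pos: "\<And>i. \<tau> i > 0"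
    and tau_lim: "\<And>i. (\<lambda>l. real (ns l i) / real (total_size (ns l))) \<longlonglongrightarrow> \<tau> i"
begin

definition v :: "'k \<Rightarrow> nat \<Rightarrow> 'w \<Rightarrow> real \<Rightarrow> real" where "v i j \<omega> t = x i j \<omega> t - \<eta> i t"

lemma iid_paths: "iid_paths M a b T (x i) (\<eta> i) (\<gamma> i)"
proof unfold_locales
  have "indep_vars (\<lambda>_. path_space T) (\<lambda>(i, j). path_on T (x i j)) (Pair i ` {1..})"
    by (rule indep_vars_subset[OF indep]) auto
  from indep_vars_reindex_inj[OF this]
  show "indep_vars (\<lambda>_. path_space T) (\<lambda>j. path_on T (x i j)) {1..}"
    by (simp add: inj_on_def)
  show "\<eta> i \<in> borel_measurable (lebesgue_on T)" using eta_L2 by (simp add: square_integrable_def)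
qed (fact interval | rule ident mean cov L2, assumption)+

lemma v_facts:
  assumes "j \<ge> 1" "t \<in> T"
  shows "(\<lambda>\<omega>. v i j \<omega> t) \<in> borel_measurable M" "integrable M (\<lambda>\<omega>. v i j \<omega> t)" "expectation (\<lambda>\<omega>. v i j \<omega> t) = 0"
    "integrable M (\<lambda>\<omega>. (v i j \<omega> t)\<^sup>2)" "expectation (\<lambda>\<omega>. (v i j \<omega> t)\<^sup>2) = \<gamma> i t t"
proof -
  interpret S: iid_paths M a b T "x i" "\<eta> i" "\<gamma> i" by (rule iid_paths)
  have eq: "S.v = v i" by (simp add: fun_eq_iff S.v_def v_def)
  show "(\<lambda>\<omega>. v i j \<omega> t) \<in> borel_measurable M" "integrable M (\<lambda>\<omega>. v i j \<omega> t)" "expectation (\<lambda>\<omega>. v i j \<omega> t) = 0"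
    "integrable M (\<lambda>\<omega>. (v i j \<omega> t)\<^sup>2)" "expectation (\<lambda>\<omega>. (v i j \<omega> t)\<^sup>2) = \<gamma> i t t"
    using S.v_measurable[OF assms] S.v_moments[OF assms] unfolding eq by auto
qed

lemma v_product:
  assumes "j \<ge> 1" "m \<ge> 1" "t \<in> T" "s \<in> T"
  shows "integrable M (\<lambda>\<omega>. v i j \<omega> t * v k m \<omega> s)"
  by (rule integrable_mult_of_squares) (use v_facts assms in auto)

lemma v_covariance:
  assumes "j \<ge> 1" "t \<in> T" "s \<in> T"
  shows "expectation (\<lambda>\<omega>. v i j \<omega> t * v i j \<omega> s) = \<gamma> i t s"
proof -
  have "expectation (\<lambda>\<omega>. x i j \<omega> t) = \<eta> i t" "expectation (\<lambda>\<omega>. x i j \<omega> s) = \<eta> i s"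
    using mean[OF assms(1)] assms by (auto simp: has_mean_function_def)
  moreover have "covariance M (\<lambda>\<omega>. x i j \<omega> t) (\<lambda>\<omega>. x i j \<omega> s) = \<gamma> i t s"
    using cov[OF assms(1)] assms by (auto simp: has_covariance_function_def)
  ultimately show ?thesis by (simp add: covariance_def v_def)
qed

lemma v_uncorrelated:
  assumes "j \<ge> 1" "m \<ge> 1" "i \<noteq> k" and t: "t \<in> T"
  shows "expectation (\<lambda>\<omega>. v i j \<omega> t * v k m \<omega> t) = 0"
proof -
  let ?S = "\<lambda>_::'k \<times> nat. path_space T" and ?X = "\<lambda>(i, j). path_on T (x i j)"
  have ind: "indep_var (PiM {(i, j)} ?S) (\<lambda>\<omega>. restrict (\<lambda>p. ?X p \<omega>) {(i, j)})
      (PiM {(k, m)} ?S) (\<lambda>\<omega>. restrict (\<lambda>p. ?X p \<omega>) {(k, m)})"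
    by (rule indep_var_restrict[OF indep]) (use assms in auto)
  have coord: "(\<lambda>f. f p t) \<in> borel_measurable (PiM {p} ?S)" for p
  proof -
    have "(\<lambda>f. f p) \<in> PiM {p} ?S \<rightarrow>\<^sub>M path_space T" by (rule measurable_component_singleton) simp
    from measurable_compose[OF this measurable_component_singleton[OF t]] show ?thesis .
  qed
  have "indep_var borel ((\<lambda>f. f (i, j) t - \<eta> i t) \<circ> (\<lambda>\<omega>. restrict (\<lambda>p. ?X p \<omega>) {(i, j)}))
      borel ((\<lambda>f. f (k, m) t - \<eta> k t) \<circ> (\<lambda>\<omega>. restrict (\<lambda>p. ?X p \<omega>) {(k, m)}))"
    by (rule indep_var_compose[OF ind]) (intro borel_measurable_diff borel_measurable_const coord)+
  then have "indep_var borel (\<lambda>\<omega>. v i j \<omega> t) borel (\<lambda>\<omega>. v k m \<omega> t)"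
    using t by (simp add: comp_def path_on_def v_def)
  from indep_var_lebesgue_integral[OF this] show ?thesis
    using v_facts[OF assms(1) t] v_facts[OF assms(2) t] by simp
qed

lemma L_finite: "finite_measure (lebesgue_on T)"
  using interval by (intro finite_measure_lebesgue_on) simp

lemma gamma_bounds:
  shows "\<exists>g0>0. \<forall>t\<in>T. g0 \<le> \<gamma> i t t" "\<exists>g1. \<forall>t\<in>T. \<gamma> i t t \<le> g1"
proof -
  have T: "compact T" "T \<noteq> {}" using interval by auto
  obtain t0 where "t0 \<in> T" "\<forall>t\<in>T. \<gamma> i t0 t0 \<le> \<gamma> i t t"
    using continuous_attains_inf[OF T gamma_cont] by blast
  then show "\<exists>g0>0. \<forall>t\<in>T. g0 \<le> \<gamma> i t t" using gamma_pos by blast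
  show "\<exists>g1. \<forall>t\<in>T. \<gamma> i t t \<le> g1"
    using continuous_attains_sup[OF T gamma_cont] by blast
qed

text \<open>With this factor \<open>dev\<close> is the square root of the total size times the
  deviation of the sample means from \<open>\<eta>\<close>. An empty sample gets factor 0 by the
  convention on division; the identification with the sample means assumes nonempty samples.\<close>

definition c :: "nat \<Rightarrow> 'k \<Rightarrow> real" where "c l i = sqrt (real (total_size (ns l))) / real (ns l i)"

definition dev :: "nat \<Rightarrow> 'w \<Rightarrow> real \<Rightarrow> real^'k" where
  "dev l \<omega> t = (\<chi> i. c l i * (\<Sum>j=1..ns l i. v i j \<omega> t))"

text \<open>The diagonal of the limit covariance at equal times; \<open>Sigma_hat\<close> is
  compared with it relatively.\<close>

definition D :: "real \<Rightarrow> 'k \<Rightarrow> real" where "D t i = 1 / \<tau> i * \<gamma> i t t"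

definition A :: "real \<Rightarrow> real^'r^'r" where "A t = pinv (gram H (D t))"

definition qf :: "nat \<Rightarrow> 'w \<Rightarrow> real \<Rightarrow> real" where
  "qf l \<omega> t = (H *v dev l \<omega> t) \<bullet> (A t *v (H *v dev l \<omega> t))"

lemma D_pos: "t \<in> T \<Longrightarrow> D t i > 0"
  using gamma_pos tau_pos by (simp add: D_def)

lemma A_nonneg: "t \<in> T \<Longrightarrow> 0 \<le> y \<bullet> (A t *v y)"
  unfolding A_def by (rule pinv_gram_nonneg) (rule D_pos)

lemma A_measurable: "(\<lambda>t. A t $ p $ q) \<in> borel_measurable (lebesgue_on T)"
  unfolding A_def
proof (rule pinv_gram_measurable)
  show "(\<lambda>t. D t i) \<in> borel_measurable (lebesgue_on T)" for i
    unfolding D_def using interval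
    by (intro borel_measurable_times borel_measurable_const continuous_imp_measurable_on_sets_lebesgue gamma_cont) simp
qed (use D_pos in simp)

lemma c_sq: "real (ns l i) * (c l i)\<^sup>2 = real (total_size (ns l)) / real (ns l i)"
  by (cases "ns l i = 0") (auto simp: c_def power_divide power2_eq_square)

lemma ratio_lim: "(\<lambda>l. real (total_size (ns l)) / real (ns l i)) \<longlonglongrightarrow> 1 / \<tau> i"
  using tendsto_inverse[OF tau_lim[of i]] tau_pos[of i] by (simp add: inverse_eq_divide)

lemma ns_lim: "filterlim (\<lambda>l. ns l i) sequentially sequentially"
proof -
  have n: "filterlim (\<lambda>l. real (total_size (ns l))) at_top sequentially"
    using size filterlim_compose[OF filterlim_real_sequentially] by blast
  have "filterlim (\<lambda>l. real (ns l i) / real (total_size (ns l)) * real (total_size (ns l))) at_top sequentially"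
    by (rule filterlim_tendsto_pos_mult_at_top[OF tau_lim tau_pos n])
  then have "filterlim (\<lambda>l. real (ns l i)) at_top sequentially"
  proof (rule filterlim_cong[THEN iffD1, rotated 3])
    show "\<forall>\<^sub>F l in sequentially. real (ns l i) / real (total_size (ns l)) * real (total_size (ns l)) = real (ns l i)"
      using filterlim_at_top_dense[THEN iffD1, OF n, rule_format, of 0] by eventually_elim simp
  qed auto
  then show ?thesis by (simp add: filterlim_sequentially_iff_filterlim_real)
qed

lemma c_lim: "(\<lambda>l. c l i) \<longlonglongrightarrow> 0"
proof -
  have "(\<lambda>l. real (total_size (ns l)) / real (ns l i) * inverse (real (ns l i))) \<longlonglongrightarrow> 1 / \<tau> i * 0"
    by (intro tendsto_mult ratio_lim tendsto_inverse_0_at_top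
        filterlim_compose[OF filterlim_real_sequentially ns_lim])
  moreover have "real (total_size (ns l)) / real (ns l i) * inverse (real (ns l i)) = (c l i)\<^sup>2" for l
    by (simp add: c_def power_divide power2_eq_square inverse_eq_divide)
  ultimately have "(\<lambda>l. (c l i)\<^sup>2) \<longlonglongrightarrow> 0" by simp
  from tendsto_real_sqrt[OF this] have "(\<lambda>l. \<bar>c l i\<bar>) \<longlonglongrightarrow> 0" by simp
  then show ?thesis by (rule tendsto_rabs_zero_cancel)
qed

text \<open>Asked for every \<open>l\<close> and not only eventually, because the second-moment
  bounds that it feeds are required along the whole sequence. An empty sample contributes the
  quotient 0.\<close>

lemma ratio_bound: "\<exists>R. \<forall>l i. real (total_size (ns l)) / real (ns l i) \<le> R"
proof -
  have "\<exists>R. \<forall>l. real (total_size (ns l)) / real (ns l i) \<le> R" for i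
  proof -
    have "Bseq (\<lambda>l. real (total_size (ns l)) / real (ns l i))"
      using ratio_lim convergent_imp_Bseq convergent_def by blast
    then obtain K where "\<And>l. norm (real (total_size (ns l)) / real (ns l i)) \<le> K" by (auto simp: Bseq_def)
    then have "\<forall>l. real (total_size (ns l)) / real (ns l i) \<le> K" by (simp add: abs_le_iff)
    then show ?thesis by blast
  qed
  then obtain R where R: "\<And>l i. real (total_size (ns l)) / real (ns l i) \<le> R i" by metis
  then have "real (total_size (ns l)) / real (ns l i) \<le> Max (range R)" for l i
    by (rule order_trans) simp
  then show ?thesis by blast
qed

lemma dev_component_measurable: "t \<in> T \<Longrightarrow> (\<lambda>\<omega>. dev l \<omega> t $ i) \<in> borel_measurable M"
  unfolding dev_def by (auto intro!: borel_measurable_times borel_measurable_sum v_facts(1))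

lemma dev_second_moment:
  assumes t: "t \<in> T"
  shows "integrable M (\<lambda>\<omega>. dev l \<omega> t $ i * dev l \<omega> t $ k)"
    and "expectation (\<lambda>\<omega>. dev l \<omega> t $ i * dev l \<omega> t $ k)
      = (if i = k then real (total_size (ns l)) / real (ns l i) * \<gamma> i t t else 0)"
proof -
  define S where "S i \<omega> = (\<Sum>j=1..ns l i. v i j \<omega> t)" for i \<omega>
  have Sm: "S i \<in> borel_measurable M" for i
    unfolding S_def by (intro borel_measurable_sum v_facts(1) t) auto
  have S2: "integrable M (\<lambda>\<omega>. (S i \<omega>)\<^sup>2)" "expectation (\<lambda>\<omega>. (S i \<omega>)\<^sup>2) = real (ns l i) * \<gamma> i t t" for i
  proof -
    interpret S: iid_paths M a b T "x i" "\<eta> i" "\<gamma> i" by (rule iid_paths)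
    have eq: "S.v = v i" by (simp add: fun_eq_iff S.v_def v_def)
    show "integrable M (\<lambda>\<omega>. (S i \<omega>)\<^sup>2)" "expectation (\<lambda>\<omega>. (S i \<omega>)\<^sup>2) = real (ns l i) * \<gamma> i t t"
      using S.sum_v_sq[OF t, of "ns l i"] unfolding eq S_def by auto
  qed
  have dev_eq: "dev l \<omega> t $ i * dev l \<omega> t $ k = (c l i * c l k) * (S i \<omega> * S k \<omega>)" for \<omega>
    by (simp add: dev_def S_def)
  have int: "integrable M (\<lambda>\<omega>. S i \<omega> * S k \<omega>)"
    by (rule integrable_mult_of_squares) (use Sm S2 in auto)
  then show "integrable M (\<lambda>\<omega>. dev l \<omega> t $ i * dev l \<omega> t $ k)" unfolding dev_eq by simp
  have "expectation (\<lambda>\<omega>. dev l \<omega> t $ i * dev l \<omega> t $ k) = (c l i * c l k) * expectation (\<lambda>\<omega>. S i \<omega> * S k \<omega>)"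
    unfolding dev_eq by simp
  also have "\<dots> = (if i = k then real (total_size (ns l)) / real (ns l i) * \<gamma> i t t else 0)"
  proof (cases "i = k")
    case True
    have "(c l i * c l i) * expectation (\<lambda>\<omega>. S i \<omega> * S i \<omega>) = (real (ns l i) * (c l i)\<^sup>2) * \<gamma> i t t"
      using S2(2)[of i] by (simp add: power2_eq_square mult_ac)
    then show ?thesis using True by (simp add: c_sq)
  next
    case False
    have "expectation (\<lambda>\<omega>. S i \<omega> * S k \<omega>) = (\<Sum>j=1..ns l i. \<Sum>m=1..ns l k. expectation (\<lambda>\<omega>. v i j \<omega> t * v k m \<omega> t))"
      unfolding S_def sum_product
      by (subst Bochner_Integration.integral_sum, intro Bochner_Integration.integrable_sum v_product t, simp, simp)
         (intro sum.cong refl Bochner_Integration.integral_sum v_product t, auto)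
    also have "\<dots> = 0" using False t by (intro sum.neutral ballI) (auto intro: v_uncorrelated)
    finally show ?thesis using False by simp
  qed
  finally show "expectation (\<lambda>\<omega>. dev l \<omega> t $ i * dev l \<omega> t $ k)
      = (if i = k then real (total_size (ns l)) / real (ns l i) * \<gamma> i t t else 0)" .
qed

lemma dev_quadratic:
  assumes t: "t \<in> T"
  shows "integrable M (\<lambda>\<omega>. (H *v dev l \<omega> t) \<bullet> (B *v (H *v dev l \<omega> t)))"
    and "expectation (\<lambda>\<omega>. (H *v dev l \<omega> t) \<bullet> (B *v (H *v dev l \<omega> t)))
      = (\<Sum>i\<in>UNIV. (transpose H ** B ** H) $ i $ i * (real (total_size (ns l)) / real (ns l i) * \<gamma> i t t))"
proof -
  define G where "G = transpose H ** B ** H"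
  have eq: "(H *v dev l \<omega> t) \<bullet> (B *v (H *v dev l \<omega> t))
      = (\<Sum>p\<in>UNIV. \<Sum>q\<in>UNIV. G $ p $ q * (dev l \<omega> t $ p * dev l \<omega> t $ q))" for \<omega>
    unfolding inner_mult_sum[symmetric] G_def by (simp add: inner_transpose_mult matrix_vector_mul_assoc matrix_mul_assoc)
  show "integrable M (\<lambda>\<omega>. (H *v dev l \<omega> t) \<bullet> (B *v (H *v dev l \<omega> t)))"
    unfolding eq by (intro Bochner_Integration.integrable_sum integrable_mult_right dev_second_moment(1) t)
  have "expectation (\<lambda>\<omega>. (H *v dev l \<omega> t) \<bullet> (B *v (H *v dev l \<omega> t)))
      = (\<Sum>p\<in>UNIV. \<Sum>q\<in>UNIV. G $ p $ q * expectation (\<lambda>\<omega>. dev l \<omega> t $ p * dev l \<omega> t $ q))"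
    unfolding eq using dev_second_moment(1)[OF t, of l] by simp
  also have "\<dots> = (\<Sum>p\<in>UNIV. \<Sum>q\<in>UNIV. if p = q then G $ p $ p * (real (total_size (ns l)) / real (ns l p) * \<gamma> p t t) else 0)"
    unfolding dev_second_moment(2)[OF t] by (intro sum.cong refl) auto
  also have "\<dots> = (\<Sum>i\<in>UNIV. G $ i $ i * (real (total_size (ns l)) / real (ns l i) * \<gamma> i t t))"
    by simp
  finally show "expectation (\<lambda>\<omega>. (H *v dev l \<omega> t) \<bullet> (B *v (H *v dev l \<omega> t)))
      = (\<Sum>i\<in>UNIV. (transpose H ** B ** H) $ i $ i * (real (total_size (ns l)) / real (ns l i) * \<gamma> i t t))"
    unfolding G_def .
qed

text \<open>The basis vector itself competes in the minimum of \<open>pinv_gram_minimum\<close> and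
  has cost \<open>1 / D t i\<close>. In \<open>qf_bound\<close> the variance cancels against this
  bound, which makes the mean of the quadratic form bounded uniformly in time.\<close>

lemma A_diagonal_bound:
  assumes t: "t \<in> T"
  shows "0 \<le> (transpose H ** A t ** H) $ i $ i" "(transpose H ** A t ** H) $ i $ i \<le> \<tau> i / \<gamma> i t t"
proof -
  have eq: "(transpose H ** A t ** H) $ i $ i = (H *v axis i 1) \<bullet> (A t *v (H *v axis i 1))"
  proof -
    have "(transpose H ** A t ** H) $ i $ i = axis i 1 \<bullet> ((transpose H ** A t ** H) *v axis i 1)"
      by (simp add: matrix_vector_mult_basis column_def inner_axis')
    then show ?thesis by (simp add: inner_transpose_mult matrix_vector_mul_assoc matrix_mul_assoc)
  qed
  show "0 \<le> (transpose H ** A t ** H) $ i $ i" unfolding eq by (rule A_nonneg[OF t])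
  have "(H *v axis i 1) \<bullet> (A t *v (H *v axis i 1)) \<le> (\<Sum>k\<in>UNIV. (axis i 1 $ k)\<^sup>2 / D t k)"
    unfolding A_def by (rule pinv_gram_minimum(2)) (use D_pos[OF t] in auto)
  also have "\<dots> = (\<Sum>k\<in>UNIV. if k = i then 1 / D t i else 0)"
    by (intro sum.cong) (auto simp: axis_def)
  also have "\<dots> = \<tau> i / \<gamma> i t t" by (simp add: D_def)
  finally show "(transpose H ** A t ** H) $ i $ i \<le> \<tau> i / \<gamma> i t t" unfolding eq .
qed

text \<open>The Cramer-Wold device: a linear combination over times and coordinates is regrouped by
  samples into sums of independent scalars \<open>\<xi> i j\<close>, to which the scalar theorem
  applies with limits \<open>1 / \<tau> i\<close> of \<open>n * c^2\<close>.\<close>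

lemma characteristic_function_lim:
  assumes F: "finite F" "F \<subseteq> T"
  shows "(\<lambda>l. \<integral>\<omega>. cis (\<Sum>t\<in>F. a' t \<bullet> (H *v dev l \<omega> t)) \<partial>M) \<longlonglongrightarrow>
    complex_of_real (exp (- (\<Sum>t\<in>F. \<Sum>s\<in>F. a' t \<bullet> ((H ** Sigma_cov \<tau> \<gamma> t s ** transpose H) *v a' s)) / 2))"
proof -
  define b' where "b' t = transpose H *v a' t" for t
  define \<xi> where "\<xi> i j \<omega> = (\<Sum>t\<in>F. b' t $ i * v i j \<omega> t)" for i j \<omega>
  have lin: "(\<Sum>t\<in>F. a' t \<bullet> (H *v dev l \<omega> t)) = (\<Sum>i\<in>UNIV. c l i * (\<Sum>j=1..ns l i. \<xi> i j \<omega>))" for l \<omega>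
  proof -
    have "(\<Sum>t\<in>F. a' t \<bullet> (H *v dev l \<omega> t)) = (\<Sum>t\<in>F. \<Sum>i\<in>UNIV. c l i * (\<Sum>j=1..ns l i. b' t $ i * v i j \<omega> t))"
    proof (rule sum.cong[OF refl])
      fix t
      have "a' t \<bullet> (H *v dev l \<omega> t) = dev l \<omega> t \<bullet> b' t"
        by (simp add: inner_commute[of "a' t"] inner_transpose_mult b'_def)
      also have "\<dots> = (\<Sum>i\<in>UNIV. c l i * (\<Sum>j=1..ns l i. b' t $ i * v i j \<omega> t))"
        by (simp add: inner_vec_def dev_def sum_distrib_left mult_ac)
      finally show "a' t \<bullet> (H *v dev l \<omega> t) = (\<Sum>i\<in>UNIV. c l i * (\<Sum>j=1..ns l i. b' t $ i * v i j \<omega> t))" .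
    qed
    also have "\<dots> = (\<Sum>i\<in>UNIV. \<Sum>t\<in>F. c l i * (\<Sum>j=1..ns l i. b' t $ i * v i j \<omega> t))" by (rule sum.swap)
    also have "\<dots> = (\<Sum>i\<in>UNIV. c l i * (\<Sum>j=1..ns l i. \<xi> i j \<omega>))"
    proof (rule sum.cong[OF refl])
      fix i
      have "(\<Sum>t\<in>F. \<Sum>j=1..ns l i. b' t $ i * v i j \<omega> t) = (\<Sum>j=1..ns l i. \<xi> i j \<omega>)"
        unfolding \<xi>_def by (rule sum.swap)
      then show "(\<Sum>t\<in>F. c l i * (\<Sum>j=1..ns l i. b' t $ i * v i j \<omega> t)) = c l i * (\<Sum>j=1..ns l i. \<xi> i j \<omega>)"
        by (simp add: sum_distrib_left[symmetric])
    qed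
    finally show ?thesis .
  qed
  \<comment> \<open>\<open>\<xi>\<close> as one measurable functional of the path for each sample,
    through which independence and equality of laws are inherited.\<close>
  define Y where "Y i p = (\<Sum>t\<in>F. b' t $ i * (p t - \<eta> i t))" for i and p :: "real \<Rightarrow> real"
  have Y_meas: "Y i \<in> borel_measurable (path_space T)" for i
    unfolding Y_def using F(2)
    by (intro borel_measurable_sum borel_measurable_times borel_measurable_diff borel_measurable_const
        measurable_component_singleton) auto
  have \<xi>_Y: "\<xi> i j \<omega> = Y i (path_on T (x i j) \<omega>)" for i j \<omega>
    unfolding \<xi>_def Y_def using F(2) by (intro sum.cong refl) (auto simp: v_def path_on_def)
  have path_meas: "path_on T (x i j) \<in> M \<rightarrow>\<^sub>M path_space T" if "j \<ge> 1" for i j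
    using indep that unfolding indep_vars_def2 by auto
  have var: "expectation (\<lambda>\<omega>. (\<xi> i 1 \<omega>)\<^sup>2) = (\<Sum>t\<in>F. \<Sum>s\<in>F. (b' t $ i * b' s $ i) * \<gamma> i t s)"
    and sq: "integrable M (\<lambda>\<omega>. (\<xi> i 1 \<omega>)\<^sup>2)" for i
  proof -
    have eq: "(\<xi> i 1 \<omega>)\<^sup>2 = (\<Sum>t\<in>F. \<Sum>s\<in>F. (b' t $ i * b' s $ i) * (v i 1 \<omega> t * v i 1 \<omega> s))" for \<omega>
      unfolding \<xi>_def power2_eq_square sum_product by (simp add: mult_ac)
    have i: "integrable M (\<lambda>\<omega>. (b' t $ i * b' s $ i) * (v i 1 \<omega> t * v i 1 \<omega> s))" if "t \<in> F" "s \<in> F" for t s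
      by (intro integrable_mult_right v_product) (use that F(2) in auto)
    show "integrable M (\<lambda>\<omega>. (\<xi> i 1 \<omega>)\<^sup>2)" unfolding eq by (intro Bochner_Integration.integrable_sum i)
    have "expectation (\<lambda>\<omega>. (\<xi> i 1 \<omega>)\<^sup>2) = (\<Sum>t\<in>F. \<Sum>s\<in>F. (b' t $ i * b' s $ i) * expectation (\<lambda>\<omega>. v i 1 \<omega> t * v i 1 \<omega> s))"
      unfolding eq using i by simp
    also have "\<dots> = (\<Sum>t\<in>F. \<Sum>s\<in>F. (b' t $ i * b' s $ i) * \<gamma> i t s)"
      by (intro sum.cong refl arg_cong2[where f="(*)"] v_covariance) (use F(2) in auto)
    finally show "expectation (\<lambda>\<omega>. (\<xi> i 1 \<omega>)\<^sup>2) = (\<Sum>t\<in>F. \<Sum>s\<in>F. (b' t $ i * b' s $ i) * \<gamma> i t s)" .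
  qed
  have "(\<lambda>l. \<integral>\<omega>. cis (\<Sum>i\<in>UNIV. c l i * (\<Sum>j=1..ns l i. \<xi> i j \<omega>)) \<partial>M)
     \<longlonglongrightarrow> complex_of_real (exp (- (\<Sum>i\<in>UNIV. 1 / \<tau> i * expectation (\<lambda>\<omega>. (\<xi> i 1 \<omega>)\<^sup>2)) / 2))"
  proof (rule multi_sample_clt)
    have "indep_vars (\<lambda>_. borel) (\<lambda>p \<omega>. Y (fst p) ((\<lambda>(i, j). path_on T (x i j)) p \<omega>)) (UNIV \<times> {1..})"
      by (rule indep_vars_compose2[OF indep, of "\<lambda>p. Y (fst p)"]) (rule Y_meas)
    also have "(\<lambda>p \<omega>. Y (fst p) ((\<lambda>(i, j). path_on T (x i j)) p \<omega>)) = (\<lambda>(i, j). \<xi> i j)"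
      by (auto simp: fun_eq_iff \<xi>_Y)
    finally show "indep_vars (\<lambda>_. borel) (\<lambda>(i, j). \<xi> i j) (UNIV \<times> {1..})" .
    have *: "distr M borel (\<xi> i j) = distr (distr M (path_space T) (path_on T (x i j))) borel (Y i)" if "j \<ge> 1" for i j
    proof -
      have "\<xi> i j = Y i \<circ> path_on T (x i j)" by (simp add: fun_eq_iff \<xi>_Y)
      then show ?thesis by (simp only: distr_distr[OF Y_meas path_meas[OF that]])
    qed
    show "distr M borel (\<xi> i j) = distr M borel (\<xi> i 1)" if "j \<ge> 1" for i j
      using *[OF that, of i] *[of 1 i] ident[OF that, of i] by simp
    have "integrable M (\<lambda>\<omega>. v i 1 \<omega> t)" "expectation (\<lambda>\<omega>. v i 1 \<omega> t) = 0" if "t \<in> F" for t i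
      using v_facts(2,3)[of 1 t i] that F(2) by auto
    then show "expectation (\<xi> i 1) = 0" for i unfolding \<xi>_def by simp
    show "(\<lambda>l. real (ns l i) * (c l i)\<^sup>2) \<longlonglongrightarrow> 1 / \<tau> i" for i unfolding c_sq by (rule ratio_lim)
  qed (use sq c_lim in auto)
  moreover have "(\<Sum>i\<in>UNIV. 1 / \<tau> i * expectation (\<lambda>\<omega>. (\<xi> i 1 \<omega>)\<^sup>2))
      = (\<Sum>t\<in>F. \<Sum>s\<in>F. a' t \<bullet> ((H ** Sigma_cov \<tau> \<gamma> t s ** transpose H) *v a' s))"
  proof -
    have "(\<Sum>i\<in>UNIV. 1 / \<tau> i * expectation (\<lambda>\<omega>. (\<xi> i 1 \<omega>)\<^sup>2))
        = (\<Sum>i\<in>UNIV. \<Sum>t\<in>F. \<Sum>s\<in>F. 1 / \<tau> i * \<gamma> i t s * (b' t $ i * b' s $ i))"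
      unfolding var by (simp add: sum_distrib_left mult_ac)
    also have "\<dots> = (\<Sum>t\<in>F. \<Sum>i\<in>UNIV. \<Sum>s\<in>F. 1 / \<tau> i * \<gamma> i t s * (b' t $ i * b' s $ i))" by (rule sum.swap)
    also have "\<dots> = (\<Sum>t\<in>F. \<Sum>s\<in>F. \<Sum>i\<in>UNIV. 1 / \<tau> i * \<gamma> i t s * (b' t $ i * b' s $ i))"
      by (intro sum.cong refl sum.swap)
    finally show ?thesis unfolding Sigma_cov_def gram_bilinear b'_def .
  qed
  ultimately show ?thesis unfolding lin by simp
qed

lemma qf_nonneg: "t \<in> T \<Longrightarrow> 0 \<le> qf l \<omega> t"
  unfolding qf_def by (rule A_nonneg)

lemma qf_integrable: "t \<in> T \<Longrightarrow> integrable M (\<lambda>\<omega>. qf l \<omega> t)"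
  unfolding qf_def by (rule dev_quadratic(1))

lemma qf_joint_measurable: "(\<lambda>(\<omega>, t). qf l \<omega> t) \<in> borel_measurable (M \<Otimes>\<^sub>M lebesgue_on T)"
proof -
  have [measurable]: "(\<lambda>p. v i j (fst p) (snd p)) \<in> borel_measurable (M \<Otimes>\<^sub>M lebesgue_on T)" if "j \<ge> 1" for i j
  proof -
    have [measurable]: "(\<lambda>p. x i j (fst p) (snd p)) \<in> borel_measurable (M \<Otimes>\<^sub>M lebesgue_on T)"
      using L2[OF that, of i] by (simp add: L2_process_def split_beta')
    have [measurable]: "\<eta> i \<in> borel_measurable (lebesgue_on T)"
      using eta_L2 by (simp add: square_integrable_def)
    show ?thesis unfolding v_def by measurable
  qed
  have [measurable]: "(\<lambda>p. dev l (fst p) (snd p) $ i) \<in> borel_measurable (M \<Otimes>\<^sub>M lebesgue_on T)" for i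
    unfolding dev_def by simp
  have [measurable]: "(\<lambda>p. (H *v dev l (fst p) (snd p)) $ i) \<in> borel_measurable (M \<Otimes>\<^sub>M lebesgue_on T)" for i
    unfolding matrix_vector_mult_def by simp
  note [measurable] = A_measurable
  show ?thesis unfolding qf_def inner_mult_sum split_beta by measurable
qed

lemma qf_bound: "\<exists>C\<ge>0. \<forall>l. \<forall>t\<in>T. expectation (\<lambda>\<omega>. qf l \<omega> t) \<le> C"
proof -
  obtain R where R: "\<And>l i. real (total_size (ns l)) / real (ns l i) \<le> R" using ratio_bound by blast
  have R0: "0 \<le> R" using R[of 0 undefined] by (meson divide_nonneg_nonneg of_nat_0_le_iff order_trans)
  have "expectation (\<lambda>\<omega>. qf l \<omega> t) \<le> (\<Sum>i\<in>UNIV. \<tau> i * R)" if t: "t \<in> T" for l t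
    unfolding qf_def dev_quadratic(2)[OF t]
  proof (rule sum_mono)
    fix i
    have g: "\<gamma> i t t > 0" by (rule gamma_pos[OF t])
    have "(transpose H ** A t ** H) $ i $ i * (real (total_size (ns l)) / real (ns l i) * \<gamma> i t t)
        \<le> \<tau> i / \<gamma> i t t * (R * \<gamma> i t t)"
      using g R R0 tau_pos[of i] by (intro mult_mono A_diagonal_bound[OF t]) auto
    then show "(transpose H ** A t ** H) $ i $ i * (real (total_size (ns l)) / real (ns l i) * \<gamma> i t t) \<le> \<tau> i * R"
      using g by simp
  qed
  moreover have "0 \<le> (\<Sum>i\<in>UNIV. \<tau> i * R)" using R0 by (intro sum_nonneg mult_nonneg_nonneg less_imp_le[OF tau_pos])
  ultimately show ?thesis by blast
qed

lemma dev_norm: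
  shows "t \<in> T \<Longrightarrow> integrable M (\<lambda>\<omega>. (norm (H *v dev l \<omega> t))\<^sup>2)"
    and "\<exists>C. \<forall>l. \<forall>t\<in>T. expectation (\<lambda>\<omega>. (norm (H *v dev l \<omega> t))\<^sup>2) \<le> C"
proof -
  have eq: "(norm (H *v dev l \<omega> t))\<^sup>2 = (H *v dev l \<omega> t) \<bullet> (mat 1 *v (H *v dev l \<omega> t))" for l \<omega> t
    by (simp add: power2_norm_eq_inner)
  show "t \<in> T \<Longrightarrow> integrable M (\<lambda>\<omega>. (norm (H *v dev l \<omega> t))\<^sup>2)" unfolding eq by (rule dev_quadratic(1))
  obtain R where R: "\<And>l i. real (total_size (ns l)) / real (ns l i) \<le> R" using ratio_bound by blast
  have R0: "0 \<le> R" using R[of 0 undefined] by (meson divide_nonneg_nonneg of_nat_0_le_iff order_trans)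
  obtain g1 where g1: "\<And>i t. t \<in> T \<Longrightarrow> \<gamma> i t t \<le> g1 i" using gamma_bounds(2) by metis
  have "expectation (\<lambda>\<omega>. (norm (H *v dev l \<omega> t))\<^sup>2) \<le> (\<Sum>i\<in>UNIV. \<bar>(transpose H ** mat 1 ** H) $ i $ i\<bar> * (R * g1 i))"
    if t: "t \<in> T" for l t
    unfolding eq dev_quadratic(2)[OF t]
  proof (rule sum_mono)
    fix i
    have "0 \<le> real (total_size (ns l)) / real (ns l i) * \<gamma> i t t"
      using gamma_pos[OF t, of i] by (intro mult_nonneg_nonneg) auto
    moreover have "real (total_size (ns l)) / real (ns l i) * \<gamma> i t t \<le> R * g1 i"
      using R R0 g1[OF t] gamma_pos[OF t, of i] by (intro mult_mono) auto
    ultimately show "(transpose H ** mat 1 ** H) $ i $ i * (real (total_size (ns l)) / real (ns l i) * \<gamma> i t t)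
        \<le> \<bar>(transpose H ** mat 1 ** H) $ i $ i\<bar> * (R * g1 i)"
      by (rule mult_mono[OF abs_ge_self _ abs_ge_zero, rotated])
  qed
  then show "\<exists>C. \<forall>l. \<forall>t\<in>T. expectation (\<lambda>\<omega>. (norm (H *v dev l \<omega> t))\<^sup>2) \<le> C" by blast
qed

lemma qf_integral:
  shows "AE \<omega> in M. integrable (lebesgue_on T) (qf l \<omega>)"
    and "integrable M (\<lambda>\<omega>. \<integral>t. qf l \<omega> t \<partial>lebesgue_on T)"
    and "\<exists>C\<ge>0. \<forall>l. expectation (\<lambda>\<omega>. \<integral>t. qf l \<omega> t \<partial>lebesgue_on T) \<le> C"
proof -
  obtain C where C: "C \<ge> 0" "\<And>l t. t \<in> T \<Longrightarrow> expectation (\<lambda>\<omega>. qf l \<omega> t) \<le> C" using qf_bound by blast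
  have *: "AE \<omega> in M. integrable (lebesgue_on T) (qf l \<omega>)"
    "integrable M (\<lambda>\<omega>. \<integral>t. qf l \<omega> t \<partial>lebesgue_on T)"
    "expectation (\<lambda>\<omega>. \<integral>t. qf l \<omega> t \<partial>lebesgue_on T) \<le> C * measure (lebesgue_on T) (space (lebesgue_on T))" for l
    by (rule nonneg_process_integral[OF prob_space_axioms L_finite qf_joint_measurable _ _ _ C(1)];
        use qf_nonneg qf_integrable C(2) in simp)+
  show "AE \<omega> in M. integrable (lebesgue_on T) (qf l \<omega>)" "integrable M (\<lambda>\<omega>. \<integral>t. qf l \<omega> t \<partial>lebesgue_on T)"
    by (rule *)+
  show "\<exists>C\<ge>0. \<forall>l. expectation (\<lambda>\<omega>. \<integral>t. qf l \<omega> t \<partial>lebesgue_on T) \<le> C"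
    using *(3) C(1) by (intro exI[of _ "C * measure (lebesgue_on T) (space (lebesgue_on T))"]) auto
qed

text \<open>The null hypothesis turns the deviation from the hypothesized value into
  \<open>H\<close> applied to the deviation of the sample means. It thereby places the vector in the
  range of \<open>H\<close>, where the minimum characterization is valid. \<open>B\<close> will be
  the random pseudoinverse.\<close>

lemma statistic_eq:
  assumes n: "\<And>i. ns l i \<ge> 1" and t: "t \<in> T" and null: "H *v (\<chi> i. \<eta> i t) = y"
  shows "real (total_size (ns l)) *
           ((H *v sample_mean_vec (ns l) (\<lambda>i j. x i j \<omega>) t - y) \<bullet> (B *v (H *v sample_mean_vec (ns l) (\<lambda>i j. x i j \<omega>) t - y)))
      = (H *v dev l \<omega> t) \<bullet> (B *v (H *v dev l \<omega> t))"
proof -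
  define N where "N = real (total_size (ns l))"
  define u where "u = H *v sample_mean_vec (ns l) (\<lambda>i j. x i j \<omega>) t - y"
  have "dev l \<omega> t = sqrt N *\<^sub>R (sample_mean_vec (ns l) (\<lambda>i j. x i j \<omega>) t - (\<chi> i. \<eta> i t))"
    unfolding vec_eq_iff
  proof
    fix i
    have "real (ns l i) > 0" using n[of i] by simp
    then show "dev l \<omega> t $ i = (sqrt N *\<^sub>R (sample_mean_vec (ns l) (\<lambda>i j. x i j \<omega>) t - (\<chi> i. \<eta> i t))) $ i"
      by (simp add: dev_def c_def N_def sample_mean_vec_def sample_mean_def v_def sum_subtractf field_simps)
  qed
  then have "H *v dev l \<omega> t = sqrt N *\<^sub>R u"
    by (simp add: u_def null[symmetric] matrix_vector_mult_scaleR matrix_vector_mult_diff_distrib)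
  moreover have "sqrt N * sqrt N = N" by (simp add: N_def)
  ultimately show ?thesis
    unfolding u_def[symmetric] N_def[symmetric] by (simp add: matrix_vector_mult_scaleR mult.assoc[symmetric])
qed

lemma dev_path_measurable:
  assumes "\<omega> \<in> space M"
  shows "(\<lambda>t. (H *v dev l \<omega> t) $ p) \<in> borel_measurable (lebesgue_on T)"
proof -
  have "(\<lambda>t. v i j \<omega> t) \<in> borel_measurable (lebesgue_on T)" if "j \<ge> 1" for i j
    using L2[OF that, of i] eta_L2[of i] assms
    by (auto simp: v_def L2_process_def square_integrable_def intro!: borel_measurable_diff)
  then show ?thesis
    unfolding matrix_vector_mult_def dev_def by (auto intro!: borel_measurable_sum borel_measurable_times)
qed

lemma variance_estimate_measurable:
  assumes "\<omega> \<in> space M"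
  shows "(\<lambda>t. sample_cov (ns l) (\<lambda>i j. x i j \<omega>) i t t) \<in> borel_measurable (lebesgue_on T)"
proof -
  have "x i j \<omega> \<in> borel_measurable (lebesgue_on T)" if "j \<ge> 1" for j
    using L2[OF that, of i] assms by (auto simp: L2_process_def square_integrable_def)
  then show ?thesis
    unfolding sample_cov_def sample_mean_def
    by (intro borel_measurable_divide borel_measurable_sum borel_measurable_times borel_measurable_diff
        borel_measurable_const) auto
qed

section \<open>Replacing the estimated variances by their limits\<close>

context
  fixes cc :: "real \<Rightarrow> real^'r"
  assumes equicont: "\<And>i j. j \<in> {1, 2} \<Longrightarrow>
          ((\<lambda>\<delta>. outer_expectation M (\<lambda>\<omega>.
               SUP (t, s) \<in> {(t, s). t \<in> T \<and> s \<in> T \<and> \<bar>t - s\<bar> < \<delta>}.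
                 ereal \<bar>v i 1 \<omega> t * v i j \<omega> t - v i 1 \<omega> s * v i j \<omega> s\<bar>))
            \<longlongrightarrow> 0) (at_right 0)"
    and null_hypothesis: "\<And>t. t \<in> T \<Longrightarrow> H *v (\<chi> i. \<eta> i t) = cc t"
begin

lemma variance_estimate_consistent:
  assumes \<epsilon>: "\<epsilon> > 0"
  shows "\<forall>\<^sub>F l in sequentially. \<exists>E\<in>sets M. prob E \<le> \<epsilon> \<and> (\<forall>\<omega>\<in>space M - E.
     AE t in lebesgue_on T. \<bar>sample_cov (ns l) (\<lambda>i j. x i j \<omega>) i t t - \<gamma> i t t\<bar> \<le> \<epsilon>)"
proof -
  interpret S: iid_paths M a b T "x i" "\<eta> i" "\<gamma> i" by (rule iid_paths)
  have w: "S.w 1 j \<omega> t = v i 1 \<omega> t * v i j \<omega> t" for j \<omega> t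
    by (simp add: S.w_def S.v_def v_def)
  have "\<exists>N0. \<forall>n\<ge>N0. \<exists>E\<in>sets M. prob E \<le> \<epsilon> \<and> (\<forall>\<omega>\<in>space M - E. AE t in lebesgue_on T. \<bar>S.scov n \<omega> t - \<gamma> i t t\<bar> \<le> \<epsilon>)"
    by (rule S.scov_uniformly_consistent[OF _ gamma_cont \<epsilon>]) (unfold w, rule equicont)
  then obtain N0 where N0: "\<And>n. n \<ge> N0 \<Longrightarrow> \<exists>E\<in>sets M. prob E \<le> \<epsilon> \<and> (\<forall>\<omega>\<in>space M - E. AE t in lebesgue_on T. \<bar>S.scov n \<omega> t - \<gamma> i t t\<bar> \<le> \<epsilon>)"
    by blast
  have eq: "sample_cov (ns l) (\<lambda>i j. x i j \<omega>) i t t = S.scov (ns l i) \<omega> t" for l \<omega> t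
    by (simp add: sample_cov_def S.scov_def sample_mean_def)
  have "\<forall>\<^sub>F l in sequentially. ns l i \<ge> N0"
    using ns_lim[of i] by (simp add: filterlim_at_top)
  then show ?thesis unfolding eq by eventually_elim (rule N0)
qed

lemma relative_variance_error:
  assumes \<epsilon>: "0 < \<epsilon>"
  shows "\<forall>\<^sub>F l in sequentially. \<exists>E\<in>sets M. prob E \<le> \<epsilon> \<and> (\<forall>\<omega>\<in>space M - E. AE t in lebesgue_on T.
    \<bar>real (total_size (ns l)) / real (ns l i) * sample_cov (ns l) (\<lambda>i j. x i j \<omega>) i t t - D t i\<bar> \<le> \<epsilon> * D t i)"
proof -
  obtain g0 where g0: "g0 > 0" "\<And>t. t \<in> T \<Longrightarrow> g0 \<le> \<gamma> i t t" using gamma_bounds(1) by blast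
  \<comment> \<open>Continuity and positivity on a compact interval give the lower bound
    \<open>g0\<close>, which converts absolute into relative error. As the size ratio is at most
    \<open>2 / \<tau> i\<close>, an error of \<open>\<epsilon> * g0 / 4\<close> uses up half of the
    allowance; the other half is for the ratio.\<close>
  define \<delta> where "\<delta> = min \<epsilon> (\<epsilon> * g0 / 4)"
  have \<delta>: "\<delta> > 0" using \<epsilon> g0 by (simp add: \<delta>_def)
  have tau: "1 / \<tau> i > 0" using tau_pos[of i] by simp
  have 1: "\<forall>\<^sub>F l in sequentially. \<bar>real (total_size (ns l)) / real (ns l i) - 1 / \<tau> i\<bar> < min 1 (\<epsilon> / 2) * (1 / \<tau> i)"
    using tendstoD[OF ratio_lim[of i], of "min 1 (\<epsilon> / 2) * (1 / \<tau> i)"] \<epsilon> tau by (simp add: dist_real_def)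
  from variance_estimate_consistent[OF \<delta>, of i] 1 show ?thesis
  proof eventually_elim
    case (elim l)
    define R where "R = real (total_size (ns l)) / real (ns l i)"
    have "min 1 (\<epsilon> / 2) * (1 / \<tau> i) \<le> 1 * (1 / \<tau> i)" "min 1 (\<epsilon> / 2) * (1 / \<tau> i) \<le> \<epsilon> / 2 * (1 / \<tau> i)"
      using tau by (intro mult_right_mono; simp)+
    then have R: "\<bar>R - 1 / \<tau> i\<bar> \<le> \<epsilon> / 2 * (1 / \<tau> i)" "0 \<le> R" "R \<le> 2 * (1 / \<tau> i)"
      using elim(2) unfolding R_def by auto
    obtain E where E: "E \<in> sets M" "prob E \<le> \<delta>" "\<And>\<omega>. \<omega> \<in> space M - E \<Longrightarrow>
        AE t in lebesgue_on T. \<bar>sample_cov (ns l) (\<lambda>i j. x i j \<omega>) i t t - \<gamma> i t t\<bar> \<le> \<delta>"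
      using elim(1) by blast
    have "AE t in lebesgue_on T. \<bar>R * sample_cov (ns l) (\<lambda>i j. x i j \<omega>) i t t - D t i\<bar> \<le> \<epsilon> * D t i"
      if "\<omega> \<in> space M - E" for \<omega>
      using E(3)[OF that] AE_space
    proof eventually_elim
      case (elim t)
      define s where "s = sample_cov (ns l) (\<lambda>i j. x i j \<omega>) i t t"
      define g where "g = \<gamma> i t t"
      have g: "g \<ge> g0" "g > 0" using elim(2) g0 unfolding g_def by (auto intro: less_le_trans)
      have "R * s - D t i = R * (s - g) + (R - 1 / \<tau> i) * g"
        by (simp add: D_def g_def algebra_simps)
      also have "\<bar>\<dots>\<bar> \<le> R * \<bar>s - g\<bar> + \<bar>R - 1 / \<tau> i\<bar> * g"
        using R(2) g(2) by (intro order_trans[OF abs_triangle_ineq]) (simp add: abs_mult)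
      also have "\<dots> \<le> 2 * (1 / \<tau> i) * (\<epsilon> * g / 4) + \<epsilon> / 2 * (1 / \<tau> i) * g"
      proof (intro add_mono mult_mono R)
        have "\<bar>s - g\<bar> \<le> \<epsilon> * g0 / 4" using elim(1) unfolding s_def g_def \<delta>_def by simp
        also have "\<dots> \<le> \<epsilon> * g / 4" using g \<epsilon> by simp
        finally show "\<bar>s - g\<bar> \<le> \<epsilon> * g / 4" .
      qed (use tau \<epsilon> g in auto)
      also have "\<dots> = \<epsilon> * D t i" by (simp add: D_def g_def)
      finally show ?case unfolding s_def .
    qed
    moreover have "prob E \<le> \<epsilon>" using E(2) by (simp add: \<delta>_def)
    ultimately show ?case using E(1) unfolding R_def by blast
  qed
qed

text \<open>A relative error valid for almost every time survives integration. Off the exceptional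
  set the integrand of the statistic is measurable and differs from the integrable \<open>qf\<close>
  by at most a multiple of \<open>qf\<close>, so the value 0 assigned to non-integrable functions
  never intervenes.\<close>

lemma statistic_approximation:
  assumes \<epsilon>: "\<epsilon> > 0"
  shows "\<forall>\<^sub>F l in sequentially. \<exists>E\<in>sets M. prob E \<le> \<epsilon> \<and> (\<forall>\<omega>\<in>space M - E.
     \<bar>GPH_statistic T H cc (ns l) (\<lambda>i j. x i j \<omega>) - (\<integral>t. qf l \<omega> t \<partial>lebesgue_on T)\<bar>
       \<le> \<epsilon> * \<bar>\<integral>t. qf l \<omega> t \<partial>lebesgue_on T\<bar>)"
proof -
  \<comment> \<open>Half of \<open>\<epsilon>\<close> for the factor 2 in the relative error, 1/2
    for the range of that lemma, and division by the number of samples for the union bound.\<close>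
  define \<epsilon>1 where "\<epsilon>1 = min (min (\<epsilon> / 2) (1 / 2)) (\<epsilon> / real CARD('k))"
  have \<epsilon>1: "\<epsilon>1 > 0" "2 * \<epsilon>1 \<le> \<epsilon>" "\<epsilon>1 \<le> 1 / 2" "real CARD('k) * \<epsilon>1 \<le> \<epsilon>"
  proof -
    show "\<epsilon>1 > 0" using \<epsilon> by (simp add: \<epsilon>1_def)
    have "\<epsilon>1 \<le> \<epsilon> / 2" "\<epsilon>1 \<le> 1 / 2" "\<epsilon>1 \<le> \<epsilon> / real CARD('k)" unfolding \<epsilon>1_def by linarith+
    then show "2 * \<epsilon>1 \<le> \<epsilon>" "\<epsilon>1 \<le> 1 / 2" "real CARD('k) * \<epsilon>1 \<le> \<epsilon>"
      by (auto simp: pos_le_divide_eq mult.commute)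
  qed
  have "\<forall>\<^sub>F l in sequentially. \<forall>i. \<exists>E\<in>sets M. prob E \<le> \<epsilon>1 \<and> (\<forall>\<omega>\<in>space M - E. AE t in lebesgue_on T.
    \<bar>real (total_size (ns l)) / real (ns l i) * sample_cov (ns l) (\<lambda>i j. x i j \<omega>) i t t - D t i\<bar> \<le> \<epsilon>1 * D t i)"
    by (intro eventually_all_finite relative_variance_error \<epsilon>1(1))
  moreover have "\<forall>\<^sub>F l in sequentially. \<forall>i. ns l i \<ge> 1"
    using ns_lim by (intro eventually_all_finite) (simp add: filterlim_at_top)
  ultimately show ?thesis
  proof eventually_elim
    case (elim l)
    define e where "e \<omega> t i = real (total_size (ns l)) / real (ns l i) * sample_cov (ns l) (\<lambda>i j. x i j \<omega>) i t t" for \<omega> t i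
    have "\<forall>i. \<exists>E. E \<in> sets M \<and> prob E \<le> \<epsilon>1 \<and>
        (\<forall>\<omega>\<in>space M - E. AE t in lebesgue_on T. \<bar>e \<omega> t i - D t i\<bar> \<le> \<epsilon>1 * D t i)"
      using elim(1) unfolding e_def Bex_def .
    from choice[OF this] obtain E where E': "\<forall>i. E i \<in> sets M \<and> prob (E i) \<le> \<epsilon>1 \<and>
        (\<forall>\<omega>\<in>space M - E i. AE t in lebesgue_on T. \<bar>e \<omega> t i - D t i\<bar> \<le> \<epsilon>1 * D t i)" ..
    have E: "E i \<in> sets M" "prob (E i) \<le> \<epsilon>1"
      "\<omega> \<in> space M - E i \<Longrightarrow> AE t in lebesgue_on T. \<bar>e \<omega> t i - D t i\<bar> \<le> \<epsilon>1 * D t i" for i \<omega>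
      using E' by blast+
    obtain Z where Z: "{\<omega> \<in> space M. \<not> integrable (lebesgue_on T) (qf l \<omega>)} \<subseteq> Z" "emeasure M Z = 0" "Z \<in> sets M"
      using qf_integral(1)[of l] by (rule AE_E)
    define E' where "E' = (\<Union>i. E i) \<union> Z"
    have E': "E' \<in> sets M" unfolding E'_def by (intro sets.Un sets.finite_UN E Z) simp
    have "prob E' \<le> prob (\<Union>i. E i) + prob Z"
      unfolding E'_def by (intro measure_Un_le sets.finite_UN E Z) simp
    also have "prob Z = 0" using Z(2) by (simp add: measure_def)
    also have "prob (\<Union>i. E i) \<le> (\<Sum>i\<in>UNIV. prob (E i))"
      using E by (intro finite_measure_subadditive_finite) auto
    also have "\<dots> \<le> (\<Sum>i::'k\<in>UNIV. \<epsilon>1)" by (intro sum_mono E)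
    finally have E'_prob: "prob E' \<le> \<epsilon>" using \<epsilon>1(4) by simp
    have close: "\<bar>GPH_statistic T H cc (ns l) (\<lambda>i j. x i j \<omega>) - (\<integral>t. qf l \<omega> t \<partial>lebesgue_on T)\<bar>
       \<le> \<epsilon> * \<bar>\<integral>t. qf l \<omega> t \<partial>lebesgue_on T\<bar>" if \<omega>: "\<omega> \<in> space M - E'" for \<omega>
    proof -
      interpret L: complete_measure "lebesgue_on T" using interval by (intro complete_measure_lebesgue_on) simp
      define y where "y t = H *v dev l \<omega> t" for t
      define r where "r t = y t \<bullet> (pinv (gram H (e \<omega> t)) *v y t)" for t
      have wM: "\<omega> \<in> space M" using \<omega> by simp
      have stat: "GPH_statistic T H cc (ns l) (\<lambda>i j. x i j \<omega>) = (\<integral>t. r t \<partial>lebesgue_on T)"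
        unfolding GPH_statistic_def r_def y_def Sigma_hat_def e_def
        by (intro Bochner_Integration.integral_cong refl statistic_eq null_hypothesis)
           (use elim(2) in \<open>auto simp: null_hypothesis\<close>)
      have q_int: "integrable (lebesgue_on T) (qf l \<omega>)" using \<omega> Z(1) by (auto simp: E'_def)
      have "AE t in lebesgue_on T. \<forall>i\<in>UNIV. \<bar>e \<omega> t i - D t i\<bar> \<le> \<epsilon>1 * D t i"
        using E(3) \<omega> by (subst AE_finite_all) (auto simp: E'_def)
      then have ae: "AE t in lebesgue_on T. t \<in> T \<and> (\<forall>i. \<bar>e \<omega> t i - D t i\<bar> \<le> \<epsilon>1 * D t i)"
        using AE_space by eventually_elim auto
      have r_close: "AE t in lebesgue_on T. \<bar>r t - qf l \<omega> t\<bar> \<le> \<epsilon> * qf l \<omega> t"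
        using ae
      proof eventually_elim
        case (elim t)
        have "\<bar>r t - qf l \<omega> t\<bar> \<le> 2 * \<epsilon>1 * qf l \<omega> t"
          unfolding r_def y_def qf_def A_def
          by (rule pinv_gram_relative_error) (use elim D_pos \<epsilon>1 in auto)
        also have "\<dots> \<le> \<epsilon> * qf l \<omega> t" using \<epsilon>1(2) elim by (intro mult_right_mono qf_nonneg) auto
        finally show ?case .
      qed
      have r_meas: "r \<in> borel_measurable (lebesgue_on T)"
      proof (rule L.borel_measurable_AE_cong)
        \<comment> \<open>An estimated variance can fail to be positive at exceptional times, where
          \<open>pinv_gram_measurable\<close> does not apply. Replacing it there by 1 changes the
          integrand on a null set only, since a relative error of at most 1/2 implies
          positivity.\<close>
        define e' where "e' t i = (if 0 < e \<omega> t i then e \<omega> t i else 1)" for t i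
        have e'm: "(\<lambda>t. e' t i) \<in> borel_measurable (lebesgue_on T)" for i
        proof -
          have [measurable]: "(\<lambda>t. e \<omega> t i) \<in> borel_measurable (lebesgue_on T)"
            unfolding e_def by (intro borel_measurable_times borel_measurable_const variance_estimate_measurable wM)
          show ?thesis unfolding e'_def by measurable
        qed
        have B: "(\<lambda>t. pinv (gram H (e' t)) $ p $ p') \<in> borel_measurable (lebesgue_on T)" for p p'
          by (rule pinv_gram_measurable[OF e'm]) (simp add: e'_def)
        show "(\<lambda>t. y t \<bullet> (pinv (gram H (e' t)) *v y t)) \<in> borel_measurable (lebesgue_on T)"
          unfolding inner_mult_sum y_def
          by (intro borel_measurable_sum borel_measurable_times B dev_path_measurable wM)
        show "AE t in lebesgue_on T. r t = y t \<bullet> (pinv (gram H (e' t)) *v y t)"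
          using ae
        proof eventually_elim
          case (elim t)
          have "e \<omega> t i > 0" for i
          proof -
            have "D t i > 0" using elim D_pos by auto
            moreover have "\<bar>e \<omega> t i - D t i\<bar> \<le> 1 / 2 * D t i"
              using elim \<epsilon>1(3) mult_right_mono[OF \<epsilon>1(3), of "D t i"] \<open>D t i > 0\<close> by (meson less_imp_le order_trans)
            ultimately show ?thesis unfolding abs_le_iff by linarith
          qed
          then have "e' t = e \<omega> t" by (simp add: fun_eq_iff e'_def)
          then show ?case by (simp add: r_def)
        qed
      qed
      have d_int: "integrable (lebesgue_on T) (\<lambda>t. r t - qf l \<omega> t)"
      proof (rule Bochner_Integration.integrable_bound)
        show "integrable (lebesgue_on T) (\<lambda>t. \<epsilon> * qf l \<omega> t)" using q_int by simp
        show "(\<lambda>t. r t - qf l \<omega> t) \<in> borel_measurable (lebesgue_on T)" using r_meas q_int by simp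
        show "AE t in lebesgue_on T. norm (r t - qf l \<omega> t) \<le> norm (\<epsilon> * qf l \<omega> t)"
          using r_close by eventually_elim auto
      qed
      have r_int: "integrable (lebesgue_on T) r"
        using Bochner_Integration.integrable_add[OF d_int q_int] by simp
      have "\<bar>(\<integral>t. r t \<partial>lebesgue_on T) - (\<integral>t. qf l \<omega> t \<partial>lebesgue_on T)\<bar> = \<bar>\<integral>t. r t - qf l \<omega> t \<partial>lebesgue_on T\<bar>"
        using r_int q_int by simp
      also have "\<dots> \<le> (\<integral>t. \<bar>r t - qf l \<omega> t\<bar> \<partial>lebesgue_on T)" by (rule integral_abs_bound)
      also have "\<dots> \<le> (\<integral>t. \<epsilon> * qf l \<omega> t \<partial>lebesgue_on T)"
        using d_int q_int r_close by (intro integral_mono_AE) auto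
      also have "\<dots> \<le> \<epsilon> * \<bar>\<integral>t. qf l \<omega> t \<partial>lebesgue_on T\<bar>" using \<epsilon> by simp
      finally show ?thesis unfolding stat .
    qed
    show ?case using E' E'_prob close by blast
  qed
qed

end

section \<open>Convergence of the statistic\<close>

lemma limit_theorem:
  fixes cc :: "real \<Rightarrow> real^'r" and N :: "'v measure" and z :: "'v \<Rightarrow> real \<Rightarrow> real^'r"
  assumes equicont: "\<And>i j. j \<in> {1, 2} \<Longrightarrow>
          ((\<lambda>\<delta>. outer_expectation M (\<lambda>\<omega>.
               SUP (t, s) \<in> {(t, s). t \<in> T \<and> s \<in> T \<and> \<bar>t - s\<bar> < \<delta>}.
                 ereal \<bar>v i 1 \<omega> t * v i j \<omega> t - v i 1 \<omega> s * v i j \<omega> s\<bar>))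
            \<longlongrightarrow> 0) (at_right 0)"
    and null_hypothesis: "\<And>t. t \<in> T \<Longrightarrow> H *v (\<chi> i. \<eta> i t) = cc t"
    and N: "prob_space N"
    and z: "centered_gaussian_process N T (\<lambda>t s. H ** Sigma_cov \<tau> \<gamma> t s ** transpose H) z"
  shows "converges_in_distribution
           M (\<lambda>l \<omega>. GPH_statistic T H cc (ns l) (\<lambda>i j. x i j \<omega>))
           N (\<lambda>\<omega>. \<integral>t. z \<omega> t \<bullet>
                     (pinv (H ** Sigma_cov \<tau> \<gamma> t t ** transpose H) *v z \<omega> t) \<partial>lebesgue_on T)"
proof -
  interpret G: centered_gaussian N T "\<lambda>t s. H ** Sigma_cov \<tau> \<gamma> t s ** transpose H" z
    using N z by (simp add: centered_gaussian_def centered_gaussian_axioms_def)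
  interpret L: finite_measure "lebesgue_on T" by (rule L_finite)
  have A_eq: "pinv (H ** Sigma_cov \<tau> \<gamma> t t ** transpose H) = A t" for t
    by (simp add: A_def Sigma_cov_def D_def[abs_def])
  define p where "p \<omega> t = z \<omega> t \<bullet> (A t *v z \<omega> t)" for \<omega> t
  have p_meas: "(\<lambda>(\<omega>, t). p \<omega> t) \<in> borel_measurable (N \<Otimes>\<^sub>M lebesgue_on T)"
  proof -
    have zm: "(\<lambda>x. z (fst x) (snd x)) \<in> borel_measurable (N \<Otimes>\<^sub>M lebesgue_on T)"
      using z by (simp add: centered_gaussian_process_def L2_process_def split_beta')
    have [measurable]: "(\<lambda>x. z (fst x) (snd x) $ i) \<in> borel_measurable (N \<Otimes>\<^sub>M lebesgue_on T)" for i
      by (rule measurable_compose[OF zm]) (intro borel_measurable_continuous_onI continuous_intros)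
    note [measurable] = A_measurable
    show ?thesis unfolding p_def inner_mult_sum split_beta by measurable
  qed
  obtain C1 where C1: "C1 \<ge> 0" "\<And>l t. t \<in> T \<Longrightarrow> expectation (\<lambda>\<omega>. qf l \<omega> t) \<le> C1" using qf_bound by blast
  \<comment> \<open>Both sides are the trace of \<open>B\<close> times the Gram matrix, by cyclic
    invariance. It identifies the mean of a quadratic form in \<open>z\<close> with the limit of the
    corresponding means for \<open>dev\<close>.\<close>
  have Gamma: "(\<Sum>p\<in>UNIV. \<Sum>q\<in>UNIV. B $ p $ q * (H ** Sigma_cov \<tau> \<gamma> t t ** transpose H) $ p $ q)
      = (\<Sum>i\<in>UNIV. (transpose H ** B ** H) $ i $ i * (1 / \<tau> i * \<gamma> i t t))" for B t
  proof -
    have entry: "(gram H d) $ p $ q = (\<Sum>i\<in>UNIV. d i * (H $ p $ i * H $ q $ i))" for d p q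
    proof -
      have "(gram H d) $ p $ q = axis p 1 \<bullet> (gram H d *v axis q 1)"
        by (simp add: matrix_vector_mult_basis column_def inner_axis')
      then show ?thesis unfolding gram_bilinear
        by (simp add: matrix_vector_mult_basis column_def transpose_def)
    qed
    have "(transpose H ** B ** H) $ i $ i = (\<Sum>p\<in>UNIV. \<Sum>q\<in>UNIV. B $ p $ q * (H $ p $ i * H $ q $ i))" for i
    proof -
      have "(transpose H ** B ** H) $ i $ i = axis i 1 \<bullet> ((transpose H ** B ** H) *v axis i 1)"
        by (simp add: matrix_vector_mult_basis column_def inner_axis')
      also have "\<dots> = (H *v axis i 1) \<bullet> (B *v (H *v axis i 1))"
        by (simp add: inner_transpose_mult matrix_vector_mul_assoc matrix_mul_assoc)
      also have "\<dots> = (\<Sum>p\<in>UNIV. \<Sum>q\<in>UNIV. B $ p $ q * (H $ p $ i * H $ q $ i))"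
        unfolding inner_mult_sum by (simp add: matrix_vector_mult_basis column_def)
      finally show ?thesis .
    qed
    then have "(\<Sum>i\<in>UNIV. (transpose H ** B ** H) $ i $ i * (1 / \<tau> i * \<gamma> i t t))
        = (\<Sum>i\<in>UNIV. \<Sum>p\<in>UNIV. \<Sum>q\<in>UNIV. B $ p $ q * ((1 / \<tau> i * \<gamma> i t t) * (H $ p $ i * H $ q $ i)))"
      by (simp add: sum_distrib_left sum_distrib_right mult_ac)
    also have "\<dots> = (\<Sum>p\<in>UNIV. \<Sum>i\<in>UNIV. \<Sum>q\<in>UNIV. B $ p $ q * ((1 / \<tau> i * \<gamma> i t t) * (H $ p $ i * H $ q $ i)))"
      by (rule sum.swap)
    also have "\<dots> = (\<Sum>p\<in>UNIV. \<Sum>q\<in>UNIV. \<Sum>i\<in>UNIV. B $ p $ q * ((1 / \<tau> i * \<gamma> i t t) * (H $ p $ i * H $ q $ i)))"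
      by (intro sum.cong refl sum.swap)
    finally show ?thesis unfolding Sigma_cov_def entry by (simp add: sum_distrib_left)
  qed
  have lim: "(\<lambda>l. expectation (\<lambda>\<omega>. (H *v dev l \<omega> t) \<bullet> (B *v (H *v dev l \<omega> t)))) \<longlonglongrightarrow> (\<integral>\<omega>. z \<omega> t \<bullet> (B *v z \<omega> t) \<partial>N)"
    if t: "t \<in> T" for B t
    unfolding dev_quadratic(2)[OF t] G.quadratic(2)[OF t t] Gamma by (intro tendsto_intros ratio_lim)
  have p_lim: "(\<lambda>l. expectation (\<lambda>\<omega>. qf l \<omega> t)) \<longlonglongrightarrow> (\<integral>\<omega>. p \<omega> t \<partial>N)" if "t \<in> T" for t
    unfolding qf_def p_def by (rule lim[OF that])
  \<comment> \<open>The uniform bound for the sequence passes to the limit process through the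
    convergence of means; the bound on second moments of \<open>z\<close> arises in the same
    way.\<close>
  have p_bound: "(\<integral>\<omega>. p \<omega> t \<partial>N) \<le> C1" if "t \<in> T" for t
    using C1(2)[OF that] by (intro LIMSEQ_le_const2[OF p_lim[OF that]]) auto
  obtain C2 where C2: "\<And>l t. t \<in> T \<Longrightarrow> expectation (\<lambda>\<omega>. (norm (H *v dev l \<omega> t))\<^sup>2) \<le> C2" using dev_norm(2) by blast
  have norm_eq: "(norm y)\<^sup>2 = y \<bullet> (mat 1 *v y)" for y :: "real^'r" by (simp add: power2_norm_eq_inner)
  have z2: "integrable N (\<lambda>\<omega>. (norm (z \<omega> t))\<^sup>2)" "(\<integral>\<omega>. (norm (z \<omega> t))\<^sup>2 \<partial>N) \<le> C2" if t: "t \<in> T" for t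
  proof -
    show "integrable N (\<lambda>\<omega>. (norm (z \<omega> t))\<^sup>2)" unfolding norm_eq by (rule G.quadratic(1)[OF t t])
    show "(\<integral>\<omega>. (norm (z \<omega> t))\<^sup>2 \<partial>N) \<le> C2"
      using C2[OF t] lim[OF t, of "mat 1"] unfolding norm_eq[symmetric] by (intro LIMSEQ_le_const2) auto
  qed
  have fdd: "(\<lambda>l. \<integral>\<omega>. (\<Prod>k<m::nat. min (qf l \<omega> (ts k)) K) \<partial>M) \<longlonglongrightarrow> (\<integral>\<omega>. (\<Prod>k<m. min (p \<omega> (ts k)) K) \<partial>N)"
    if K: "K > 0" and ts: "\<And>k. k < m \<Longrightarrow> ts k \<in> T" for m ts K
  proof -
    \<comment> \<open>Division by \<open>K\<close> normalizes the truncated form to be bounded by 1,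
      as the approximation by trigonometric polynomials expects; the factor \<open>K ^ m\<close> is
      put back afterwards.\<close>
    define h where "h k y = min (y \<bullet> (A (ts k) *v y)) K / K" for k y
    have "(\<lambda>l. \<integral>\<omega>. (\<Prod>k<m. h k (H *v dev l \<omega> (ts k))) \<partial>M) \<longlonglongrightarrow> (\<integral>\<omega>. (\<Prod>k<m. h k (z \<omega> (ts k))) \<partial>N)"
    proof (rule fdd_product_converges[OF prob_space_axioms N, where T=T and C=C2])
      show "(\<lambda>\<omega>. H *v dev l \<omega> t) \<in> borel_measurable M" if t: "t \<in> T" for l t
      proof -
        have "(\<lambda>\<omega>. (H *v dev l \<omega> t) $ i) \<in> borel_measurable M" for i
          unfolding matrix_vector_mult_def
          by (simp, intro borel_measurable_sum borel_measurable_times borel_measurable_const dev_component_measurable t)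
        then show ?thesis by (subst borel_measurable_euclidean_space) (auto simp: Basis_vec_def inner_axis)
      qed
      show "(\<lambda>l. \<integral>\<omega>. cis (\<Sum>t\<in>F. a' t \<bullet> (H *v dev l \<omega> t)) \<partial>M) \<longlonglongrightarrow> (\<integral>\<omega>. cis (\<Sum>t\<in>F. a' t \<bullet> z \<omega> t) \<partial>N)"
        if F: "finite F" "F \<subseteq> T" for F a'
        unfolding G.characteristic_function[OF F] by (rule characteristic_function_lim[OF F])
      show "continuous_on UNIV (h k)" if "k < m" for k
        unfolding h_def inner_mult_sum using K by (intro continuous_intros) auto
      show "\<bar>h k y\<bar> \<le> 1" if "k < m" for k y
        using A_nonneg[OF ts[OF that], of y] K by (auto simp: h_def)
    qed (use G.vector_measurable dev_norm(1) z2 C2 ts in auto)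
    then have scaled: "(\<lambda>l. K ^ m * (\<integral>\<omega>. (\<Prod>k<m. h k (H *v dev l \<omega> (ts k))) \<partial>M))
        \<longlonglongrightarrow> K ^ m * (\<integral>\<omega>. (\<Prod>k<m. h k (z \<omega> (ts k))) \<partial>N)" by (rule tendsto_mult_left)
    have unscale: "K ^ m * (\<integral>\<omega>. (\<Prod>k<m. h k (Y \<omega> k)) \<partial>R) = (\<integral>\<omega>. (\<Prod>k<m. min (Y \<omega> k \<bullet> (A (ts k) *v Y \<omega> k)) K) \<partial>R)"
      for Y :: "'x \<Rightarrow> nat \<Rightarrow> real^'r" and R
    proof -
      have "(\<Prod>k<m. min (Y \<omega> k \<bullet> (A (ts k) *v Y \<omega> k)) K) = K ^ m * (\<Prod>k<m. h k (Y \<omega> k))" for \<omega>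
        using K by (simp add: h_def prod_dividef)
      then show ?thesis by simp
    qed
    show ?thesis unfolding qf_def p_def
      using scaled unfolding unscale[of _ "\<lambda>\<omega> k. H *v dev l \<omega> (ts k)" for l]
        unscale[of _ "\<lambda>\<omega> k. z \<omega> (ts k)"] .
  qed
  have conv: "(\<lambda>l. \<integral>\<omega>. f (\<integral>t. qf l \<omega> t \<partial>lebesgue_on T) \<partial>M) \<longlonglongrightarrow> (\<integral>\<omega>. f (\<integral>t. p \<omega> t \<partial>lebesgue_on T) \<partial>N)"
    if f: "continuous_on UNIV f" "bounded (range f)" for f :: "real \<Rightarrow> real"
  proof (rule integral_functional_converges[OF prob_space_axioms N L_finite qf_joint_measurable p_meas _ _ _ _ _ C1(1) _ _ _ f])
    show "integrable N (\<lambda>\<omega>. p \<omega> t)" if "t \<in> space (lebesgue_on T)" for t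
      unfolding p_def using that by (intro G.quadratic(1)) auto
    show "0 \<le> p \<omega> t" if "t \<in> space (lebesgue_on T)" for \<omega> t
      unfolding p_def using that by (intro A_nonneg) simp
    show "(\<lambda>l. \<integral>\<omega>. (\<Prod>k<m. min (qf l \<omega> (ts k)) K) \<partial>M) \<longlonglongrightarrow> (\<integral>\<omega>. (\<Prod>k<m. min (p \<omega> (ts k)) K) \<partial>N)"
      if "K > 0" "\<And>k. k < m \<Longrightarrow> ts k \<in> space (lebesgue_on T)" for m :: nat and ts K
      using that by (intro fdd) auto
  qed (use qf_nonneg qf_integrable C1(2) p_bound p_lim in auto)
  obtain C where C: "C \<ge> 0" "\<And>l. expectation (\<lambda>\<omega>. \<integral>t. qf l \<omega> t \<partial>lebesgue_on T) \<le> C" using qf_integral(3) by blast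
  have Y: "(\<lambda>\<omega>. \<integral>t. p \<omega> t \<partial>lebesgue_on T) \<in> borel_measurable N"
    by (rule L.borel_measurable_lebesgue_integral) (use p_meas in simp)
  show ?thesis
    unfolding converges_in_distribution_def A_eq p_def[symmetric]
  proof (intro conjI Y allI impI)
    fix f :: "real \<Rightarrow> real" assume f: "continuous_on UNIV f" "bounded (range f)"
    show "(\<lambda>l. outer_expectation M (\<lambda>\<omega>. ereal (f (GPH_statistic T H cc (ns l) (\<lambda>i j. x i j \<omega>)))))
        \<longlonglongrightarrow> ereal (\<integral>\<omega>. f (\<integral>t. p \<omega> t \<partial>lebesgue_on T) \<partial>N)"
    proof (rule outer_slutsky[OF prob_space_axioms _ _ C(2,1) _ f conv[OF f]])
      show "AE \<omega> in M. 0 \<le> (\<integral>t. qf l \<omega> t \<partial>lebesgue_on T)" for l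
        by (intro AE_I2 integral_nonneg_AE) (use qf_nonneg in auto)
      show "\<forall>\<^sub>F l in sequentially. \<exists>E\<in>sets M. prob E \<le> \<epsilon> \<and> (\<forall>\<omega>\<in>space M - E.
          \<bar>GPH_statistic T H cc (ns l) (\<lambda>i j. x i j \<omega>) - (\<integral>t. qf l \<omega> t \<partial>lebesgue_on T)\<bar>
          \<le> \<epsilon> * \<bar>\<integral>t. qf l \<omega> t \<partial>lebesgue_on T\<bar>)" if "\<epsilon> > 0" for \<epsilon>
        by (rule statistic_approximation[OF equicont null_hypothesis that])
    qed (rule qf_integral(2))
  qed
qed

end

theorem theorem1:
  fixes a b :: real
    and T :: "real set"
    and H :: "real^'k::finite^'r::finite"
    and c :: "real \<Rightarrow> real^'r"
    and M :: "'w measure"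
    and x :: "'k \<Rightarrow> nat \<Rightarrow> 'w \<Rightarrow> real \<Rightarrow> real"
    and v :: "'k \<Rightarrow> nat \<Rightarrow> 'w \<Rightarrow> real \<Rightarrow> real"
    and \<eta> :: "'k \<Rightarrow> real \<Rightarrow> real"
    and \<gamma> :: "'k \<Rightarrow> real \<Rightarrow> real \<Rightarrow> real"
    and ns :: "nat \<Rightarrow> 'k \<Rightarrow> nat"
    and \<tau> :: "'k \<Rightarrow> real"
    and N :: "'v measure"
    and z :: "'v \<Rightarrow> real \<Rightarrow> real^'r"
  assumes interval: "a \<le> b" "T = {a..b}"
    and c_meas: "c \<in> borel_measurable (lebesgue_on T)"
    and prob: "prob_space M"
    and v_def: "\<And>i j \<omega> t. v i j \<omega> t = x i j \<omega> t - \<eta> i t"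
    and indep: "prob_space.indep_vars M (\<lambda>_. path_space T) (\<lambda>(i, j). path_on T (x i j))
                  (UNIV \<times> {1..})"
    and ident: "\<And>i j. j \<ge> 1 \<Longrightarrow>
                  distr M (path_space T) (path_on T (x i j)) = distr M (path_space T) (path_on T (x i 1))"
    and mean: "\<And>i j. j \<ge> 1 \<Longrightarrow> has_mean_function M T (x i j) (\<eta> i)"
    and cov: "\<And>i j. j \<ge> 1 \<Longrightarrow> has_covariance_function M T (x i j) (\<gamma> i)"
    and L2: "\<And>i j. j \<ge> 1 \<Longrightarrow> L2_process M T (x i j)"
    and eta_L2: "\<And>i. square_integrable T (\<eta> i)"
    and gamma_cont: "\<And>i. continuous_on T (\<lambda>t. \<gamma> i t t)"
    and gamma_pos: "\<And>i t. t \<in> T \<Longrightarrow> \<gamma> i t t > 0"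
    and size: "filterlim (\<lambda>l. total_size (ns l)) at_top sequentially"
    and tau_pos: "\<And>i. \<tau> i > 0"
    and tau_lim: "\<And>i. (\<lambda>l. real (ns l i) / real (total_size (ns l))) \<longlonglongrightarrow> \<tau> i"
    and equicont: "\<And>i j. j \<in> {1, 2} \<Longrightarrow>
          ((\<lambda>\<delta>. outer_expectation M (\<lambda>\<omega>.
               SUP (t, s) \<in> {(t, s). t \<in> T \<and> s \<in> T \<and> \<bar>t - s\<bar> < \<delta>}.
                 ereal \<bar>v i 1 \<omega> t * v i j \<omega> t - v i 1 \<omega> s * v i j \<omega> s\<bar>))
            \<longlongrightarrow> 0) (at_right 0)"
    and null_hypothesis: "\<And>t. t \<in> T \<Longrightarrow> H *v (\<chi> i. \<eta> i t) = c t"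
    and prob_z: "prob_space N"
    and z: "centered_gaussian_process N T (\<lambda>t s. H ** Sigma_cov \<tau> \<gamma> t s ** transpose H) z"
  shows "converges_in_distribution
           M (\<lambda>l \<omega>. GPH_statistic T H c (ns l) (\<lambda>i j. x i j \<omega>))
           N (\<lambda>\<omega>. \<integral>t. z \<omega> t \<bullet>
                     (pinv (H ** Sigma_cov \<tau> \<gamma> t t ** transpose H) *v z \<omega> t) \<partial>lebesgue_on T)"
proof -
  interpret S: samples M a b T H x \<eta> \<gamma> ns \<tau>
    by (intro samples.intro samples_axioms.intro prob interval indep ident mean cov L2 eta_L2
        gamma_cont gamma_pos size tau_pos tau_lim)
  have v: "S.v = v" by (simp add: fun_eq_iff S.v_def v_def)
  show ?thesis by (rule S.limit_theorem[unfolded v, OF equicont null_hypothesis prob_z z])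
qed

end
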